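(* Let $n\geq 2$ be an integer, let $S=K[x_1,\ldots,x_n]$ and let $\mathbf m=(x_1,\ldots,x_n)\subset S$. Then $$\operatorname{hdepth}(\mathbf m)= \left\lceil \frac{n}{2} \right\rceil .$$
   Context: $K$ is an infinite field and $S=K[x_1,\ldots,x_n]$ is the polynomial ring with the standard $\mathbb Z$-grading ($\deg x_i=1$). For a finitely generated graded $S$-module $M$, the Hilbert depth $\operatorname{hdepth}(M)$ is the maximal depth of a finitely generated graded $S$-module $N$ having the same Hilbert series as $M$. *)

theory Defs
  imports
    "Jordan_Normal_Form.VS_Connect"
    "HOL-Algebra.Ideal"
    "HOL-Library.Poly_Mapping"
    "HOL-Library.Extended_Nat"
    "HOL-Library.Cardinality"
    "HOL-Computational_Algebra.Formal_Laurent_Series"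
begin

hide_const (open) Multiset.mult Polynomial.smult

text \<open>
  The polynomial ring over \<open>'k\<close> whose variables are indexed by the finite type \<open>'n\<close>: a polynomial
  maps exponent vectors to coefficients. As an object of HOL-Algebra it is \<open>class_ring\<close>.
\<close>

type_synonym ('n, 'k) mpoly = "('n \<Rightarrow>\<^sub>0 nat) \<Rightarrow>\<^sub>0 'k"

definition Var :: "'n \<Rightarrow> ('n, 'k::comm_ring_1) mpoly" where
  "Var i = Poly_Mapping.single (Poly_Mapping.single i 1) 1"

definition Const :: "'k::comm_ring_1 \<Rightarrow> ('n, 'k) mpoly" where
  "Const c = Poly_Mapping.single 0 c"

definition total_degree :: "('n::finite \<Rightarrow>\<^sub>0 nat) \<Rightarrow> nat" where
  "total_degree e = (\<Sum>i\<in>UNIV. Poly_Mapping.lookup e i)"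

definition homogeneous :: "int \<Rightarrow> ('n::finite, 'k::zero) mpoly \<Rightarrow> bool" where
  "homogeneous d p \<longleftrightarrow> (\<forall>e\<in>Poly_Mapping.keys p. int (total_degree e) = d)"

definition max_ideal :: "('n::finite, 'k::field) mpoly set" where
  "max_ideal = Idl\<^bsub>class_ring\<^esub> (range Var)"

text \<open>
  The ring fields \<open>mult\<close> and \<open>one\<close> that module records inherit carry no meaning.
\<close>

record ('a, 'b) graded_module = "('a, 'b) module" +
  component :: "int \<Rightarrow> 'b set"

locale graded_module = Module.module class_ring N
  for N :: "(('n::finite, 'k::field) mpoly, 'b) graded_module" (structure) +
  assumes component_subgroup: "subgroup (component N d) (add_monoid N)"
    and smult_component:
      "homogeneous i p \<Longrightarrow> x \<in> component N d \<Longrightarrow> p \<odot> x \<in> component N (i + d)"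
    and decomposition:
      "x \<in> carrier N \<Longrightarrow>
        \<exists>!f. (\<forall>d. f d \<in> component N d) \<and> finite {d. f d \<noteq> \<zero>} \<and> x = (\<Oplus>d\<in>{d. f d \<noteq> \<zero>}. f d)"

definition finitely_generated ::
    "(('n::finite, 'k::field) mpoly, 'b) graded_module \<Rightarrow> bool" where
  "finitely_generated N \<longleftrightarrow>
    (\<exists>X. finite X \<and> X \<subseteq> carrier N \<and> LinearCombinations.module.span class_ring N X = carrier N)"

definition component_space ::
    "(('n::finite, 'k::field) mpoly, 'b) graded_module \<Rightarrow> int \<Rightarrow> ('k, 'b) module" where
  "component_space N d =
    \<lparr>carrier = component N d, mult = mult N, one = one N, zero = zero N, add = add N,
     smult = (\<lambda>c x. Const c \<odot>\<^bsub>N\<^esub> x)\<rparr>"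

text \<open>
  A finitely generated graded module has finite-dimensional components, which vanish in all
  sufficiently negative degrees, so that \<open>Abs_fls\<close> and \<open>dim\<close> are meaningful here.
\<close>

definition hilbert_series ::
    "(('n::finite, 'k::field) mpoly, 'b) graded_module \<Rightarrow> int fls" where
  "hilbert_series N = Abs_fls (\<lambda>d. int (vectorspace.dim class_ring (component_space N d)))"

definition seq_submodule ::
    "(('n::finite, 'k::field) mpoly, 'b) graded_module \<Rightarrow> ('n, 'k) mpoly list \<Rightarrow> 'b set" where
  "seq_submodule N rs =
    LinearCombinations.module.span class_ring N {r \<odot>\<^bsub>N\<^esub> x | r x. r \<in> set rs \<and> x \<in> carrier N}"

text \<open>
  The first condition says that \<open>r\<^sub>i\<close> is a nonzerodivisor on
  \<open>N / (r\<^sub>1, \<dots>, r\<^sub>i\<^sub>-\<^sub>1) N\<close>.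
\<close>

definition regular_sequence ::
    "(('n::finite, 'k::field) mpoly, 'b) graded_module \<Rightarrow> ('n, 'k) mpoly list \<Rightarrow> bool" where
  "regular_sequence N rs \<longleftrightarrow>
    (\<forall>i<length rs. \<forall>x\<in>carrier N.
      (rs ! i) \<odot>\<^bsub>N\<^esub> x \<in> seq_submodule N (take i rs) \<longrightarrow> x \<in> seq_submodule N (take i rs)) \<and>
    seq_submodule N rs \<noteq> carrier N"

text \<open>
  The depth is the maximal length of a regular sequence in the graded maximal ideal; its elements
  need not be homogeneous. The zero module has infinite depth by convention.
\<close>

definition depth :: "(('n::finite, 'k::field) mpoly, 'b) graded_module \<Rightarrow> enat" where
  "depth N =
    (if carrier N = {\<zero>\<^bsub>N\<^esub>} then \<infinity>
     else Sup {enat (length rs) | rs. set rs \<subseteq> max_ideal \<and> regular_sequence N rs})"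

text \<open>
  A quantifier over all modules has to fix the type of their elements. The type
  \<open>nat \<Rightarrow>\<^sub>0 ('n, 'k) mpoly\<close>, the free module of countable rank, is large enough for every finitely
  generated graded module to be isomorphic to one with elements in this type; \<open>exists_copy\<close> below
  shows that the choice does not restrict the supremum. The supremum of a set of \<open>enat\<close>s with
  a finite positive value is attained, so it is a maximum in that case.
\<close>

definition hdepth :: "(('n::finite, 'k::field) mpoly, 'b) graded_module \<Rightarrow> enat" where
  "hdepth M =
    Sup {depth N | N :: (('n, 'k) mpoly, nat \<Rightarrow>\<^sub>0 ('n, 'k) mpoly) graded_module.
      graded_module N \<and> finitely_generated N \<and> hilbert_series N = hilbert_series M}"

definition max_ideal_module ::
    "(('n::finite, 'k::field) mpoly, ('n, 'k) mpoly) graded_module" where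
  "max_ideal_module =
    \<lparr>carrier = max_ideal, mult = (*), one = 1, zero = 0, add = (+), smult = (*),
     component = (\<lambda>d. {p \<in> max_ideal. homogeneous d p})\<rparr>"

lemma (in graded_module) component_subset: "component N d \<subseteq> carrier N"
  using subgroup.subset[OF component_subgroup] by simp

lemma finitely_generated_injection:
  fixes N :: "(('n::finite, 'k::field) mpoly, 'b) graded_module"
  assumes "graded_module N" and "finitely_generated N"
  obtains \<iota> :: "'b \<Rightarrow> (nat \<Rightarrow>\<^sub>0 ('n, 'k) mpoly)" where "inj_on \<iota> (carrier N)"
proof -
  interpret graded_module N by fact
  obtain X where X: "finite X" "X \<subseteq> carrier N" "span X = carrier N"
    using assms(2) unfolding finitely_generated_def by blast
  obtain h :: "'b \<Rightarrow> nat" where h: "inj_on h X"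
    using finite_imp_inj_to_nat_seg[OF X(1)] by metis
  have "\<exists>a. x = lincomb a X" if "x \<in> carrier N" for x
    using that X finite_span[OF X(1,2)] by auto
  then obtain A where A: "\<And>x. x \<in> carrier N \<Longrightarrow> x = lincomb (A x) X"
    by metis
  define \<iota> where "\<iota> x = (\<Sum>g\<in>X. Poly_Mapping.single (h g) (A x g))" for x
  have lookup: "Poly_Mapping.lookup (\<iota> x) (h g) = A x g" if "g \<in> X" for x g
  proof -
    have "Poly_Mapping.lookup (\<iota> x) (h g) = (\<Sum>g'\<in>X. if g' = g then A x g else 0)"
      unfolding \<iota>_def lookup_sum
      by (rule sum.cong) (use h that in \<open>auto simp: lookup_single when_def inj_on_def\<close>)
    then show ?thesis using that X(1) by simp
  qed
  have "inj_on \<iota> (carrier N)"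
  proof (rule inj_onI)
    fix x y assume xy: "x \<in> carrier N" "y \<in> carrier N" "\<iota> x = \<iota> y"
    then have "A x g = A y g" if "g \<in> X" for g using lookup[OF that] by metis
    then have "lincomb (A x) X = lincomb (A y) X"
      by (intro lincomb_cong) (use X(2) in auto)
    then show "x = y" using A xy by metis
  qed
  then show thesis by (rule that)
qed

lemma graded_module_transport:
  fixes N :: "(('n::finite, 'k::field) mpoly, 'b) graded_module" (structure) and \<iota> :: "'b \<Rightarrow> 'c"
  assumes "graded_module N" and "inj_on \<iota> (carrier N)"
  defines "g \<equiv> inv_into (carrier N) \<iota>"
  defines "N' \<equiv> \<lparr>carrier = \<iota> ` carrier N, mult = (\<lambda>x y. \<iota> (mult N (g x) (g y))), one = \<iota> (one N),
      zero = \<iota> (zero N), add = (\<lambda>x y. \<iota> (add N (g x) (g y))), smult = (\<lambda>p x. \<iota> (smult N p (g x))),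
      component = (\<lambda>d. \<iota> ` component N d)\<rparr>"
  shows "graded_module N'" "\<iota> \<in> LinearCombinations.module_hom class_ring N N'"
proof -
  interpret graded_module N by fact
  have g[simp]: "g (\<iota> x) = x" if "x \<in> carrier N" for x
    using that assms(2) by (simp add: g_def)
  have mod: "Module.module class_ring N'"
  proof (rule moduleI)
    show "cring (class_ring :: ('n,'k) mpoly ring)" by (rule class_cring.cring_axioms)
    show "abelian_group N'"
    proof (rule abelian_groupI)
      fix x assume "x \<in> carrier N'"
      then obtain u where "u \<in> carrier N" "x = \<iota> u" by (auto simp: N'_def)
      then show "\<exists>y\<in>carrier N'. y \<oplus>\<^bsub>N'\<^esub> x = \<zero>\<^bsub>N'\<^esub>"
        by (auto simp: N'_def M.l_neg intro!: bexI[of _ "\<ominus> u"])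
    qed (auto simp: N'_def M.a_ac)
  qed (auto simp: N'_def smult_l_distr[simplified] smult_r_distr[simplified]
        smult_assoc1[simplified] smult_one[simplified])
  show hom: "\<iota> \<in> LinearCombinations.module_hom class_ring N N'"
    by (auto simp: LinearCombinations.module_hom_def N'_def)
  interpret N': Module.module class_ring N' by fact
  interpret mod_hom class_ring N N' \<iota>
    by (intro mod_hom.intro mod mod_hom_axioms.intro hom) unfold_locales
  note [simp del] = f0_is_0 f_add f_smult f_neg f_minus
  have inj: "\<iota> x = \<iota> y \<longleftrightarrow> x = y" if "x \<in> carrier N" "y \<in> carrier N" for x y
    using assms(2) that by (auto dest: inj_onD)
  have comp: "x \<in> component N d \<Longrightarrow> x \<in> carrier N" for x d
    using subgroup.subset[OF component_subgroup] by auto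
  have sum: "finsum N' (\<lambda>d. \<iota> (F d)) A = \<iota> (finsum N F A)"
    if "finite A" "\<And>d. F d \<in> carrier N" for F and A :: "int set"
    using that(1)
  proof (induction A rule: finite_induct)
    case (insert a A)
    have "finsum N' (\<lambda>d. \<iota> (F d)) (insert a A) = \<iota> (F a) \<oplus>\<^bsub>N'\<^esub> finsum N' (\<lambda>d. \<iota> (F d)) A"
      using insert.hyps that(2) by (intro N'.finsum_insert) (simp_all add: Pi_def)
    also have "\<dots> = \<iota> (F a \<oplus> finsum N F A)"
      unfolding insert.IH by (rule f_add[symmetric]) (simp_all add: that(2) M.finsum_closed Pi_def)
    also have "F a \<oplus> finsum N F A = finsum N F (insert a A)"
      using insert.hyps that(2) by (intro M.finsum_insert[symmetric]) (simp_all add: Pi_def)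
    finally show ?case .
  qed (simp only: N'.finsum_empty M.finsum_empty f0_is_0)
  have zero': "\<zero>\<^bsub>N'\<^esub> = \<iota> \<zero>" by (simp add: N'_def)
  have component': "component N' d = \<iota> ` component N d" for d by (simp add: N'_def)
  show "graded_module N'"
  proof (intro graded_module.intro mod graded_module_axioms.intro)
    fix d
    show "subgroup (component N' d) (add_monoid N')"
    proof (rule group.subgroupI)
      show "group (add_monoid N')" by (rule N'.a_group)
      show "component N' d \<subseteq> carrier (add_monoid N')" using comp by (auto simp: N'_def)
      show "component N' d \<noteq> {}"
        using subgroup.one_closed[OF component_subgroup[of d]] by (auto simp: component')
      fix a b assume "a \<in> component N' d" "b \<in> component N' d"
      then obtain u v where uv: "u \<in> component N d" "v \<in> component N d" "a = \<iota> u" "b = \<iota> v"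
        by (auto simp: component')
      have "\<ominus> u \<in> component N d"
        using subgroup.m_inv_closed[OF component_subgroup uv(1)] by (simp add: a_inv_def)
      moreover have "inv\<^bsub>add_monoid N'\<^esub> a = \<iota> (\<ominus> u)"
        using f_neg[OF comp[OF uv(1)]] uv by (simp add: a_inv_def)
      ultimately show "inv\<^bsub>add_monoid N'\<^esub> a \<in> component N' d" by (simp add: component')
      have "u \<oplus> v \<in> component N d"
        using subgroup.m_closed[OF component_subgroup uv(1,2)] by simp
      then show "a \<otimes>\<^bsub>add_monoid N'\<^esub> b \<in> component N' d"
        using uv comp by (auto simp: component' simp flip: f_add)
    qed
  next
    fix i d x and p :: "('n, 'k) mpoly"
    assume "homogeneous i p" "x \<in> component N' d"
    then show "p \<odot>\<^bsub>N'\<^esub> x \<in> component N' (i + d)"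
      using smult_component[of i p _ d] comp by (auto simp: N'_def)
  next
    fix x assume "x \<in> carrier N'"
    then obtain u where u: "u \<in> carrier N" "x = \<iota> u" by (auto simp: N'_def)
    obtain F where F: "\<And>d. F d \<in> component N d" "finite {d. F d \<noteq> \<zero>}"
        "u = (\<Oplus>d\<in>{d. F d \<noteq> \<zero>}. F d)"
      and uniq: "\<And>G. (\<forall>d. G d \<in> component N d) \<and> finite {d. G d \<noteq> \<zero>} \<and>
        u = (\<Oplus>d\<in>{d. G d \<noteq> \<zero>}. G d) \<Longrightarrow> G = F"
      using decomposition[OF u(1)] by (elim ex1E) blast
    have supp: "{d. \<iota> (G d) \<noteq> \<iota> \<zero>} = {d. G d \<noteq> \<zero>}" if "\<And>d. G d \<in> component N d" for G
      using that comp inj by (metis M.zero_closed)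
    show "\<exists>!f. (\<forall>d. f d \<in> component N' d) \<and> finite {d. f d \<noteq> \<zero>\<^bsub>N'\<^esub>} \<and>
      x = (\<Oplus>\<^bsub>N'\<^esub>d\<in>{d. f d \<noteq> \<zero>\<^bsub>N'\<^esub>}. f d)"
    proof (rule ex1I[of _ "\<lambda>d. \<iota> (F d)"])
      show "(\<forall>d. \<iota> (F d) \<in> component N' d) \<and> finite {d. \<iota> (F d) \<noteq> \<zero>\<^bsub>N'\<^esub>} \<and>
        x = (\<Oplus>\<^bsub>N'\<^esub>d\<in>{d. \<iota> (F d) \<noteq> \<zero>\<^bsub>N'\<^esub>}. \<iota> (F d))"
        using F u sum[OF F(2) comp[OF F(1)]] by (simp add: component' zero' supp)
    next
      fix f assume f: "(\<forall>d. f d \<in> component N' d) \<and> finite {d. f d \<noteq> \<zero>\<^bsub>N'\<^esub>} \<and>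
        x = (\<Oplus>\<^bsub>N'\<^esub>d\<in>{d. f d \<noteq> \<zero>\<^bsub>N'\<^esub>}. f d)"
      then have "\<forall>d. \<exists>v. v \<in> component N d \<and> f d = \<iota> v" by (auto simp: component')
      then obtain G where G: "\<And>d. G d \<in> component N d" "\<And>d. f d = \<iota> (G d)" by metis
      have f_eq: "f = (\<lambda>d. \<iota> (G d))" using G by auto
      have fin: "finite {d. G d \<noteq> \<zero>}" using f G(1) by (simp add: f_eq zero' supp)
      have "\<iota> u = \<iota> (\<Oplus>d\<in>{d. G d \<noteq> \<zero>}. G d)"
        using f G(1) u sum[OF fin comp[OF G(1)]] by (simp add: f_eq zero' supp)
      then have "u = (\<Oplus>d\<in>{d. G d \<noteq> \<zero>}. G d)"
        by (rule inj[THEN iffD1, OF u(1) M.finsum_closed, rotated]) (use comp[OF G(1)] in auto)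
      with uniq G(1) fin have "G = F" by blast
      then show "f = (\<lambda>d. \<iota> (F d))" using f_eq by simp
    qed
  qed
qed

lemma span_image:
  fixes R :: "('a, 'm) ring_scheme"
  assumes "Module.module R M" "Module.module R M'" "f \<in> LinearCombinations.module_hom R M M'"
    and inj: "inj_on f (carrier M)" and X: "X \<subseteq> carrier M"
  shows "LinearCombinations.module.span R M' (f ` X) = f ` LinearCombinations.module.span R M X"
proof -
  interpret mod_hom R M M' f
    by (intro mod_hom.intro mod_hom_axioms.intro assms)
  have key: "f (M.lincomb a A) = N.lincomb b (f ` A)"
    if A: "finite A" "A \<subseteq> carrier M" and a: "a \<in> A \<rightarrow> carrier R" and ab: "\<And>v. v \<in> A \<Longrightarrow> b (f v) = a v"
    for a b A
    using A a ab
  proof (induction A rule: finite_induct)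
    case (insert v A)
    then have "f v \<notin> f ` A" using inj by (auto dest: inj_onD)
    moreover have "(\<lambda>w. b w \<odot>\<^bsub>M'\<^esub> w) \<in> f ` A \<rightarrow> carrier M'"
      using insert.prems by (auto simp: Pi_def subset_iff)
    moreover have "b (f v) \<odot>\<^bsub>M'\<^esub> f v \<in> carrier M'"
      using insert.prems by (auto simp: Pi_def)
    ultimately show ?case using insert
      by (simp add: M.lincomb_def N.lincomb_def M.M.finsum_insert N.M.finsum_insert Pi_def image_subset_iff subset_iff)
  qed (simp add: M.lincomb_def N.lincomb_def)
  show ?thesis
  proof (intro equalityI subsetI)
    fix y assume "y \<in> N.span (f ` X)"
    then obtain b B where B: "finite B" "B \<subseteq> f ` X" "b \<in> B \<rightarrow> carrier R" "y = N.lincomb b B"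
      by (auto simp: N.span_def)
    obtain A where A: "A \<subseteq> X" "finite A" "B = f ` A" using B finite_subset_image by metis
    have "f (M.lincomb (\<lambda>v. b (f v)) A) = y"
      using key[of A "\<lambda>v. b (f v)" b] A B X by auto
    moreover have "M.lincomb (\<lambda>v. b (f v)) A \<in> M.span X"
      unfolding M.span_def
      by (intro CollectI exI[of _ "\<lambda>v. b (f v)"] exI[of _ A]) (use A B in auto)
    ultimately show "y \<in> f ` M.span X" by blast
  next
    fix y assume "y \<in> f ` M.span X"
    then obtain a A where A: "finite A" "A \<subseteq> X" "a \<in> A \<rightarrow> carrier R" "y = f (M.lincomb a A)"
      by (auto simp: M.span_def)
    have inv: "inv_into (carrier M) f (f v) = v" if "v \<in> A" for v
      using that A X inj by auto
    have "y = N.lincomb (\<lambda>w. a (inv_into (carrier M) f w)) (f ` A)"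
      using key[of A a "\<lambda>w. a (inv_into (carrier M) f w)"] A X inv by auto
    moreover have "(\<lambda>w. a (inv_into (carrier M) f w)) \<in> f ` A \<rightarrow> carrier R"
      using A inv by auto
    ultimately show "y \<in> N.span (f ` X)"
      unfolding N.span_def
      by (intro CollectI exI[of _ "\<lambda>w. a (inv_into (carrier M) f w)"] exI[of _ "f ` A"])
        (use A in auto)
  qed
qed

lemma component_space_vectorspace:
  fixes N :: "(('n::finite, 'k::field) mpoly, 'b) graded_module" (structure)
  assumes "graded_module N"
  shows "vectorspace class_ring (component_space N d)"
proof -
  interpret graded_module N by fact
  have comp: "x \<in> component N d \<Longrightarrow> x \<in> carrier N" for x
    using subgroup.subset[OF component_subgroup] by auto
  have hom0: "homogeneous 0 (Const c :: ('n, 'k) mpoly)" for c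
    by (auto simp: homogeneous_def Const_def total_degree_def split: if_splits)
  have Const: "Const (a + b) = Const a + (Const b :: ('n, 'k) mpoly)"
    "Const (a * b) = Const a * (Const b :: ('n, 'k) mpoly)" "Const 1 = (1 :: ('n, 'k) mpoly)" for a b
    by (simp_all add: Const_def single_add mult_single)
  have sm: "Const c \<odot> x \<in> component N d" if "x \<in> component N d" for c x
    using smult_component[OF hom0 that] by simp
  have add: "x \<oplus> y \<in> component N d" if "x \<in> component N d" "y \<in> component N d" for x y
    using subgroup.m_closed[OF component_subgroup that] by simp
  have zero: "\<zero> \<in> component N d"
    using subgroup.one_closed[OF component_subgroup[of d]] by simp
  have neg: "\<ominus> x \<in> component N d" if "x \<in> component N d" for x
    using subgroup.m_inv_closed[OF component_subgroup that] by (simp add: a_inv_def)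
  have "Module.module class_ring (component_space N d)"
  proof (rule moduleI)
    show "cring (class_ring :: 'k ring)" by (rule class_cring.cring_axioms)
    show "abelian_group (component_space N d)"
    proof (rule abelian_groupI)
      fix x assume "x \<in> carrier (component_space N d)"
      then show "\<exists>y\<in>carrier (component_space N d).
          y \<oplus>\<^bsub>component_space N d\<^esub> x = \<zero>\<^bsub>component_space N d\<^esub>"
        using neg comp by (auto simp: component_space_def M.l_neg intro!: bexI[of _ "\<ominus> x"])
    qed (use add zero comp in \<open>auto simp: component_space_def M.a_ac\<close>)
  qed (use sm comp in \<open>auto simp: component_space_def Const smult_l_distr[simplified]
         smult_r_distr[simplified] smult_assoc1[simplified] smult_one[simplified]\<close>)
  then show ?thesis
    by (intro vectorspace.intro) (auto intro: class_field.field_axioms)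
qed

text \<open>
  The element type fixed in \<open>hdepth\<close> loses no module: over any other element type, finitely
  generated graded modules realize the same pairs of Hilbert series and depth.
\<close>

lemma exists_copy:
  fixes N :: "(('n::finite, 'k::field) mpoly, 'b) graded_module"
  assumes "graded_module N" and "finitely_generated N"
  shows "\<exists>N' :: (('n, 'k) mpoly, nat \<Rightarrow>\<^sub>0 ('n, 'k) mpoly) graded_module.
    graded_module N' \<and> finitely_generated N' \<and>
    hilbert_series N' = hilbert_series N \<and> depth N' = depth N"
proof -
  obtain f :: "'b \<Rightarrow> (nat \<Rightarrow>\<^sub>0 ('n, 'k) mpoly)" where inj: "inj_on f (carrier N)"
    using finitely_generated_injection[OF assms] .
  obtain N' :: "(('n, 'k) mpoly, nat \<Rightarrow>\<^sub>0 ('n, 'k) mpoly) graded_module"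
    where N': "graded_module N'" "f \<in> LinearCombinations.module_hom class_ring N N'"
      and carrier: "carrier N' = f ` carrier N"
      and comp: "\<And>d. component N' d = f ` component N d"
    using graded_module_transport[OF assms(1) inj] by fastforce
  interpret N: graded_module N by fact
  interpret N': graded_module N' by fact
  interpret mod_hom class_ring N N' f
    by (intro mod_hom.intro mod_hom_axioms.intro N' N.module_axioms N'.module_axioms)
  have span: "N'.span (f ` X) = f ` N.span X" if "X \<subseteq> carrier N" for X
    using span_image[OF N.module_axioms N'.module_axioms N'(2) inj that] .
  have span_sub: "N.span X \<subseteq> carrier N" if "X \<subseteq> carrier N" for X
    using N.span_is_subset2[OF that] .
  have fg: "finitely_generated N'"
    using assms(2) span carrier unfolding finitely_generated_def
    by (metis finite_imageI image_mono)
  have sub: "component N d \<subseteq> carrier N" for d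
    using subgroup.subset[OF N.component_subgroup] by simp
  have dim: "vectorspace.dim class_ring (component_space N' d) =
      vectorspace.dim class_ring (component_space N d)" for d
  proof -
    interpret V: vectorspace class_ring "component_space N d"
      by (rule component_space_vectorspace) fact
    interpret V': vectorspace class_ring "component_space N' d"
      by (rule component_space_vectorspace) fact
    have cV: "carrier (component_space N d) = component N d"
      "carrier (component_space N' d) = f ` component N d"
      by (simp_all add: component_space_def comp)
    have "f \<in> LinearCombinations.module_hom class_ring (component_space N d) (component_space N' d)"
      using sub by (auto simp: LinearCombinations.module_hom_def component_space_def comp subset_iff)
    then have sp: "V'.span (f ` A) = f ` V.span A" if "A \<subseteq> component N d" for A
      using span_image[OF V.module_axioms V'.module_axioms] that inj_on_subset[OF inj sub] cV by metis
    have spV: "V.span A \<subseteq> component N d" if "A \<subseteq> component N d" for A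
      using V.span_is_subset2[of A] that cV by simp
    have injd: "inj_on f (component N d)" using inj_on_subset[OF inj sub] .
    have "(\<exists>B. finite B \<and> card B = n \<and> B \<subseteq> f ` component N d \<and> V'.span B = f ` component N d) \<longleftrightarrow>
      (\<exists>A. finite A \<and> card A = n \<and> A \<subseteq> component N d \<and> V.span A = component N d)"
      (is "?L \<longleftrightarrow> ?R") for n
    proof
      assume ?R
      then obtain A where A: "finite A" "card A = n" "A \<subseteq> component N d" "V.span A = component N d" by blast
      then have "card (f ` A) = n" using card_image[OF inj_on_subset[OF injd A(3)]] by simp
      then show ?L using A sp[OF A(3)] by (intro exI[of _ "f ` A"]) auto
    next
      assume ?L
      then obtain B where B: "finite B" "card B = n" "B \<subseteq> f ` component N d" "V'.span B = f ` component N d"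
        by blast
      then obtain A where A: "A \<subseteq> component N d" "finite A" "B = f ` A" using finite_subset_image by metis
      have "card A = n" using card_image[OF inj_on_subset[OF injd A(1)]] A B by simp
      moreover have "f ` V.span A = f ` component N d" using sp[OF A(1)] A B by simp
      then have "V.span A = component N d"
        using inj_on_image_eq_iff[OF injd spV[OF A(1)] order_refl] by simp
      ultimately show ?R using A by blast
    qed
    then show ?thesis unfolding V.dim_def V'.dim_def cV by simp
  qed
  have ss_sub: "{r \<odot>\<^bsub>N\<^esub> x | r x. r \<in> set rs \<and> x \<in> carrier N} \<subseteq> carrier N" for rs
    by auto
  have seq: "seq_submodule N' rs = f ` seq_submodule N rs" for rs
  proof -
    have "{r \<odot>\<^bsub>N'\<^esub> x | r x. r \<in> set rs \<and> x \<in> carrier N'} =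
        f ` {r \<odot>\<^bsub>N\<^esub> x | r x. r \<in> set rs \<and> x \<in> carrier N}"
      by (force simp: carrier)
    then show ?thesis unfolding seq_submodule_def using span[OF ss_sub] by simp
  qed
  have seq_sub: "seq_submodule N rs \<subseteq> carrier N" for rs
    unfolding seq_submodule_def by (rule span_sub[OF ss_sub])
  have mem: "f x \<in> seq_submodule N' rs \<longleftrightarrow> x \<in> seq_submodule N rs" if "x \<in> carrier N" for x rs
    unfolding seq using inj_on_image_mem_iff[OF inj that seq_sub] .
  have reg: "regular_sequence N' rs \<longleftrightarrow> regular_sequence N rs" for rs
  proof -
    have "seq_submodule N' rs = carrier N' \<longleftrightarrow> seq_submodule N rs = carrier N"
      unfolding seq carrier using inj_on_image_eq_iff[OF inj seq_sub order_refl] .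
    then show ?thesis
      unfolding regular_sequence_def by (simp add: carrier mem flip: f_smult)
  qed
  have "carrier N' = {\<zero>\<^bsub>N'\<^esub>} \<longleftrightarrow> carrier N = {\<zero>\<^bsub>N\<^esub>}"
    unfolding carrier f0_is_0[symmetric]
    using inj_on_image_eq_iff[OF inj, of "carrier N" "{\<zero>\<^bsub>N\<^esub>}"] by simp
  then have "depth N' = depth N" unfolding depth_def reg by simp
  moreover have "hilbert_series N' = hilbert_series N" unfolding hilbert_series_def dim ..
  ultimately show ?thesis using N'(1) fg by blast
qed

lemma uminus_class_ring: "a_inv (class_ring :: 'a::ring_1 ring) = uminus"
  by (simp only: class_ring_simps)
lemma class_ring_um:
  "inv\<^bsub>add_monoid (class_ring :: 'a::ring_1 ring)\<^esub> p = - p"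
  using fun_cong[OF uminus_class_ring, of p]
  by (simp add: a_inv_def)
lemma mem_max_ideal_iff:
  fixes p :: "('n::finite, 'k::field) mpoly"
  shows "p \<in> max_ideal \<longleftrightarrow> Poly_Mapping.lookup p 0 = 0"
proof
  let ?I = "{p :: ('n, 'k) mpoly. Poly_Mapping.lookup p 0 = 0}"
  have mult: "Poly_Mapping.lookup (p * q) 0 = 0" if "Poly_Mapping.lookup p 0 = 0" for p q :: "('n, 'k) mpoly"
  proof -
    have "0 \<notin> Poly_Mapping.keys (p * q)"
    proof
      assume "0 \<in> Poly_Mapping.keys (p * q)"
      then obtain a b where ab: "0 = a + b" "a \<in> Poly_Mapping.keys p"
        using keys_mult[of p q] by auto
      have "a = 0"
      proof (rule poly_mapping_eqI)
        fix k
        have "Poly_Mapping.lookup (a + b) k = 0" using ab(1) by (metis lookup_zero)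
        then show "Poly_Mapping.lookup a k = Poly_Mapping.lookup 0 k" by (simp add: lookup_add)
      qed
      then show False using ab(2) that by (simp add: in_keys_iff)
    qed
    then show ?thesis by (simp add: in_keys_iff)
  qed
  have "ideal ?I (class_ring :: ('n, 'k) mpoly ring)"
  proof (rule idealI)
    show "ring (class_ring :: ('n, 'k) mpoly ring)" by (rule class_ring.ring_axioms)
    have *: "group (add_monoid (class_ring :: ('n, 'k) mpoly ring))"
      using class_ring.a_group by simp
    have um: "inv\<^bsub>add_monoid (class_ring :: ('n, 'k) mpoly ring)\<^esub> p = - p" for p :: "('n, 'k) mpoly"
      by (rule class_ring_um)
    show "subgroup ?I (add_monoid (class_ring :: ('n, 'k) mpoly ring))"
      by (rule group.subgroupI[OF *]) (auto simp: um[simplified] lookup_add intro: exI[of _ 0])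
  qed (auto simp: mult mult.commute[of _ "_ :: ('n, 'k) mpoly"] simp del: mult_cancel_left)
  moreover have "range Var \<subseteq> ?I" by (auto simp: Var_def lookup_single when_def) (metis lookup_single_eq lookup_zero nat.distinct(1))
  ultimately show "p \<in> max_ideal \<Longrightarrow> Poly_Mapping.lookup p 0 = 0"
    unfolding max_ideal_def genideal_def by blast
next
  assume p: "Poly_Mapping.lookup p 0 = 0"
  have id: "ideal (max_ideal :: ('n, 'k) mpoly set) class_ring"
    unfolding max_ideal_def by (rule ring.genideal_ideal[OF class_ring.ring_axioms]) simp
  have Var: "Var i \<in> (max_ideal :: ('n, 'k) mpoly set)" for i
    unfolding max_ideal_def using ring.genideal_self[OF class_ring.ring_axioms, of "range Var"] by auto
  have single: "Poly_Mapping.single e c \<in> (max_ideal :: ('n, 'k) mpoly set)" if "e \<noteq> 0" for e c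
  proof -
    obtain i where i: "Poly_Mapping.lookup e i \<noteq> 0" using \<open>e \<noteq> 0\<close> poly_mapping_eqI[of e 0] by auto
    have "e = (e - Poly_Mapping.single i 1) + Poly_Mapping.single i 1"
      by (rule poly_mapping_eqI) (use i in \<open>auto simp: lookup_add lookup_minus lookup_single when_def\<close>)
    then have "Poly_Mapping.single e c = Poly_Mapping.single (e - Poly_Mapping.single i 1) c * Var i"
      by (simp add: Var_def mult_single)
    then show ?thesis using ideal.I_l_closed[OF id Var[of i]] by simp
  qed
  have sum: "(\<Sum>e\<in>A. Poly_Mapping.single e (Poly_Mapping.lookup p e)) \<in> (max_ideal :: ('n, 'k) mpoly set)"
    if "finite A" "A \<subseteq> Poly_Mapping.keys p" for A
    using that
  proof (induction A rule: finite_induct)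
    case empty
    show ?case using additive_subgroup.zero_closed[OF ideal.axioms(1)[OF id]] by simp
  next
    case (insert e A)
    then have "e \<noteq> 0" using p by (auto simp: in_keys_iff)
    then show ?case
      using insert additive_subgroup.a_closed[OF ideal.axioms(1)[OF id] single[of e "Poly_Mapping.lookup p e"]]
      by simp
  qed
  have "p = (\<Sum>e\<in>Poly_Mapping.keys p. Poly_Mapping.single e (Poly_Mapping.lookup p e))"
    by (rule poly_mapping_eqI) (auto simp: lookup_sum lookup_single when_def in_keys_iff)
  then show "p \<in> max_ideal" using sum[of "Poly_Mapping.keys p"] by simp
qed

lemma graded_module_max_ideal:
  "graded_module (max_ideal_module :: (('n::finite, 'k::field) mpoly, ('n, 'k) mpoly) graded_module)"
proof -
  let ?M = "max_ideal_module :: (('n::finite, 'k::field) mpoly, ('n, 'k) mpoly) graded_module"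
  have id: "ideal (max_ideal :: ('n, 'k) mpoly set) class_ring"
    unfolding max_ideal_def by (rule ring.genideal_ideal[OF class_ring.ring_axioms]) simp
  have cl: "p * q \<in> max_ideal" if "q \<in> max_ideal" for p q :: "('n, 'k) mpoly"
    using ideal.I_l_closed[OF id that] by simp
  have mod: "Module.module class_ring ?M"
  proof (rule moduleI)
    show "cring (class_ring :: ('n,'k) mpoly ring)" by (rule class_cring.cring_axioms)
    show "abelian_group ?M"
    proof (rule abelian_groupI)
      fix x assume "x \<in> carrier ?M"
      then show "\<exists>y\<in>carrier ?M. y \<oplus>\<^bsub>?M\<^esub> x = \<zero>\<^bsub>?M\<^esub>"
        by (auto simp: max_ideal_module_def mem_max_ideal_iff intro!: bexI[of _ "- x"])
    qed (auto simp: max_ideal_module_def mem_max_ideal_iff lookup_add add_ac)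
  qed (auto simp: max_ideal_module_def cl algebra_simps)
  interpret M: Module.module class_ring ?M by fact
  have minus: "\<ominus>\<^bsub>?M\<^esub> x = - x" if "x \<in> carrier ?M" for x
  proof -
    have "- x \<in> carrier ?M" using that by (auto simp: max_ideal_module_def mem_max_ideal_iff)
    then show ?thesis using that by (intro M.minus_equality) (auto simp: max_ideal_module_def)
  qed
  have fs: "finsum ?M F A = sum F A" if "finite A" "\<And>d. F d \<in> max_ideal" for F and A :: "int set"
    using that
  proof (induction A rule: finite_induct)
    case empty
    have "\<zero>\<^bsub>?M\<^esub> = 0" by (simp add: max_ideal_module_def)
    then show ?case by simp
  next
    case (insert a A)
    then have "finsum ?M F (insert a A) = F a \<oplus>\<^bsub>?M\<^esub> finsum ?M F A"
      by (intro M.finsum_insert) (auto simp: max_ideal_module_def)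
    then show ?case using insert by (simp add: max_ideal_module_def)
  qed
  have hom_add: "homogeneous d (p + q)" if "homogeneous d p" "homogeneous d q" for d and p q :: "('n, 'k) mpoly"
    using that Poly_Mapping.keys_add[of p q] unfolding homogeneous_def by blast
  have hom_mult: "homogeneous (i + d) (p * q)" if "homogeneous i p" "homogeneous d q"
    for i d and p q :: "('n, 'k) mpoly"
    using that keys_mult[of p q]
    by (fastforce simp: homogeneous_def total_degree_def lookup_add sum.distrib)
  show ?thesis
  proof (intro graded_module.intro mod graded_module_axioms.intro)
    fix d
    show "subgroup (component ?M d) (add_monoid ?M)"
    proof (rule group.subgroupI)
      show "group (add_monoid ?M)" by (rule M.a_group)
      show "component ?M d \<noteq> {}"
        by (auto simp: max_ideal_module_def mem_max_ideal_iff homogeneous_def intro!: exI[of _ 0])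
      fix a assume a: "a \<in> component ?M d"
      then have "inv\<^bsub>add_monoid ?M\<^esub> a = - a"
        using minus[of a] by (auto simp: a_inv_def max_ideal_module_def)
      then show "inv\<^bsub>add_monoid ?M\<^esub> a \<in> component ?M d"
        using a by (auto simp: max_ideal_module_def mem_max_ideal_iff homogeneous_def in_keys_iff)
    qed (auto simp: max_ideal_module_def mem_max_ideal_iff hom_add lookup_add)
  next
    fix i d x and p :: "('n, 'k) mpoly"
    assume "homogeneous i p" "x \<in> component ?M d"
    then show "p \<odot>\<^bsub>?M\<^esub> x \<in> component ?M (i + d)"
      by (auto simp: max_ideal_module_def cl hom_mult)
  next
    fix p assume "p \<in> carrier ?M"
    then have p: "Poly_Mapping.lookup p 0 = 0" by (simp add: max_ideal_module_def mem_max_ideal_iff)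
    define D where "D = (\<lambda>e. int (total_degree e)) ` Poly_Mapping.keys p"
    define F where "F d = (\<Sum>e\<in>{e \<in> Poly_Mapping.keys p. int (total_degree e) = d}.
        Poly_Mapping.single e (Poly_Mapping.lookup p e))" for d
    have lF: "Poly_Mapping.lookup (F d) e = (if int (total_degree e) = d then Poly_Mapping.lookup p e else 0)" for d e
      by (auto simp: F_def lookup_sum lookup_single when_def in_keys_iff)
    have F_comp: "F d \<in> component ?M d" for d
      using p by (auto simp: max_ideal_module_def mem_max_ideal_iff lF homogeneous_def in_keys_iff split: if_splits)
    have suppF: "{d. F d \<noteq> 0} \<subseteq> D"
      unfolding D_def F_def by (auto intro!: sum.neutral)
    have finF: "finite {d. F d \<noteq> 0}" using suppF by (rule finite_subset) (simp add: D_def)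
    have lsum: "Poly_Mapping.lookup (sum G {d. G d \<noteq> 0}) e = Poly_Mapping.lookup (G (int (total_degree e))) e"
      if G: "\<And>d. G d \<in> component ?M d" "finite {d. G d \<noteq> 0}" for G e
    proof -
      have "Poly_Mapping.lookup (G d) e = 0" if "d \<noteq> int (total_degree e)" for d
        using G(1)[of d] that by (auto simp: max_ideal_module_def homogeneous_def in_keys_iff)
      then have "(\<Sum>d\<in>{d. G d \<noteq> 0}. Poly_Mapping.lookup (G d) e) =
          (\<Sum>d\<in>{d. G d \<noteq> 0}. if d = int (total_degree e) then Poly_Mapping.lookup (G d) e else 0)"
        by (intro sum.cong) auto
      also have "\<dots> = Poly_Mapping.lookup (G (int (total_degree e))) e"
        using G(2) by (simp add: sum.delta)
      finally show ?thesis by (simp add: lookup_sum)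
    qed
    have sub: "G d \<in> max_ideal" if "G d \<in> component ?M d" for G d
      using that by (simp add: max_ideal_module_def)
    have z: "\<zero>\<^bsub>?M\<^esub> = 0" by (simp add: max_ideal_module_def)
    show "\<exists>!f. (\<forall>d. f d \<in> component ?M d) \<and> finite {d. f d \<noteq> \<zero>\<^bsub>?M\<^esub>} \<and>
        p = (\<Oplus>\<^bsub>?M\<^esub>d\<in>{d. f d \<noteq> \<zero>\<^bsub>?M\<^esub>}. f d)"
    proof (rule ex1I[of _ F])
      have "p = sum F {d. F d \<noteq> 0}"
        by (rule poly_mapping_eqI) (simp add: lsum[OF F_comp finF] lF)
      then show "(\<forall>d. F d \<in> component ?M d) \<and> finite {d. F d \<noteq> \<zero>\<^bsub>?M\<^esub>} \<and>
        p = (\<Oplus>\<^bsub>?M\<^esub>d\<in>{d. F d \<noteq> \<zero>\<^bsub>?M\<^esub>}. F d)"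
        using F_comp finF sub by (simp add: z fs)
    next
      fix G assume "(\<forall>d. G d \<in> component ?M d) \<and> finite {d. G d \<noteq> \<zero>\<^bsub>?M\<^esub>} \<and>
        p = (\<Oplus>\<^bsub>?M\<^esub>d\<in>{d. G d \<noteq> \<zero>\<^bsub>?M\<^esub>}. G d)"
      then have G: "\<And>d. G d \<in> component ?M d" "finite {d. G d \<noteq> 0}" "p = sum G {d. G d \<noteq> 0}"
        using sub by (auto simp: z fs)
      have lG: "Poly_Mapping.lookup (G d) e = (if int (total_degree e) = d then Poly_Mapping.lookup p e else 0)" for d e
        using lsum[OF G(1,2)] G(1)[of d] G(3)[symmetric]
        by (auto simp: max_ideal_module_def homogeneous_def in_keys_iff)
      show "G = F" by (rule ext, rule poly_mapping_eqI) (simp add: lG lF)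
    qed
  qed
qed

lemma finitely_generated_max_ideal:
  "finitely_generated (max_ideal_module :: (('n::finite, 'k::field) mpoly, ('n, 'k) mpoly) graded_module)"
proof -
  let ?M = "max_ideal_module :: (('n::finite, 'k::field) mpoly, ('n, 'k) mpoly) graded_module"
  interpret graded_module ?M by (rule graded_module_max_ideal)
  have Var: "range Var \<subseteq> carrier ?M"
    unfolding max_ideal_module_def max_ideal_def using ring.genideal_self[OF class_ring.ring_axioms, of "range Var"] by auto
  have sm: "submodule class_ring (span (range Var)) ?M" by (rule span_is_submodule[OF Var])
  have sub: "span (range Var) \<subseteq> carrier ?M" by (rule span_is_subset2[OF Var])
  have "ideal (span (range Var)) (class_ring :: ('n, 'k) mpoly ring)"
  proof (rule idealI)
    show "ring (class_ring :: ('n, 'k) mpoly ring)" by (rule class_ring.ring_axioms)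
    have *: "group (add_monoid (class_ring :: ('n, 'k) mpoly ring))"
      using class_ring.a_group by simp
    have um: "inv\<^bsub>add_monoid (class_ring :: ('n, 'k) mpoly ring)\<^esub> p = - p" for p :: "('n, 'k) mpoly"
      by (rule class_ring_um)
    have 1: "p * q \<in> span (range Var)" if "q \<in> span (range Var)" for p q
      using submodule.smult_closed[OF sm _ that, of p] by (simp add: max_ideal_module_def)
    then show "x \<otimes>\<^bsub>class_ring\<^esub> a \<in> span (range Var)" "a \<otimes>\<^bsub>class_ring\<^esub> x \<in> span (range Var)"
      if "a \<in> span (range Var)" for a x :: "('n, 'k) mpoly"
      using that by (auto simp: mult.commute[of a])
    have "- p \<in> span (range Var)" if "p \<in> span (range Var)" for p
      using 1[OF that, of "- 1"] by simp
    moreover have "p + q \<in> span (range Var)" if "p \<in> span (range Var)" "q \<in> span (range Var)" for p q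
      using submodule.m_closed[OF sm that] by (simp add: max_ideal_module_def)
    moreover have "span (range Var) \<noteq> {}" using submodule.zero_closed[OF sm] by auto
    ultimately show "subgroup (span (range Var)) (add_monoid (class_ring :: ('n, 'k) mpoly ring))"
      by (intro group.subgroupI[OF *]) (auto simp: um[simplified])
  qed
  moreover have "range Var \<subseteq> span (range Var)" by (rule in_own_span[OF Var])
  ultimately have "max_ideal \<subseteq> span (range Var)"
    unfolding max_ideal_def genideal_def by blast
  then have "span (range Var) = carrier ?M" using sub by (auto simp: max_ideal_module_def)
  then show ?thesis unfolding finitely_generated_def using Var by (intro exI[of _ "range Var"]) auto
qed

end

theory Submission
  imports Defs
begin

text \<open>
  Let \<open>n\<close> be the number of variables, so that the claimed value is \<open>(n + 1) div 2\<close>.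

  Upper bound. Let \<open>N\<close> have the Hilbert series of the maximal ideal. Then \<open>N\<close> lives in
  positive degrees and has dimension \<open>n\<close> in degree 1 and \<open>n (n + 1) / 2\<close> in degree 2. If
  linear forms \<open>l\<^sub>1, \<dots>, l\<^sub>d\<close> are a regular sequence on \<open>N\<close>, then a relation \<open>\<Sum> l\<^sub>i y\<^sub>i = 0\<close> with all
  \<open>y\<^sub>i\<close> of degree 1 puts \<open>y\<^sub>d\<close> into \<open>(l\<^sub>1, \<dots>, l\<^sub>d\<^sub>-\<^sub>1) N\<close>, which lives in degrees at least 2, so that
  \<open>y\<^sub>d = 0\<close>, and then all other \<open>y\<^sub>i\<close> vanish in turn. Hence \<open>d n \<le> n (n + 1) / 2\<close>, and \<open>d \<le> (n + 1) / 2\<close>.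

  A regular sequence \<open>r\<^sub>1, \<dots>, r\<^sub>d\<close> in the maximal ideal need not consist of linear or even homogeneous
  elements, but it can be replaced by linear forms (\<open>regular_mod_by_pencil\<close>). None of the quotients
  \<open>N / (r\<^sub>1, \<dots>, r\<^sub>i\<^sub>-\<^sub>1) N\<close> contains a nonzero element killed by all variables, because \<open>r\<^sub>i\<close> would kill it
  too. As the field is infinite and the quotients are Noetherian, some linear form \<open>l\<close> is a
  nonzerodivisor on all of them (\<open>socle_of_infinitely_many_zerodivisors\<close>). So \<open>r\<^sub>1, \<dots>, r\<^sub>d\<^sub>-\<^sub>1, l\<close> is
  regular, and swapping neighbours moves \<open>l\<close> to the front (\<open>regular_mod_exchange\<close>). The argument
  goes on with \<open>r\<^sub>1, \<dots>, r\<^sub>d\<^sub>-\<^sub>1\<close> on \<open>N / l N\<close>.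

  Lower bound. With \<open>d = (n + 1) div 2\<close>, the series \<open>(1 - t)\<^sup>d (1 / (1 - t)\<^sup>n - 1)\<close> has
  nonnegative coefficients, and beyond degree \<open>d\<close> they are those of the polynomial ring in \<open>n - d\<close>
  variables. So the Hilbert series of the maximal ideal is also that of a direct sum of shifted
  polynomial rings in \<open>d\<close> variables and of one power of an ideal generated by the \<open>n - d\<close> other
  variables, and the \<open>d\<close> variables form a regular sequence on this sum
  (\<open>exists_module_of_depth_ge_half\<close>).
\<close>

section \<open>Noetherian modules and Hilbert's basis theorem\<close>

text \<open>
  The theory of regular sequences below works modulo submodules of one ambient module instead of
  forming quotients, so that every module lives on a type with an addition.
\<close>

locale ring_module = Modules.module scale
  for scale :: "'r::comm_ring_1 \<Rightarrow> 'a::ab_group_add \<Rightarrow> 'a" (infixr "\<cdot>" 75)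
begin

text \<open>
  Submodules over a part \<open>R\<close> of the ring, which need not be a subring: adding one ring element
  after the other to \<open>R\<close> is the induction over the variables in Hilbert's basis theorem.
\<close>

definition stable_subgroup :: "'r set \<Rightarrow> 'a set \<Rightarrow> bool" where
  "stable_subgroup R U \<longleftrightarrow> 0 \<in> U \<and> (\<forall>x\<in>U. \<forall>y\<in>U. x + y \<in> U) \<and> (\<forall>x\<in>U. - x \<in> U) \<and>
     (\<forall>r\<in>R. \<forall>x\<in>U. r \<cdot> x \<in> U)"

definition noetherian_over :: "'r set \<Rightarrow> 'a set \<Rightarrow> bool" where
  "noetherian_over R M \<longleftrightarrow> stable_subgroup R M \<and>
     (\<forall>U :: nat \<Rightarrow> 'a set. (\<forall>i. stable_subgroup R (U i) \<and> U i \<subseteq> M \<and> U i \<subseteq> U (Suc i)) \<longrightarrow>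
        (\<exists>k. \<forall>i\<ge>k. U i = U k))"

lemma stable_subgroupD:
  assumes "stable_subgroup R U"
  shows "0 \<in> U" "x \<in> U \<Longrightarrow> y \<in> U \<Longrightarrow> x + y \<in> U" "x \<in> U \<Longrightarrow> - x \<in> U"
    "r \<in> R \<Longrightarrow> x \<in> U \<Longrightarrow> r \<cdot> x \<in> U" "x \<in> U \<Longrightarrow> y \<in> U \<Longrightarrow> x - y \<in> U"
proof -
  show "x - y \<in> U" if "x \<in> U" "y \<in> U"
    using assms that unfolding stable_subgroup_def by (metis add_uminus_conv_diff)
qed (use assms in \<open>auto simp: stable_subgroup_def\<close>)

lemma noetherian_overD:
  assumes "noetherian_over R M" "\<And>i. stable_subgroup R (U i)" "\<And>i. U i \<subseteq> M" "\<And>i. U i \<subseteq> U (Suc i)"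
  shows "\<exists>k. \<forall>i\<ge>k. U i = U k"
  using assms unfolding noetherian_over_def by meson

text \<open>
  A submodule \<open>U\<close> of \<open>A + B\<close> is controlled by \<open>U \<inter> B\<close> and by its projection to \<open>A\<close>: if both agree
  for \<open>U \<subseteq> U'\<close>, then an element of \<open>U'\<close> differs from one of \<open>U\<close> by an element of \<open>U' \<inter> B = U \<inter> B\<close>.
\<close>

lemma noetherian_over_sum:
  assumes A: "noetherian_over R A" and B: "noetherian_over R B"
  shows "noetherian_over R {a + b | a b. a \<in> A \<and> b \<in> B}"
proof -
  have sA: "stable_subgroup R A" and sB: "stable_subgroup R B"
    using A B by (auto simp: noetherian_over_def)
  note a = stable_subgroupD[OF sA] and b = stable_subgroupD[OF sB]
  let ?S = "{a + b | a b. a \<in> A \<and> b \<in> B}"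
  have "stable_subgroup R ?S"
    unfolding stable_subgroup_def
  proof (intro conjI ballI)
    show "0 \<in> ?S" using a(1) b(1) by force
  next
    fix x y assume "x \<in> ?S" "y \<in> ?S"
    then obtain p q p' q' where "x = p + q" "y = p' + q'" "p \<in> A" "p' \<in> A" "q \<in> B" "q' \<in> B" by auto
    then show "x + y \<in> ?S" using a(2) b(2)
      by (intro CollectI exI[of _ "p + p'"] exI[of _ "q + q'"]) (auto simp: algebra_simps)
  next
    fix x assume "x \<in> ?S"
    then obtain p q where "x = p + q" "p \<in> A" "q \<in> B" by auto
    then show "- x \<in> ?S" using a(3) b(3)
      by (intro CollectI exI[of _ "- p"] exI[of _ "- q"]) (auto simp: algebra_simps)
  next
    fix x r assume "x \<in> ?S" "r \<in> R"
    then obtain p q where "x = p + q" "p \<in> A" "q \<in> B" "r \<in> R" by auto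
    then show "r \<cdot> x \<in> ?S" using a(4) b(4)
      by (intro CollectI exI[of _ "r \<cdot> p"] exI[of _ "r \<cdot> q"]) (auto simp: scale_right_distrib)
  qed
  moreover have "\<exists>k. \<forall>i\<ge>k. U i = U k"
    if U: "\<forall>i. stable_subgroup R (U i) \<and> U i \<subseteq> ?S \<and> U i \<subseteq> U (Suc i)" for U :: "nat \<Rightarrow> 'a set"
  proof -
    have sU: "stable_subgroup R (U i)" for i using U by blast
    note u = stable_subgroupD[OF sU]
    have mono: "U i \<subseteq> U j" if "i \<le> j" for i j using that U lift_Suc_mono_le[of U] by blast
    define L where "L i = {p \<in> A. \<exists>q\<in>B. p + q \<in> U i}" for i
    have sL: "stable_subgroup R (L i)" for i
      unfolding stable_subgroup_def
    proof (intro conjI ballI)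
      show "0 \<in> L i" using a(1) b(1) u(1) by (force simp: L_def)
    next
      fix x y assume "x \<in> L i" "y \<in> L i"
      then obtain q q' where "x \<in> A" "y \<in> A" "q \<in> B" "q' \<in> B" "x + q \<in> U i" "y + q' \<in> U i"
        by (auto simp: L_def)
      then show "x + y \<in> L i" using a(2) b(2) u(2)[of "x + q" i "y + q'"]
        by (auto simp: L_def algebra_simps intro!: bexI[of _ "q + q'"])
    next
      fix x assume "x \<in> L i"
      then obtain q where "x \<in> A" "q \<in> B" "x + q \<in> U i" by (auto simp: L_def)
      then show "- x \<in> L i" using a(3) b(3) u(3)[of "x + q" i]
        by (auto simp: L_def algebra_simps intro!: bexI[of _ "- q"])
    next
      fix x r assume "x \<in> L i" "r \<in> R"
      then obtain q where "r \<in> R" "x \<in> A" "q \<in> B" "x + q \<in> U i" by (auto simp: L_def)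
      then show "r \<cdot> x \<in> L i" using a(4) b(4) u(4)[of r "x + q" i]
        by (auto simp: L_def scale_right_distrib intro!: bexI[of _ "r \<cdot> q"])
    qed
    have "L i \<subseteq> A" "L i \<subseteq> L (Suc i)" for i using U by (auto simp: L_def)
    from noetherian_overD[of R A L, OF A sL this]
    obtain k where k: "\<And>i. i \<ge> k \<Longrightarrow> L i = L k" by blast
    have sUB: "stable_subgroup R (U i \<inter> B)" for i
      using sU[of i] sB by (auto simp: stable_subgroup_def)
    have "U i \<inter> B \<subseteq> B" "U i \<inter> B \<subseteq> U (Suc i) \<inter> B" for i using U by auto
    from noetherian_overD[of R B "\<lambda>i. U i \<inter> B", OF B sUB this]
    obtain l where l: "\<And>i. i \<ge> l \<Longrightarrow> U i \<inter> B = U l \<inter> B" by blast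
    have "U i \<subseteq> U (max k l)" if "i \<ge> max k l" for i
    proof
      fix x assume x: "x \<in> U i"
      then obtain p q where pq: "x = p + q" "p \<in> A" "q \<in> B" using U by blast
      then have "p \<in> L i" using x by (auto simp: L_def)
      then have "p \<in> L (max k l)" using k[of i] k[of "max k l"] that by simp
      then obtain q' where q': "q' \<in> B" "p + q' \<in> U (max k l)" by (auto simp: L_def)
      then have "x - (p + q') \<in> U i" using x mono[OF that] u(5) by blast
      then have "q - q' \<in> U i \<inter> B" using pq q' b(5) by simp
      then have "q - q' \<in> U (max k l)" using l[of i] l[of "max k l"] that by auto
      then show "x \<in> U (max k l)" using u(2)[OF q'(2)] pq by force
    qed
    then show ?thesis using mono by (intro exI[of _ "max k l"]) blast
  qed
  ultimately show ?thesis unfolding noetherian_over_def by blast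
qed

text \<open>
  Hilbert's basis theorem with \<open>M + x M + x\<^sup>2 M + \<dots>\<close> in the role of the polynomials over \<open>M\<close>. The
  sum need not be direct: \<open>D k\<close> collects the elements with an expression of degree less than \<open>k\<close>,
  and \<open>L k i\<close> the possible coefficients of \<open>x\<^sup>k\<close> in the expressions of degree at most \<open>k\<close> of elements
  of \<open>U i\<close>. The sets \<open>L k i\<close> grow in both arguments, so that the diagonal and finitely many rows
  decide when all of them have become stationary; from there on the chain \<open>U\<close> is constant.
\<close>

lemma hilbert_basis_step:
  assumes M: "noetherian_over R M"
  shows "\<exists>M'. M \<subseteq> M' \<and> noetherian_over (insert x R) M'"
proof -
  have sM: "stable_subgroup R M" using M by (auto simp: noetherian_over_def)
  note m = stable_subgroupD[OF sM]
  define D where "D = rec_nat {0::'a} (\<lambda>k S. {x ^ k \<cdot> a + b | a b. a \<in> M \<and> b \<in> S})"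
  have D0: "D 0 = {0}" and DS: "D (Suc k) = {x ^ k \<cdot> a + b | a b. a \<in> M \<and> b \<in> D k}" for k
    by (simp_all add: D_def)
  have comm: "r \<cdot> x ^ k \<cdot> a = x ^ k \<cdot> r \<cdot> a" for r k a by (simp add: mult.commute)
  have sD: "stable_subgroup R (D k)" for k
  proof (induction k)
    case 0 show ?case by (simp add: D0 stable_subgroup_def)
  next
    case (Suc k)
    note d = stable_subgroupD[OF Suc]
    show ?case unfolding stable_subgroup_def
    proof (intro conjI ballI)
      show "0 \<in> D (Suc k)" using m(1) d(1) unfolding DS by force
    next
      fix u v assume "u \<in> D (Suc k)" "v \<in> D (Suc k)"
      then obtain a b a' b' where "u = x ^ k \<cdot> a + b" "v = x ^ k \<cdot> a' + b'" "a \<in> M" "a' \<in> M" "b \<in> D k" "b' \<in> D k"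
        unfolding DS by auto
      then show "u + v \<in> D (Suc k)" unfolding DS using m(2) d(2)
        by (intro CollectI exI[of _ "a + a'"] exI[of _ "b + b'"]) (auto simp: scale_right_distrib algebra_simps)
    next
      fix u assume "u \<in> D (Suc k)"
      then obtain a b where "u = x ^ k \<cdot> a + b" "a \<in> M" "b \<in> D k" unfolding DS by auto
      then show "- u \<in> D (Suc k)" unfolding DS using m(3) d(3)
        by (intro CollectI exI[of _ "- a"] exI[of _ "- b"]) (auto simp: scale_minus_right)
    next
      fix u r assume "u \<in> D (Suc k)" "r \<in> R"
      then obtain a b where "u = x ^ k \<cdot> a + b" "a \<in> M" "b \<in> D k" "r \<in> R" unfolding DS by auto
      then show "r \<cdot> u \<in> D (Suc k)" unfolding DS using m(4) d(4)
        by (intro CollectI exI[of _ "r \<cdot> a"] exI[of _ "r \<cdot> b"]) (auto simp: scale_right_distrib mult.commute)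
    qed
  qed
  note d = stable_subgroupD[OF sD]
  have D_Suc: "D k \<subseteq> D (Suc k)" for k
    using m(1) by (force simp: DS)
  have D_mono: "D i \<subseteq> D j" if "i \<le> j" for i j using lift_Suc_mono_le[of D] D_Suc that by blast
  have xD: "x \<cdot> u \<in> D (Suc k)" if "u \<in> D k" for u k
    using that
  proof (induction k arbitrary: u)
    case 0 then show ?case using d(1)[of 1] by (simp add: D0)
  next
    case (Suc k)
    then obtain a b where "u = x ^ k \<cdot> a + b" "a \<in> M" "b \<in> D k" unfolding DS by auto
    then show ?case using Suc.IH[of b] unfolding DS[of "Suc k"]
      by (intro CollectI exI[of _ a] exI[of _ "x \<cdot> b"]) (auto simp: scale_right_distrib)
  qed
  define M' where "M' = (\<Union>k. D k)"
  have sM': "stable_subgroup (insert x R) M'"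
    unfolding stable_subgroup_def
  proof (intro conjI ballI)
    show "0 \<in> M'" using d(1) by (auto simp: M'_def)
  next
    fix u v assume "u \<in> M'" "v \<in> M'"
    then obtain i j where "u \<in> D i" "v \<in> D j" by (auto simp: M'_def)
    then have "u \<in> D (max i j)" "v \<in> D (max i j)" using D_mono[of i "max i j"] D_mono[of j "max i j"] by auto
    then show "u + v \<in> M'" using d(2) by (auto simp: M'_def)
  next
    fix u assume "u \<in> M'" then show "- u \<in> M'" using d(3) by (auto simp: M'_def)
  next
    fix u r assume "u \<in> M'" "r \<in> insert x R"
    then obtain k where "u \<in> D k" by (auto simp: M'_def)
    then have "r \<cdot> u \<in> D (Suc k)"
      using \<open>r \<in> insert x R\<close> xD[of u k] d(4)[of r u k] D_Suc by auto
    then show "r \<cdot> u \<in> M'" by (auto simp: M'_def)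
  qed
  have chain: "\<exists>k. \<forall>i\<ge>k. U i = U k"
    if U: "\<forall>i. stable_subgroup (insert x R) (U i) \<and> U i \<subseteq> M' \<and> U i \<subseteq> U (Suc i)" for U :: "nat \<Rightarrow> 'a set"
  proof -
    have sU: "stable_subgroup (insert x R) (U i)" for i using U by blast
    note u = stable_subgroupD[OF sU]
    have mono: "U i \<subseteq> U j" if "i \<le> j" for i j using that U lift_Suc_mono_le[of U] by blast
    define L where "L k i = {a \<in> M. \<exists>b\<in>D k. x ^ k \<cdot> a + b \<in> U i}" for k i
    have sL: "stable_subgroup R (L k i)" for k i
      unfolding stable_subgroup_def
    proof (intro conjI ballI)
      show "0 \<in> L k i" using m(1) d(1) u(1) by (force simp: L_def)
    next
      fix a a' assume "a \<in> L k i" "a' \<in> L k i"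
      then obtain b b' where "a \<in> M" "a' \<in> M" "b \<in> D k" "b' \<in> D k"
          "x ^ k \<cdot> a + b \<in> U i" "x ^ k \<cdot> a' + b' \<in> U i"
        by (auto simp: L_def)
      then show "a + a' \<in> L k i" using m(2) d(2) u(2)[of "x ^ k \<cdot> a + b" i "x ^ k \<cdot> a' + b'"]
        by (auto simp: L_def scale_right_distrib algebra_simps intro!: bexI[of _ "b + b'"])
    next
      fix a assume "a \<in> L k i"
      then obtain b where "a \<in> M" "b \<in> D k" "x ^ k \<cdot> a + b \<in> U i" by (auto simp: L_def)
      moreover from this have "x ^ k \<cdot> (- a) + (- b) \<in> U i"
        using u(3)[of "x ^ k \<cdot> a + b" i] by simp
      ultimately show "- a \<in> L k i" using m(3) d(3) unfolding L_def by blast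
    next
      fix a r assume "a \<in> L k i" "r \<in> R"
      then obtain b where "r \<in> R" "a \<in> M" "b \<in> D k" "x ^ k \<cdot> a + b \<in> U i" by (auto simp: L_def)
      then show "r \<cdot> a \<in> L k i" using m(4) d(4) u(4)[of r "x ^ k \<cdot> a + b" i]
        by (auto simp: L_def scale_right_distrib mult.commute intro!: bexI[of _ "r \<cdot> b"])
    qed
    have L_i: "L k i \<subseteq> L k j" if "i \<le> j" for k i j using mono[OF that] by (auto simp: L_def)
    have "L k i \<subseteq> L (Suc k) i" for k i
    proof
      fix a assume "a \<in> L k i"
      then obtain b where b: "a \<in> M" "b \<in> D k" "x ^ k \<cdot> a + b \<in> U i" by (auto simp: L_def)
      then show "a \<in> L (Suc k) i" using u(4)[of x "x ^ k \<cdot> a + b" i] xD[of b k]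
        by (auto simp: L_def scale_right_distrib intro!: bexI[of _ "x \<cdot> b"])
    qed
    then have L_k: "L k i \<subseteq> L l i" if "k \<le> l" for k l i
      using that lift_Suc_mono_le[of "\<lambda>k. L k i"] by blast
    have "L i i \<subseteq> M" "L i i \<subseteq> L (Suc i) (Suc i)" for i
      using L_i[of i "Suc i" i] L_k[of i "Suc i" "Suc i"] by (auto simp: L_def)
    from noetherian_overD[of R M "\<lambda>i. L i i", OF M sL this]
    obtain j0 where j0: "\<And>j. j \<ge> j0 \<Longrightarrow> L j j = L j0 j0" by blast
    have "\<exists>l. \<forall>i\<ge>l. L k i = L k l" for k
    proof -
      have "L k i \<subseteq> M" "L k i \<subseteq> L k (Suc i)" for i using L_i[of i "Suc i" k] by (auto simp: L_def)
      from noetherian_overD[of R M "L k", OF M sL this] show ?thesis .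
    qed
    then obtain l where l: "\<And>k i. i \<ge> l k \<Longrightarrow> L k i = L k (l k)" by metis
    define N where "N = Max (insert j0 (l ` {..<j0}))"
    have N: "j0 \<le> N" "k < j0 \<Longrightarrow> l k \<le> N" for k by (auto simp: N_def)
    have L_eq: "L k i = L k N" if "i \<ge> N" for k i
    proof (cases "k < j0")
      case True
      then show ?thesis using l[of k i] l[of k N] N(2)[OF True] that by simp
    next
      case False
      have "L k i \<subseteq> L (max k i) (max k i)" using L_k[of k "max k i" i] L_i[of i "max k i"] by auto
      also have "\<dots> = L j0 j0" using False by (intro j0) auto
      also have "\<dots> \<subseteq> L k N" using False N L_k[of j0 k j0] L_i[of j0 N k] by auto
      finally show ?thesis using L_i[OF that] by blast
    qed
    \<comment> \<open>Subtracting an element of \<open>U N\<close> with the same leading coefficient lowers the degree.\<close>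
    have "U i \<inter> D k \<subseteq> U N" if "i \<ge> N" for i k
    proof (induction k)
      case 0 show ?case using u(1) by (auto simp: D0)
    next
      case (Suc k)
      show ?case
      proof
        fix y assume y: "y \<in> U i \<inter> D (Suc k)"
        then obtain a b where ab: "y = x ^ k \<cdot> a + b" "a \<in> M" "b \<in> D k" unfolding DS by auto
        then have "a \<in> L k i" using y by (auto simp: L_def)
        then have "a \<in> L k N" using L_eq[OF that] by simp
        then obtain b' where b': "b' \<in> D k" "x ^ k \<cdot> a + b' \<in> U N" by (auto simp: L_def)
        then have "y - (x ^ k \<cdot> a + b') \<in> U i" using y mono[OF that] by (intro u(5)) auto
        then have "b - b' \<in> U i \<inter> D k" using ab b' d(5) by simp
        then have "b - b' \<in> U N" using Suc by blast
        then show "y \<in> U N" using u(2)[OF b'(2)] ab by force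
      qed
    qed
    then have "U i \<subseteq> U N" if "i \<ge> N" for i using U that unfolding M'_def by blast
    then show ?thesis using mono by (intro exI[of _ N]) blast
  qed
  have "M \<subseteq> D 1" using DS[of 0] D0 by auto
  then show ?thesis using sM' chain unfolding noetherian_over_def M'_def by blast
qed

lemma noetherian_over_extend:
  assumes "finite X" "noetherian_over R M"
  shows "\<exists>M'. M \<subseteq> M' \<and> noetherian_over (R \<union> X) M'"
  using assms
proof (induction X rule: finite_induct)
  case (insert x X)
  then obtain M' where "M \<subseteq> M'" "noetherian_over (R \<union> X) M'" by blast
  then show ?case using hilbert_basis_step[of "R \<union> X" M' x] by auto
qed auto

end

context ring_module
begin

lemma noetherian_over_subset:
  assumes "noetherian_over R M" "R \<subseteq> R'" "M' \<subseteq> M" "stable_subgroup R' M'"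
  shows "noetherian_over R' M'"
  unfolding noetherian_over_def
proof (intro conjI allI impI)
  fix U :: "nat \<Rightarrow> 'a set"
  assume U: "\<forall>i. stable_subgroup R' (U i) \<and> U i \<subseteq> M' \<and> U i \<subseteq> U (Suc i)"
  have "stable_subgroup R V" if "stable_subgroup R' V" for V
    using that assms(2) by (auto simp: stable_subgroup_def)
  then show "\<exists>k. \<forall>i\<ge>k. U i = U k"
    using U assms(3) by (intro noetherian_overD[OF assms(1)]) blast+
qed fact

lemma noetherian_over_induct [consumes 3, case_names step]:
  assumes M: "noetherian_over R M" and Q: "stable_subgroup R Q" "Q \<subseteq> M"
    and step: "\<And>Q. stable_subgroup R Q \<Longrightarrow> Q \<subseteq> M \<Longrightarrow>
      (\<And>Q'. stable_subgroup R Q' \<Longrightarrow> Q' \<subseteq> M \<Longrightarrow> Q \<subset> Q' \<Longrightarrow> P Q') \<Longrightarrow> P Q"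
  shows "P Q"
proof -
  let ?r = "{(Q', Q). stable_subgroup R Q' \<and> Q' \<subseteq> M \<and> stable_subgroup R Q \<and> Q \<subseteq> M \<and> Q \<subset> Q'}"
  have "wf ?r"
    unfolding wf_iff_no_infinite_down_chain
  proof
    assume "\<exists>f. \<forall>i. (f (Suc i), f i) \<in> ?r"
    then obtain f where f: "\<And>i. (f (Suc i), f i) \<in> ?r" by blast
    then have "\<exists>k. \<forall>i\<ge>k. f i = f k" by (intro noetherian_overD[OF M]) auto
    then show False using f by (metis (mono_tags, lifting) case_prodD le_Suc_eq mem_Collect_eq order_refl psubset_eq)
  qed
  then show ?thesis
    using Q
  proof (induction Q rule: wf_induct_rule)
    case (less Q)
    show ?case
    proof (rule step)
      show "P Q'" if "stable_subgroup R Q'" "Q' \<subseteq> M" "Q \<subset> Q'" for Q'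
        using less that by auto
    qed (use less.prems in auto)
  qed
qed

end

section \<open>Regular sequences modulo a submodule\<close>

context ring_module
begin

abbreviation submod :: "'a set \<Rightarrow> bool" where
  "submod \<equiv> stable_subgroup UNIV"

lemma submodD:
  assumes "submod U"
  shows "0 \<in> U" "x \<in> U \<Longrightarrow> y \<in> U \<Longrightarrow> x + y \<in> U" "x \<in> U \<Longrightarrow> - x \<in> U"
    "x \<in> U \<Longrightarrow> r \<cdot> x \<in> U" "x \<in> U \<Longrightarrow> y \<in> U \<Longrightarrow> x - y \<in> U"
  using stable_subgroupD[OF assms] by auto

lemma submod_sum: "submod U \<Longrightarrow> (\<And>i. i \<in> I \<Longrightarrow> f i \<in> U) \<Longrightarrow> sum f I \<in> U"
  by (induction I rule: infinite_finite_induct) (auto dest: submodD)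

text \<open>
  \<open>nonzerodivisor_mod M P r\<close> says that \<open>r\<close> is a nonzerodivisor on \<open>M / P\<close>, and \<open>regular_mod M P rs\<close>
  that \<open>rs\<close> is a regular sequence on \<open>M / P\<close>, except that \<open>M / (P + rs M)\<close> may vanish.
\<close>

definition nonzerodivisor_mod :: "'a set \<Rightarrow> 'a set \<Rightarrow> 'r \<Rightarrow> bool" where
  "nonzerodivisor_mod M P r \<longleftrightarrow> (\<forall>y\<in>M. r \<cdot> y \<in> P \<longrightarrow> y \<in> P)"

definition adjoin :: "'a set \<Rightarrow> 'a set \<Rightarrow> 'r \<Rightarrow> 'a set" where
  "adjoin M P r = {p + r \<cdot> y | p y. p \<in> P \<and> y \<in> M}"

primrec regular_mod :: "'a set \<Rightarrow> 'a set \<Rightarrow> 'r list \<Rightarrow> bool" where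
  "regular_mod M P [] \<longleftrightarrow> True"
| "regular_mod M P (r # rs) \<longleftrightarrow> nonzerodivisor_mod M P r \<and> regular_mod M (adjoin M P r) rs"

lemma regular_mod_iff_nth:
  "regular_mod M P rs \<longleftrightarrow>
     (\<forall>i<length rs. nonzerodivisor_mod M (foldl (adjoin M) P (take i rs)) (rs ! i))"
proof (induction rs arbitrary: P)
  case (Cons r rs)
  show ?case unfolding regular_mod.simps Cons.IH
    by (simp add: All_less_Suc2)
qed simp

lemma adjoin:
  assumes "submod M" "submod P" "P \<subseteq> M"
  shows "submod (adjoin M P r)" "adjoin M P r \<subseteq> M" "P \<subseteq> adjoin M P r"
proof -
  note m = submodD[OF assms(1)] and p = submodD[OF assms(2)]
  show "adjoin M P r \<subseteq> M" using m assms(3) by (auto simp: adjoin_def)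
  show "P \<subseteq> adjoin M P r" using m(1) by (force simp: adjoin_def)
  show "submod (adjoin M P r)"
    unfolding stable_subgroup_def
  proof (intro conjI ballI)
    show "0 \<in> adjoin M P r" using m(1) p(1) by (force simp: adjoin_def)
  next
    fix x y assume "x \<in> adjoin M P r" "y \<in> adjoin M P r"
    then obtain a u b v where "x = a + r \<cdot> u" "y = b + r \<cdot> v" "a \<in> P" "b \<in> P" "u \<in> M" "v \<in> M"
      by (auto simp: adjoin_def)
    then show "x + y \<in> adjoin M P r" using m(2) p(2) unfolding adjoin_def
      by (intro CollectI exI[of _ "a + b"] exI[of _ "u + v"]) (auto simp: scale_right_distrib algebra_simps)
  next
    fix x assume "x \<in> adjoin M P r"
    then obtain a u where "x = a + r \<cdot> u" "a \<in> P" "u \<in> M" by (auto simp: adjoin_def)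
    then show "- x \<in> adjoin M P r" using m(3) p(3) unfolding adjoin_def
      by (intro CollectI exI[of _ "- a"] exI[of _ "- u"]) auto
  next
    fix x c assume "x \<in> adjoin M P r"
    then obtain a u where "x = a + r \<cdot> u" "a \<in> P" "u \<in> M" by (auto simp: adjoin_def)
    then show "c \<cdot> x \<in> adjoin M P r" using m(4) p(4) unfolding adjoin_def
      by (intro CollectI exI[of _ "c \<cdot> a"] exI[of _ "c \<cdot> u"]) (auto simp: scale_right_distrib mult.commute)
  qed
qed

lemma submod_foldl_adjoin:
  assumes "submod M" "submod P" "P \<subseteq> M"
  shows "submod (foldl (adjoin M) P rs)" "foldl (adjoin M) P rs \<subseteq> M"
  using assms(2,3) by (induction rs arbitrary: P) (simp_all add: adjoin[OF assms(1)])

lemma adjoin_commute: "adjoin M (adjoin M P a) b = adjoin M (adjoin M P b) a"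
proof -
  have "adjoin M (adjoin M P a) b \<subseteq> adjoin M (adjoin M P b) a" for a b
  proof
    fix v assume "v \<in> adjoin M (adjoin M P a) b"
    then obtain p y z where "v = (p + a \<cdot> y) + b \<cdot> z" "p \<in> P" "y \<in> M" "z \<in> M"
      by (auto simp: adjoin_def)
    moreover from this have "v = (p + b \<cdot> z) + a \<cdot> y" by (simp add: algebra_simps)
    ultimately show "v \<in> adjoin M (adjoin M P b) a" unfolding adjoin_def by blast
  qed
  then show ?thesis by blast
qed

text \<open>
  If \<open>a, b\<close> is regular on \<open>M / P\<close> and \<open>b\<close> is a nonzerodivisor there, then \<open>a\<close> is a nonzerodivisor
  modulo \<open>b\<close>: from \<open>a y = c + b w\<close> with \<open>c \<in> P\<close> the regularity of \<open>b\<close> modulo \<open>a\<close> gives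
  \<open>w = c' + a v\<close>, whence \<open>a (y - b v) \<in> P\<close> and \<open>y \<in> P + b M\<close>.
\<close>

lemma regular_mod_swap:
  assumes "submod M" "submod P" "P \<subseteq> M"
    and reg: "regular_mod M P (a # b # rs)" and b: "nonzerodivisor_mod M P b"
  shows "regular_mod M P (b # a # rs)"
proof -
  note m = submodD[OF assms(1)] and p = submodD[OF assms(2)]
  have "y \<in> adjoin M P b" if y: "y \<in> M" "a \<cdot> y \<in> adjoin M P b" for y
  proof -
    obtain c w where w: "a \<cdot> y = c + b \<cdot> w" "c \<in> P" "w \<in> M" using y(2) by (auto simp: adjoin_def)
    then have "b \<cdot> w = - c + a \<cdot> y" by simp
    then have "b \<cdot> w \<in> adjoin M P a" using y(1) w p(3) unfolding adjoin_def by blast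
    then have "w \<in> adjoin M P a" using reg w by (auto simp: nonzerodivisor_mod_def)
    then obtain c' v where v: "w = c' + a \<cdot> v" "c' \<in> P" "v \<in> M" by (auto simp: adjoin_def)
    have "a \<cdot> (y - b \<cdot> v) = c + b \<cdot> c'"
      using w(1) v(1) by (simp add: scale_right_distrib scale_right_diff_distrib mult.commute)
    then have "a \<cdot> (y - b \<cdot> v) \<in> P" using w(2) v(2) p by simp
    moreover have "y - b \<cdot> v \<in> M" using y(1) v(3) m by simp
    ultimately have "y - b \<cdot> v \<in> P" using reg by (auto simp: nonzerodivisor_mod_def)
    then show ?thesis using v(3) unfolding adjoin_def by (intro CollectI exI[of _ "y - b \<cdot> v"] exI[of _ v]) auto
  qed
  then show ?thesis using reg b adjoin_commute[of M P a b]
    by (auto simp: nonzerodivisor_mod_def)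
qed

text \<open>
  The exchange property: \<open>l\<close> may replace the last element of \<open>rs\<close>, and since it is a nonzerodivisor
  at every stage, swaps move it to the front.
\<close>

lemma regular_mod_exchange:
  assumes "submod M" "submod P" "P \<subseteq> M" "rs \<noteq> []" "regular_mod M P rs"
    and "\<And>i. i < length rs \<Longrightarrow> nonzerodivisor_mod M (foldl (adjoin M) P (take i rs)) l"
  shows "regular_mod M P (l # butlast rs)"
  using assms(2-)
proof (induction rs arbitrary: P)
  case (Cons r rs)
  have l: "nonzerodivisor_mod M P l" using Cons.prems(5)[of 0] by simp
  show ?case
  proof (cases "rs = []")
    case True then show ?thesis using l by simp
  next
    case False
    have "regular_mod M (adjoin M P r) (l # butlast rs)"
    proof (rule Cons.IH)
      show "nonzerodivisor_mod M (foldl (adjoin M) (adjoin M P r) (take i rs)) l" if "i < length rs" for i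
        using Cons.prems(5)[of "Suc i"] that by simp
    qed (use Cons.prems False adjoin[OF assms(1) Cons.prems(1,2)] in auto)
    then have "regular_mod M P (r # l # butlast rs)" using Cons.prems(4) by simp
    from regular_mod_swap[OF assms(1) Cons.prems(1,2) this l] show ?thesis using False by simp
  qed
qed simp

text \<open>
  In the application \<open>G\<close> consists of the elements without parts in degrees at most 1, and \<open>Y\<close> of the
  elements of degree 1, in both cases modulo \<open>P\<close>. A relation \<open>\<Sum> l\<^sub>i y\<^sub>i \<in> P\<close> puts the last \<open>y\<^sub>i\<close> into \<open>P\<close> plus the multiples of
  the other \<open>l\<^sub>j\<close>, that is, into \<open>G\<close>, and \<open>Y\<close> meets \<open>G\<close> only in \<open>P\<close>.
\<close>

lemma regular_mod_relation_trivial: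
  assumes reg: "regular_mod M P ls" and P: "submod P" "P \<subseteq> M" and M: "submod M"
    and G: "submod G" "P \<subseteq> G" "\<And>l y. l \<in> set ls \<Longrightarrow> y \<in> M \<Longrightarrow> l \<cdot> y \<in> G"
    and Y: "Y \<subseteq> M" "Y \<inter> G \<subseteq> P"
    and y: "\<And>i. i < length ls \<Longrightarrow> y i \<in> Y" and rel: "(\<Sum>i<length ls. (ls ! i) \<cdot> y i) \<in> P"
    and i: "i < length ls"
  shows "y i \<in> P"
  using assms
proof (induction ls arbitrary: P y i)
  case (Cons l ls)
  let ?P' = "adjoin M P l"
  note a = adjoin[OF Cons.prems(4,2,3), of l]
  have P'G: "?P' \<subseteq> G" using Cons.prems(6,7) submodD(2)[OF Cons.prems(5)] by (auto simp: adjoin_def)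
  have rel: "l \<cdot> y 0 + (\<Sum>i<length ls. (ls ! i) \<cdot> y (Suc i)) \<in> P"
    using Cons.prems(11) by (simp add: sum.lessThan_Suc_shift del: sum.lessThan_Suc)
  have y0: "y 0 \<in> M" using Cons.prems(8,10) by auto
  have tail: "y (Suc j) \<in> P" if j: "j < length ls" for j
  proof -
    have "(l \<cdot> y 0 + (\<Sum>i<length ls. (ls ! i) \<cdot> y (Suc i))) + l \<cdot> (- y 0) \<in> ?P'"
      using rel y0 submodD(3)[OF Cons.prems(4)] unfolding adjoin_def by blast
    then have "(\<Sum>i<length ls. (ls ! i) \<cdot> y (Suc i)) \<in> ?P'" by simp
    then have "y (Suc j) \<in> ?P'"
      using Cons.IH[of ?P' "\<lambda>i. y (Suc i)" j] Cons.prems a P'G j by auto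
    then show ?thesis using P'G Cons.prems(9) Cons.prems(10)[of "Suc j"] j by auto
  qed
  have "(\<Sum>i<length ls. (ls ! i) \<cdot> y (Suc i)) \<in> P"
    using tail submodD(4)[OF Cons.prems(2)] by (intro submod_sum[OF Cons.prems(2)]) auto
  from submodD(5)[OF Cons.prems(2) rel this] have "l \<cdot> y 0 \<in> P" by simp
  then have "y 0 \<in> P" using Cons.prems(1) y0 by (auto simp: nonzerodivisor_mod_def)
  then show ?case using tail Cons.prems(12) by (cases i) auto
qed simp

end


section \<open>Linear forms as regular elements\<close>

text \<open>
  The linear forms \<open>pencil t = \<Sum> t\<^sup>k x\<^sub>k\<close> lie on a moment curve, so that any \<open>n\<close> of them with distinct
  parameters have the same span over the field as \<open>x\<^sub>0, \<dots>, x\<^sub>n\<^sub>-\<^sub>1\<close>. The map \<open>\<kappa>\<close> makes the ring an algebra over the field.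
\<close>

locale pencil_module = ring_module scale
  for scale :: "'r::comm_ring_1 \<Rightarrow> 'a::ab_group_add \<Rightarrow> 'a" (infixr "\<cdot>" 75) +
  fixes \<kappa> :: "'k::field \<Rightarrow> 'r" and x :: "nat \<Rightarrow> 'r" and n :: nat
  assumes \<kappa>_add: "\<kappa> (a + b) = \<kappa> a + \<kappa> b" and \<kappa>_mult: "\<kappa> (a * b) = \<kappa> a * \<kappa> b" and \<kappa>_1: "\<kappa> 1 = 1"
begin

lemma \<kappa>_0: "\<kappa> 0 = 0" using \<kappa>_add[of 0 0] by simp
lemma \<kappa>_diff: "\<kappa> (a - b) = \<kappa> a - \<kappa> b" using \<kappa>_add[of "a - b" b] by (simp add: algebra_simps)
lemma \<kappa>_uminus: "\<kappa> (- a) = - \<kappa> a" using \<kappa>_diff[of 0 a] by (simp add: \<kappa>_0)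
lemma \<kappa>_cancel: "c \<noteq> 0 \<Longrightarrow> \<kappa> (inverse c) \<cdot> \<kappa> c \<cdot> y = y"
  by (simp flip: \<kappa>_mult add: \<kappa>_1)

lemma noetherian_over_line: "noetherian_over (range \<kappa>) {\<kappa> c \<cdot> g | c. True}"
proof -
  let ?L = "{\<kappa> c \<cdot> g | c. True}"
  have "stable_subgroup (range \<kappa>) ?L"
    unfolding stable_subgroup_def
  proof (intro conjI ballI)
    show "0 \<in> ?L" using \<kappa>_0 by (intro CollectI exI[of _ 0]) simp
  next
    fix u v assume "u \<in> ?L" "v \<in> ?L"
    then obtain c d where "u = \<kappa> c \<cdot> g" "v = \<kappa> d \<cdot> g" by blast
    then show "u + v \<in> ?L" by (intro CollectI exI[of _ "c + d"]) (simp add: \<kappa>_add scale_left_distrib)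
  next
    fix u assume "u \<in> ?L"
    then obtain c where "u = \<kappa> c \<cdot> g" by blast
    then show "- u \<in> ?L" by (intro CollectI exI[of _ "- c"]) (simp add: \<kappa>_uminus)
  next
    fix u r assume "u \<in> ?L" "r \<in> range \<kappa>"
    then obtain c d where "u = \<kappa> c \<cdot> g" "r = \<kappa> d" by blast
    then show "r \<cdot> u \<in> ?L" by (intro CollectI exI[of _ "d * c"]) (simp add: \<kappa>_mult)
  qed
  moreover have "\<exists>k. \<forall>i\<ge>k. U i = U k"
    if U: "\<forall>i. stable_subgroup (range \<kappa>) (U i) \<and> U i \<subseteq> ?L \<and> U i \<subseteq> U (Suc i)" for U :: "nat \<Rightarrow> 'a set"
  proof (cases "\<exists>k. U k \<noteq> {0}")
    case True
    then obtain k where k: "U k \<noteq> {0}" by blast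
    moreover have "0 \<in> U k" using U by (auto simp: stable_subgroup_def)
    ultimately obtain u where "u \<in> U k" "u \<noteq> 0" by blast
    moreover obtain c where "u = \<kappa> c \<cdot> g" using U \<open>u \<in> U k\<close> by blast
    ultimately have c: "\<kappa> c \<cdot> g \<in> U k" "c \<noteq> 0" using \<kappa>_0 by auto
    have sU: "stable_subgroup (range \<kappa>) (U k)" using U by blast
    have "\<kappa> d \<cdot> g \<in> U k" for d
    proof -
      have "\<kappa> d \<cdot> \<kappa> (inverse c) \<cdot> \<kappa> c \<cdot> g \<in> U k" using stable_subgroupD(4)[OF sU] c(1) by (simp del: scale_scale)
      then show ?thesis unfolding \<kappa>_cancel[OF c(2)] .
    qed
    then have "?L \<subseteq> U k" by blast
    moreover have "U k \<subseteq> U i" if "i \<ge> k" for i using that U lift_Suc_mono_le[of U] by blast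
    ultimately have "\<forall>i\<ge>k. U i = U k" using U by blast
    then show ?thesis by blast
  next
    case False
    then have "\<forall>i\<ge>0. U i = U 0" by blast
    then show ?thesis by blast
  qed
  ultimately show ?thesis unfolding noetherian_over_def by blast
qed

lemma noetherian_over_finite_dimensional:
  assumes "finite X"
  shows "\<exists>M. X \<subseteq> M \<and> noetherian_over (range \<kappa>) M"
  using assms
proof (induction X rule: finite_induct)
  case empty
  have "noetherian_over (range \<kappa>) {0}" using noetherian_over_line[of 0] by simp
  then show ?case by blast
next
  case (insert g X)
  then obtain M where M: "X \<subseteq> M" "noetherian_over (range \<kappa>) M" by blast
  let ?M = "{a + b | a b. a \<in> M \<and> b \<in> {\<kappa> c \<cdot> g | c. True}}"
  have 0: "0 \<in> M" "0 \<in> {\<kappa> c \<cdot> g | c. True}"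
    using M(2) noetherian_over_line[of g] by (auto simp: noetherian_over_def stable_subgroup_def)
  have "g \<in> {\<kappa> c \<cdot> g | c. True}" using \<kappa>_1 by (metis (mono_tags, lifting) mem_Collect_eq scale_one)
  then have "insert g X \<subseteq> ?M" using M(1) 0 by force
  then show ?case using noetherian_over_sum[OF M(2) noetherian_over_line[of g]] by blast
qed

text \<open>
  A module-valued polynomial of degree less than \<open>m\<close> with \<open>m\<close> zeros vanishes. Dividing by
  \<open>X - t\<^sub>0\<close> with remainder leaves a polynomial with one coefficient less that vanishes at the other
  points.
\<close>

lemma vandermonde_mod:
  assumes Q: "submod Q" and "card T = m" "finite T"
    and "\<And>t. t \<in> T \<Longrightarrow> (\<Sum>k<m. \<kappa> (t ^ k) \<cdot> w k) \<in> Q" and "k < m"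
  shows "w k \<in> Q"
  using assms(2-)
proof (induction m arbitrary: T w k)
  case (Suc m)
  obtain t0 T' where T: "T = insert t0 T'" "t0 \<notin> T'" "card T' = m"
    using Suc.prems(1) by (auto simp: card_Suc_eq)
  \<comment> \<open>Horner's scheme: \<open>u 0\<close> is the value at \<open>t0\<close>, and \<open>u 1, u 2, \<dots>\<close> are the coefficients of the quotient.\<close>
  define u where "u k = (\<Sum>j\<in>{k..m}. \<kappa> (t0 ^ (j - k)) \<cdot> w j)" for k
  have u_Suc_m: "u (Suc m) = 0" by (simp add: u_def)
  have w_u: "w k = u k - \<kappa> t0 \<cdot> u (Suc k)" if "k \<le> m" for k
  proof -
    have "u k = w k + (\<Sum>j\<in>{Suc k..m}. \<kappa> (t0 ^ (j - k)) \<cdot> w j)"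
      using that by (simp add: u_def sum.atLeast_Suc_atMost \<kappa>_1)
    also have "(\<Sum>j\<in>{Suc k..m}. \<kappa> (t0 ^ (j - k)) \<cdot> w j) = \<kappa> t0 \<cdot> u (Suc k)"
      unfolding u_def scale_sum_right
      by (rule sum.cong) (auto simp flip: \<kappa>_mult power_Suc simp: Suc_diff_Suc)
    finally show ?thesis by simp
  qed
  have eval: "(\<Sum>k<Suc m. \<kappa> (t ^ k) \<cdot> w k) = u 0 + \<kappa> (t - t0) \<cdot> (\<Sum>k<m. \<kappa> (t ^ k) \<cdot> u (Suc k))" for t
  proof -
    have "(\<Sum>k<Suc m. \<kappa> (t ^ k) \<cdot> w k) =
        (\<Sum>k<Suc m. \<kappa> (t ^ k) \<cdot> u k) - (\<Sum>k<Suc m. \<kappa> (t ^ k) \<cdot> \<kappa> t0 \<cdot> u (Suc k))"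
      by (simp add: w_u scale_right_diff_distrib sum_subtractf)
    also have "(\<Sum>k<Suc m. \<kappa> (t ^ k) \<cdot> u k) = u 0 + \<kappa> t \<cdot> (\<Sum>k<m. \<kappa> (t ^ k) \<cdot> u (Suc k))"
      by (simp add: sum.lessThan_Suc_shift \<kappa>_1 \<kappa>_mult scale_sum_right del: sum.lessThan_Suc)
    also have "(\<Sum>k<Suc m. \<kappa> (t ^ k) \<cdot> \<kappa> t0 \<cdot> u (Suc k)) = \<kappa> t0 \<cdot> (\<Sum>k<m. \<kappa> (t ^ k) \<cdot> u (Suc k))"
      by (simp add: u_Suc_m scale_sum_right mult.commute)
    finally show ?thesis by (simp add: \<kappa>_diff scale_left_diff_distrib)
  qed
  have u0: "u 0 \<in> Q" using Suc.prems(3)[of t0] eval[of t0] by (simp add: T \<kappa>_0)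
  have "u (Suc k) \<in> Q" if "k < m" for k
  proof (rule Suc.IH[of T' "\<lambda>k. u (Suc k)"])
    show "(\<Sum>k<m. \<kappa> (t ^ k) \<cdot> u (Suc k)) \<in> Q" (is "?s \<in> Q") if "t \<in> T'" for t
    proof -
      have "u 0 + \<kappa> (t - t0) \<cdot> ?s \<in> Q" using Suc.prems(3)[of t] that eval[of t] by (simp add: T)
      then have "\<kappa> (t - t0) \<cdot> ?s \<in> Q" using submodD(5)[OF Q _ u0] by fastforce
      then have "\<kappa> (inverse (t - t0)) \<cdot> \<kappa> (t - t0) \<cdot> ?s \<in> Q" using submodD(4)[OF Q] by blast
      moreover have "t - t0 \<noteq> 0" using that T by auto
      ultimately show ?thesis using \<kappa>_cancel by metis
    qed
  qed (use T Suc.prems that in auto)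
  then have uQ: "u j \<in> Q" if "j \<le> Suc m" for j
    using that u0 u_Suc_m submodD(1)[OF Q] by (cases j) (auto simp: le_less)
  show ?case using w_u[of k] Suc.prems(4) uQ submodD[OF Q] by auto
qed simp

definition pencil :: "'k \<Rightarrow> 'r" where "pencil t = (\<Sum>k<n. \<kappa> (t ^ k) * x k)"

lemma pencil_scale: "pencil t \<cdot> y = (\<Sum>k<n. \<kappa> (t ^ k) \<cdot> x k \<cdot> y)"
  by (simp add: pencil_def scale_sum_left)

text \<open>
  Noetherian induction on \<open>Q\<close>. Suppose that no element of
  \<open>M / Q\<close> other than 0 is killed by all \<open>x\<^sub>k\<close>, and let \<open>U s\<close> be the kernel of \<open>pencil s\<close> on \<open>M / Q\<close>. For a
  zerodivisor \<open>pencil s\<close>, multiplication by it embeds \<open>M / U s\<close> into \<open>M / Q\<close>, so the induction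
  hypothesis leaves only finitely many zerodivisors \<open>pencil t\<close> on \<open>M / U s\<close>, and all but finitely
  many \<open>t\<close> satisfy \<open>U t \<subseteq> U s\<close>. Repeating this gives distinct \<open>s\<^sub>1, \<dots>, s\<^sub>n\<close> with a common nonzero
  element in their kernels, and by the Vandermonde argument all \<open>x\<^sub>k\<close> kill it.
\<close>

lemma socle_of_infinitely_many_zerodivisors:
  assumes M: "noetherian_over UNIV M" and Q: "submod Q" "Q \<subseteq> M"
    and "infinite {t. \<not> nonzerodivisor_mod M Q (pencil t)}"
  shows "\<exists>z\<in>M - Q. \<forall>k<n. x k \<cdot> z \<in> Q"
  using M Q assms(4)
proof (induction Q rule: noetherian_over_induct)
  case (step Q)
  have sM: "submod M" using M by (simp add: noetherian_over_def)
  let ?Bad = "\<lambda>Q. {t. \<not> nonzerodivisor_mod M Q (pencil t)}"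
  define U where "U s = {y\<in>M. pencil s \<cdot> y \<in> Q}" for s
  show ?case
  proof (rule ccontr)
    assume no_socle: "\<not> (\<exists>z\<in>M - Q. \<forall>k<n. x k \<cdot> z \<in> Q)"
    have commute: "a \<cdot> b \<cdot> y = b \<cdot> a \<cdot> y" for a b y by (simp add: mult.commute)
    have sU: "submod (U s)" for s
      unfolding stable_subgroup_def U_def using submodD[OF sM] submodD[OF step.hyps(1)]
      by (auto simp: scale_right_distrib commute[of "pencil s"] simp del: scale_scale)
    have QU: "Q \<subseteq> U s" for s using step.hyps submodD[OF step.hyps(1)] by (auto simp: U_def)
    have fin: "finite (?Bad (U s))" if s: "s \<in> ?Bad Q" for s
    proof (rule ccontr)
      assume "infinite (?Bad (U s))"
      moreover have "Q \<subset> U s" using s QU by (auto simp: U_def nonzerodivisor_mod_def)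
      ultimately obtain z where z: "z \<in> M - U s" "\<forall>k<n. x k \<cdot> z \<in> U s"
        using step.IH[OF sU[of s]] by (auto simp: U_def)
      then have "pencil s \<cdot> z \<in> M - Q" using submodD(4)[OF sM] by (auto simp: U_def)
      moreover have "x k \<cdot> pencil s \<cdot> z \<in> Q" if "k < n" for k
        using z(2) that by (auto simp: U_def commute[of "x k"] simp del: scale_scale)
      ultimately show False using no_socle by blast
    qed
    have "\<exists>S t. finite S \<and> card S = m \<and> t \<in> ?Bad Q \<and> (\<forall>s\<in>S. U t \<subseteq> U s)" for m
    proof (induction m)
      case 0
      obtain t where "t \<in> ?Bad Q" using step.prems by (metis finite.emptyI ex_in_conv)
      then show ?case by (intro exI[of _ "{}"] exI[of _ t]) auto
    next
      case (Suc m)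
      then obtain S t where S: "finite S" "card S = m" "t \<in> ?Bad Q" "\<forall>s\<in>S. U t \<subseteq> U s" by blast
      have "infinite (?Bad Q - S - ?Bad (U t))"
        by (intro Diff_infinite_finite fin[OF S(3)] S(1) step.prems)
      then obtain t' where t': "t' \<in> ?Bad Q - S - ?Bad (U t)" by (metis finite.emptyI ex_in_conv)
      have "U t' \<subseteq> U t"
        using t' QU[of t] by (auto simp: U_def nonzerodivisor_mod_def)
      then show ?case using S t' by (intro exI[of _ "insert t' S"] exI[of _ t']) auto
    qed
    then obtain S t where S: "finite S" "card S = n" "t \<in> ?Bad Q" "\<forall>s\<in>S. U t \<subseteq> U s" by blast
    then obtain z where z: "z \<in> M" "z \<in> U t" "z \<notin> Q" by (auto simp: U_def nonzerodivisor_mod_def)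
    have "x k \<cdot> z \<in> Q" if "k < n" for k
      by (rule vandermonde_mod[OF step.hyps(1) S(2,1) _ that])
        (use S(4) z(2) in \<open>auto simp: U_def pencil_scale subset_iff\<close>)
    then show False using no_socle z by blast
  qed
qed

text \<open>
  Every element of \<open>rs\<close> lies in the ideal of the \<open>x\<^sub>k\<close> and is a nonzerodivisor at its stage, so no
  stage has an element killed by all \<open>x\<^sub>k\<close>. Over an infinite field some \<open>t\<close> therefore makes \<open>pencil t\<close>
  a nonzerodivisor at all stages simultaneously, and it can be exchanged for the last element of
  \<open>rs\<close>. The remaining elements are treated modulo \<open>pencil t\<close>.
\<close>

lemma regular_mod_by_pencil:
  assumes inf: "infinite (UNIV :: 'k set)" and M: "noetherian_over UNIV M"
    and "submod P" "P \<subseteq> M" "regular_mod M P rs"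
    and "\<And>r. r \<in> set rs \<Longrightarrow> \<exists>c. r = (\<Sum>k<n. c k * x k)"
  shows "\<exists>ts. length ts = length rs \<and> regular_mod M P (map pencil ts)"
  using assms(3-)
proof (induction "length rs" arbitrary: P rs)
  case (Suc m)
  have sM: "submod M" using M by (simp add: noetherian_over_def)
  define Q where "Q i = foldl (adjoin M) P (take i rs)" for i
  have sQ: "submod (Q i)" "Q i \<subseteq> M" for i
    unfolding Q_def using submod_foldl_adjoin[OF sM Suc.prems(1,2)] by auto
  have fin: "finite {t. \<not> nonzerodivisor_mod M (Q i) (pencil t)}" if i: "i < length rs" for i
  proof (rule ccontr)
    assume "infinite {t. \<not> nonzerodivisor_mod M (Q i) (pencil t)}"
    from socle_of_infinitely_many_zerodivisors[OF M sQ this]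
    obtain z where z: "z \<in> M" "z \<notin> Q i" "\<And>k. k < n \<Longrightarrow> x k \<cdot> z \<in> Q i" by blast
    obtain c where c: "rs ! i = (\<Sum>k<n. c k * x k)" using Suc.prems(4) i nth_mem by blast
    have "rs ! i \<cdot> z = (\<Sum>k<n. c k \<cdot> x k \<cdot> z)" by (simp add: c scale_sum_left)
    also have "\<dots> \<in> Q i"
      using z(3) submodD(4)[OF sQ(1)] by (intro submod_sum[OF sQ(1)]) (auto simp del: scale_scale)
    finally have "z \<in> Q i"
      using Suc.prems(3) i z(1) unfolding regular_mod_iff_nth Q_def nonzerodivisor_mod_def by blast
    then show False using z(2) by simp
  qed
  have "finite (\<Union>i<length rs. {t. \<not> nonzerodivisor_mod M (Q i) (pencil t)})" using fin by blast
  then obtain t where t: "t \<notin> (\<Union>i<length rs. {t. \<not> nonzerodivisor_mod M (Q i) (pencil t)})"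
    using inf by (metis ex_new_if_finite)
  have ex: "regular_mod M P (pencil t # butlast rs)"
    by (rule regular_mod_exchange[OF sM Suc.prems(1,2)]) (use t Suc.prems(3) Suc.hyps(2) in \<open>auto simp: Q_def\<close>)
  have "\<exists>ts. length ts = length (butlast rs) \<and> regular_mod M (adjoin M P (pencil t)) (map pencil ts)"
    by (rule Suc.hyps(1)) (use ex Suc.hyps(2) Suc.prems(4) in \<open>auto simp: adjoin[OF sM Suc.prems(1,2)] dest: in_set_butlastD\<close>)
  then obtain ts where "length ts = m" "regular_mod M (adjoin M P (pencil t)) (map pencil ts)"
    using Suc.hyps(2)[symmetric] by auto
  then show ?case using ex Suc.hyps(2) by (intro exI[of _ "t # ts"]) auto
qed (auto intro: exI[of _ "[]"])

end

section \<open>Homogeneous parts of graded modules\<close>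

lemma mpoly_induct [case_names Const add Var]:
  fixes p :: "('n::finite, 'k::field) mpoly"
  assumes Const: "\<And>c. P (Const c)" and add: "\<And>p q. P p \<Longrightarrow> P q \<Longrightarrow> P (p + q)"
    and Var: "\<And>i p. P p \<Longrightarrow> P (Var i * p)"
  shows "P p"
proof -
  have single: "P (Poly_Mapping.single e c)" for e c
  proof (induction "total_degree e" arbitrary: e)
    case 0
    then have "e = 0" by (intro poly_mapping_eqI) (simp add: total_degree_def)
    then show ?case using Const[of c] by (simp add: Const_def)
  next
    case (Suc d)
    then obtain i where i: "Poly_Mapping.lookup e i \<noteq> 0"
      unfolding total_degree_def by (metis nat.distinct(1) sum.neutral)
    define f where "f = e - Poly_Mapping.single i 1"
    have e: "e = Poly_Mapping.single i 1 + f"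
      unfolding f_def
      by (rule poly_mapping_eqI) (use i in \<open>auto simp: lookup_add lookup_minus lookup_single when_def\<close>)
    have "total_degree e = Suc (total_degree f)"
      by (simp add: e total_degree_def lookup_add sum.distrib lookup_single when_def)
    then have "P (Poly_Mapping.single f c)" using Suc by simp
    from Var[OF this, of i] show ?case by (simp add: e Var_def mult_single)
  qed
  have "P (\<Sum>e\<in>A. Poly_Mapping.single e (Poly_Mapping.lookup p e))" if "finite A" for A
    using that by (induction A rule: finite_induct) (use single[of 0 0] single add in auto)
  moreover have "(\<Sum>e\<in>Poly_Mapping.keys p. Poly_Mapping.single e (Poly_Mapping.lookup p e)) = p"
    by (rule poly_mapping_eqI) (auto simp: lookup_sum lookup_single when_def in_keys_iff)
  ultimately show ?thesis by (metis finite_keys)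
qed

lemma finite_total_degree: "finite {e :: 'n::finite \<Rightarrow>\<^sub>0 nat. total_degree e = k}"
proof -
  have "finite {f :: 'n \<Rightarrow> nat. \<forall>x. (x \<in> UNIV \<longrightarrow> f x \<in> {..k}) \<and> (x \<notin> UNIV \<longrightarrow> f x = 0)}"
    by (rule finite_set_of_finite_funs) auto
  moreover have "Poly_Mapping.lookup e i \<le> total_degree e" for e :: "'n \<Rightarrow>\<^sub>0 nat" and i
    unfolding total_degree_def by (rule member_le_sum) auto
  then have "Poly_Mapping.lookup ` {e :: 'n \<Rightarrow>\<^sub>0 nat. total_degree e = k} \<subseteq>
      {f. \<forall>x. (x \<in> UNIV \<longrightarrow> f x \<in> {..k}) \<and> (x \<notin> UNIV \<longrightarrow> f x = 0)}" by auto
  ultimately show ?thesis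
    by (meson finite_imageD finite_subset inj_onI poly_mapping.lookup_inject)
qed

lemma total_degree_add: "total_degree (e + f) = total_degree e + total_degree f"
  by (simp add: total_degree_def lookup_add sum.distrib)

lemma total_degree_single: "total_degree (Poly_Mapping.single i c) = c"
  by (simp add: total_degree_def lookup_single when_def)

lemma total_degree_0 [simp]: "total_degree 0 = 0"
  by (simp add: total_degree_def)

lemma homogeneous_Const: "homogeneous 0 (Const c)"
  by (auto simp: homogeneous_def Const_def split: if_splits)

lemma homogeneous_Var: "homogeneous 1 (Var i)"
  by (simp add: homogeneous_def Var_def total_degree_single)

lemma homogeneous_single: "homogeneous (int (total_degree e)) (Poly_Mapping.single e c)"
  by (simp add: homogeneous_def)

lemma homogeneous_mult:
  assumes "homogeneous i p" "homogeneous j q" shows "homogeneous (i + j) (p * q)"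
  using assms keys_mult[of p q] by (fastforce simp: homogeneous_def total_degree_add)

lemma homogeneous_sum:
  assumes "\<And>k. k \<in> A \<Longrightarrow> homogeneous i (p k)" shows "homogeneous i (sum p A)"
  using assms keys_sum[of p A] by (fastforce simp: homogeneous_def)

lemma Const_add: "Const (a + b) = Const a + Const b"
  and Const_mult: "Const (a * b) = Const a * Const b" and Const_1: "Const 1 = 1"
  by (simp_all add: Const_def single_add mult_single)

context graded_module
begin

lemma component_closed:
  "\<zero> \<in> component N d" "x \<in> component N d \<Longrightarrow> x \<in> carrier N"
  "x \<in> component N d \<Longrightarrow> y \<in> component N d \<Longrightarrow> x \<oplus> y \<in> component N d"
  "x \<in> component N d \<Longrightarrow> Const c \<odot> x \<in> component N d"
  using subgroup.one_closed[OF component_subgroup[of d]] component_subset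
    subgroup.m_closed[OF component_subgroup[of d], of x y] smult_component[OF homogeneous_Const, of x d c]
  by auto

lemmas scale_simps =
  smult_l_distr[simplified] smult_r_distr[simplified] smult_assoc1[simplified] smult_one[simplified]

definition part :: "'b \<Rightarrow> int \<Rightarrow> 'b" where
  "part x = (THE f. (\<forall>d. f d \<in> component N d) \<and> finite {d. f d \<noteq> \<zero>} \<and>
     x = (\<Oplus>d\<in>{d. f d \<noteq> \<zero>}. f d))"

lemma part:
  assumes "x \<in> carrier N"
  shows "part x d \<in> component N d" "finite {d. part x d \<noteq> \<zero>}" "x = (\<Oplus>d\<in>{d. part x d \<noteq> \<zero>}. part x d)"
  using theI'[OF decomposition[OF assms]] unfolding part_def by blast+

lemma finsum_support:
  assumes "finite A" "\<And>d. f d \<in> carrier N" "\<And>d. d \<notin> A \<Longrightarrow> f d = \<zero>"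
  shows "(\<Oplus>d\<in>{d. f d \<noteq> \<zero>}. f d) = (\<Oplus>d\<in>A. f d)"
  by (rule M.add.finprod_mono_neutral_cong_left) (use assms in auto)

lemma part_unique:
  assumes A: "finite A" and f: "\<And>d. f d \<in> component N d" "\<And>d. d \<notin> A \<Longrightarrow> f d = \<zero>"
    and x: "x = (\<Oplus>d\<in>A. f d)"
  shows "part x = f"
proof -
  have fc: "f d \<in> carrier N" for d using f(1) component_closed(2) by blast
  then have xc: "x \<in> carrier N" unfolding x by (intro M.finsum_closed) auto
  have "finite {d. f d \<noteq> \<zero>}" by (rule finite_subset[OF _ A]) (use f(2) in auto)
  then have "(\<forall>d. f d \<in> component N d) \<and> finite {d. f d \<noteq> \<zero>} \<and> x = (\<Oplus>d\<in>{d. f d \<noteq> \<zero>}. f d)"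
    using f(1) finsum_support[OF A fc f(2)] x by simp
  then show ?thesis
    unfolding part_def by (rule the1_equality[OF decomposition[OF xc]])
qed

lemma part_sum:
  assumes "x \<in> carrier N" "finite A" "{d. part x d \<noteq> \<zero>} \<subseteq> A"
  shows "x = (\<Oplus>d\<in>A. part x d)"
  using part(3)[OF assms(1)] finsum_support[of A "part x"] part(1)[OF assms(1)] component_closed(2) assms
  by auto

lemma part_component:
  assumes "x \<in> component N d" shows "part x = (\<lambda>e. if e = d then x else \<zero>)"
  by (rule part_unique[of "{d}"]) (use assms component_closed in auto)

lemma part_add:
  assumes x: "x \<in> carrier N" and y: "y \<in> carrier N"
  shows "part (x \<oplus> y) d = part x d \<oplus> part y d"
proof -
  let ?A = "{d. part x d \<noteq> \<zero>} \<union> {d. part y d \<noteq> \<zero>}"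
  have fin: "finite ?A" using part(2) x y by simp
  have c: "part x d \<in> carrier N" "part y d \<in> carrier N" for d
    using part(1) x y component_closed(2) by blast+
  have "part (x \<oplus> y) = (\<lambda>d. part x d \<oplus> part y d)"
  proof (rule part_unique[OF fin])
    have "x \<oplus> y = (\<Oplus>d\<in>?A. part x d) \<oplus> (\<Oplus>d\<in>?A. part y d)"
      using part_sum[OF x fin] part_sum[OF y fin] by simp
    then show "x \<oplus> y = (\<Oplus>d\<in>?A. part x d \<oplus> part y d)"
      using c by (simp add: M.finsum_addf)
  qed (use part(1) x y component_closed(3) in auto)
  then show ?thesis by simp
qed

lemma part_scale:
  assumes p: "homogeneous i p" and x: "x \<in> carrier N"
  shows "part (p \<odot> x) d = p \<odot> part x (d - i)"
proof -
  let ?B = "{d. part x d \<noteq> \<zero>}"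
  have c: "part x d \<in> carrier N" for d using part(1)[OF x] component_closed(2) by blast
  have "part (p \<odot> x) = (\<lambda>d. p \<odot> part x (d - i))"
  proof (rule part_unique[of "(\<lambda>d. d + i) ` ?B"])
    show "finite ((\<lambda>d. d + i) ` ?B)" using part(2)[OF x] by simp
    show "p \<odot> part x (d - i) \<in> component N d" for d
      using smult_component[OF p part(1)[OF x], of "d - i"] by simp
    show "p \<odot> part x (d - i) = \<zero>" if "d \<notin> (\<lambda>d. d + i) ` ?B" for d
    proof -
      have "part x (d - i) = \<zero>" using that by force
      then show ?thesis by simp
    qed
    have "p \<odot> x = (\<Oplus>d\<in>?B. p \<odot> part x d)"
      using finsum_smult[of p "part x" ?B] c part(3)[OF x] by simp
    also have "\<dots> = (\<Oplus>d\<in>?B. p \<odot> part x ((d + i) - i))" by simp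
    also have "\<dots> = (\<Oplus>d\<in>(\<lambda>d. d + i) ` ?B. p \<odot> part x (d - i))"
      using c by (intro M.finsum_reindex[symmetric]) (auto intro!: inj_onI)
    finally show "p \<odot> x = (\<Oplus>d\<in>(\<lambda>d. d + i) ` ?B. p \<odot> part x (d - i))" .
  qed
  then show ?thesis by simp
qed

text \<open>
  Closure under constants and variables suffices, since these generate the polynomial ring.
\<close>

lemma generated_subset:
  assumes X: "span X = carrier N" "X \<subseteq> U" and U: "U \<subseteq> carrier N" "\<zero> \<in> U"
    "\<And>x y. x \<in> U \<Longrightarrow> y \<in> U \<Longrightarrow> x \<oplus> y \<in> U" "\<And>c x. x \<in> U \<Longrightarrow> Const c \<odot> x \<in> U"
    "\<And>i x. x \<in> U \<Longrightarrow> Var i \<odot> x \<in> U"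
  shows "U = carrier N"
proof -
  have "p \<odot> x \<in> U" if "x \<in> U" for p x
  proof (induction p rule: mpoly_induct)
    case (add p q)
    then show ?case using U(1,3) that by (auto simp: scale_simps subset_iff)
  next
    case (Var i p)
    have "x \<in> carrier N" using that U(1) by blast
    then show ?case using U(5)[OF Var, of i] by (simp add: scale_simps)
  qed (use U(4) that in auto)
  then have "submodule class_ring U N"
    using U by (intro submodule.intro module_axioms) auto
  then show ?thesis using span_is_subset[OF X(2)] X(1) U(1) by blast
qed

text \<open>
  The component of degree \<open>d\<close> is spanned by the products of degree \<open>d\<close> of a monomial with a
  homogeneous part of a generator: the elements all of whose parts lie in these spans form a
  submodule that contains the generators. There are finitely many such products, and none
  in degrees below those of the parts of the generators.
\<close>

lemma finite_dimensional_components: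
  assumes "finitely_generated N"
  shows "vectorspace.fin_dim class_ring (component_space N d)"
    and "\<exists>d0. \<forall>d<d0. component N d = {\<zero>}"
proof -
  obtain X where X: "finite X" "X \<subseteq> carrier N" "span X = carrier N"
    using assms unfolding finitely_generated_def by blast
  define E where "E = (\<Union>x\<in>X. {d. part x d \<noteq> \<zero>})"
  have E: "finite E" unfolding E_def using X(1,2) part(2) by blast
  define W where "W d = {Poly_Mapping.single u 1 \<odot> part x e | u x e.
    x \<in> X \<and> e \<in> E \<and> int (total_degree u) + e = d}" for d
  have W_sub: "W d \<subseteq> component N d" for d
    using smult_component[OF homogeneous_single] part(1) X(2) by (auto simp: W_def subset_iff)
  have "finite (W d)" for d
  proof (rule finite_subset)
    show "W d \<subseteq> (\<lambda>((u, x), e). Poly_Mapping.single u 1 \<odot> part x e) `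
        (((\<Union>e\<in>E. {u. total_degree u = nat (d - e)}) \<times> X) \<times> E)"
      unfolding W_def by (force simp: image_iff)
    show "finite ((\<lambda>((u, x), e). Poly_Mapping.single u 1 \<odot> part x e) `
        (((\<Union>e\<in>E. {u. total_degree u = nat (d - e)}) \<times> X) \<times> E))"
      using E X(1) finite_total_degree by blast
  qed
  note W_fin = this
  have vs: "vectorspace class_ring (component_space N d)" for d
    by (rule component_space_vectorspace) (rule graded_module_axioms)
  have mod: "Module.module class_ring (component_space N d)" for d
    using vs[of d] by (simp add: vectorspace_def)
  have car [simp]: "carrier (component_space N d) = component N d"
    "zero (component_space N d) = \<zero>" "add (component_space N d) = add N"
    "smult (component_space N d) c x = Const c \<odot> x" for c d x
    by (simp_all add: component_space_def)
  let ?span = "\<lambda>d. LinearCombinations.module.span class_ring (component_space N d)"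
  have sp: "submodule class_ring (?span d (W d)) (component_space N d)" for d
    by (rule LinearCombinations.module.span_is_submodule[OF mod]) (use W_sub in auto)
  have W_in: "W d \<subseteq> ?span d (W d)" for d
    by (rule LinearCombinations.module.in_own_span[OF mod]) (use W_sub in auto)
  have sp_sub: "?span d (W d) \<subseteq> component N d" for d using submodule.subset[OF sp[of d]] by simp
  define U where "U = {x \<in> carrier N. \<forall>d. part x d \<in> ?span d (W d)}"
  have "U = carrier N"
  proof (rule generated_subset[OF X(3)])
    show "U \<subseteq> carrier N" by (auto simp: U_def)
    show "X \<subseteq> U"
    proof
      fix x assume x: "x \<in> X"
      have "part x d \<in> ?span d (W d)" for d
      proof (cases "part x d = \<zero>")
        case True
        then show ?thesis using submodule.zero_closed[OF sp[of d]] by simp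
      next
        case False
        have "part x d \<in> carrier N" using part(1) component_closed(2) x X(2) by blast
        then have "part x d = Poly_Mapping.single 0 1 \<odot> part x d" by (simp add: scale_simps)
        moreover have "d \<in> E" using False x by (auto simp: E_def)
        ultimately have "part x d \<in> W d"
          using x unfolding W_def
          by (intro CollectI exI[of _ 0] exI[of _ x] exI[of _ d] conjI) (assumption | simp)+
        then show ?thesis using W_in by blast
      qed
      then show "x \<in> U" using x X(2) by (auto simp: U_def)
    qed
    show "\<zero> \<in> U"
      using part_component[OF component_closed(1), of 0] submodule.zero_closed[OF sp] by (simp add: U_def)
    show "x \<oplus> y \<in> U" if "x \<in> U" "y \<in> U" for x y
      using that submodule.m_closed[OF sp] by (auto simp: U_def part_add)
    show "Const c \<odot> x \<in> U" if "x \<in> U" for c x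
      using that submodule.smult_closed[OF sp] by (auto simp: U_def part_scale[OF homogeneous_Const])
    show "Var i \<odot> x \<in> U" if x: "x \<in> U" for i x
    proof -
      have "Var i \<odot> w \<in> ?span d (W d)" if w: "w \<in> ?span (d - 1) (W (d - 1))" for w d
      proof -
        let ?S = "{w \<in> component N (d - 1). Var i \<odot> w \<in> ?span d (W d)}"
        have comm: "Var i \<odot> (Const c \<odot> w) = Const c \<odot> (Var i \<odot> w)" if "w \<in> component N (d - 1)" for c w
          using component_closed(2)[OF that] by (simp add: scale_simps[symmetric] mult.commute)
        have "submodule class_ring ?S (component_space N (d - 1))"
        proof (rule submodule.intro[OF mod])
          show "v \<oplus>\<^bsub>component_space N (d - 1)\<^esub> w \<in> ?S" if "v \<in> ?S" "w \<in> ?S" for v w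
            using that submodule.m_closed[OF sp[of d], of "Var i \<odot> v" "Var i \<odot> w"] component_closed[where d = "d - 1"]
            by (auto simp: scale_simps)
          show "c \<odot>\<^bsub>component_space N (d - 1)\<^esub> w \<in> ?S" if "w \<in> ?S" for c w
            using that submodule.smult_closed[OF sp[of d], of c "Var i \<odot> w"] component_closed[where d = "d - 1"]
            by (auto simp: comm)
        qed (use submodule.zero_closed[OF sp[of d]] component_closed in auto)
        moreover have "W (d - 1) \<subseteq> ?S"
        proof
          fix w assume w: "w \<in> W (d - 1)"
          then obtain u x e where ux: "w = Poly_Mapping.single u 1 \<odot> part x e" "x \<in> X" "e \<in> E"
            "int (total_degree u) + e = d - 1" by (auto simp: W_def)
          have "part x e \<in> carrier N" using part(1) component_closed(2) ux(2) X(2) by blast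
          then have "Var i \<odot> w = Poly_Mapping.single (Poly_Mapping.single i 1 + u) 1 \<odot> part x e"
            by (simp add: ux(1) scale_simps(3)[symmetric] Var_def mult_single)
          moreover have "int (total_degree (Poly_Mapping.single i 1 + u)) + e = d"
            using ux(4) by (simp add: total_degree_add total_degree_single)
          ultimately have "Var i \<odot> w \<in> W d" using ux(2,3) unfolding W_def by blast
          then show "w \<in> ?S" using W_in W_sub w by blast
        qed
        ultimately have "?span (d - 1) (W (d - 1)) \<subseteq> ?S"
          by (intro LinearCombinations.module.span_is_subset[OF mod])
        then show ?thesis using w by blast
      qed
      then show ?thesis using x by (auto simp: U_def part_scale[OF homogeneous_Var])
    qed
  qed
  have W_span: "?span d (W d) = component N d" for d
  proof
    show "component N d \<subseteq> ?span d (W d)"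
    proof
      fix x assume x: "x \<in> component N d"
      then have "x \<in> U" using \<open>U = carrier N\<close> component_closed(2) by blast
      then have "part x d \<in> ?span d (W d)" by (simp add: U_def)
      then show "x \<in> ?span d (W d)" using part_component[OF x] by simp
    qed
  qed (rule sp_sub)
  show "vectorspace.fin_dim class_ring (component_space N d)"
    unfolding vectorspace.fin_dim_def[OF vs] using W_fin[of d] W_sub[of d] W_span[of d] by auto
  obtain d0 where d0: "\<And>e. e \<in> E \<Longrightarrow> d0 \<le> e"
    by (metis E Min_le)
  have "component N d = {\<zero>}" if "d < d0" for d
  proof -
    have "W d = {}" using d0 that by (fastforce simp: W_def)
    then have "?span d (W d) = {\<zero>}"
      using vectorspace.span_empty[OF vs[of d]] by simp
    then show ?thesis using W_span[of d] by simp
  qed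
  then show "\<exists>d0. \<forall>d<d0. component N d = {\<zero>}" by blast
qed

end

section \<open>Dimensions and Hilbert series\<close>

text \<open>
  The family is indexed because distinct indices must not be identified before their vectors are
  known to be distinct.
\<close>

lemma independent_family_card_le_dim:
  fixes V :: "('k::field, 'v, 'm) module_scheme"
  assumes "vectorspace class_ring V" "vectorspace.fin_dim class_ring V" "finite A"
    and v: "\<And>i. i \<in> A \<Longrightarrow> v i \<in> carrier V"
    and indep: "\<And>a i. (\<Oplus>\<^bsub>V\<^esub>i\<in>A. a i \<odot>\<^bsub>V\<^esub> v i) = \<zero>\<^bsub>V\<^esub> \<Longrightarrow> i \<in> A \<Longrightarrow> a i = 0"
  shows "card A \<le> vectorspace.dim class_ring V"
proof -
  interpret vectorspace class_ring V by fact
  have null: "0 \<odot>\<^bsub>V\<^esub> w = \<zero>\<^bsub>V\<^esub>" if "w \<in> carrier V" for w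
    using smult_l_null[OF that] by simp
  have inj: "inj_on v A"
  proof (rule inj_onI, rule ccontr)
    fix i j assume ij: "i \<in> A" "j \<in> A" "v i = v j" "i \<noteq> j"
    define a where "a = (\<lambda>k. if k = i then 1 else if k = j then - 1 else 0 :: 'k)"
    have "(\<Oplus>\<^bsub>V\<^esub>k\<in>A. a k \<odot>\<^bsub>V\<^esub> v k) = (\<Oplus>\<^bsub>V\<^esub>k\<in>{i, j}. a k \<odot>\<^bsub>V\<^esub> v k)"
      by (rule M.add.finprod_mono_neutral_cong_right) (use assms(3) ij v in \<open>auto simp: a_def null\<close>)
    also have "\<dots> = (1 \<odot>\<^bsub>V\<^esub> v i) \<oplus>\<^bsub>V\<^esub> ((- 1) \<odot>\<^bsub>V\<^esub> v i)"
      using ij v[of i] v[of j] by (subst M.finsum_insert) (auto simp: a_def)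
    also have "\<dots> = (1 + (- 1)) \<odot>\<^bsub>V\<^esub> v i"
      using smult_l_distr[of 1 "- 1" "v i"] v[OF ij(1)] by simp
    also have "\<dots> = \<zero>\<^bsub>V\<^esub>" using null v[OF ij(1)] by simp
    finally have "a i = 0" using indep[of a i] ij(1) by blast
    then show False by (simp add: a_def)
  qed
  have "lin_indpt (v ` A)"
  proof (rule finite_lin_indpt2)
    fix a assume "lincomb a (v ` A) = \<zero>\<^bsub>V\<^esub>"
    then have "(\<Oplus>\<^bsub>V\<^esub>i\<in>A. a (v i) \<odot>\<^bsub>V\<^esub> v i) = \<zero>\<^bsub>V\<^esub>"
      unfolding lincomb_def using v by (subst (asm) M.finsum_reindex[OF _ inj]) auto
    from indep[of "\<lambda>i. a (v i)", OF this]
    show "\<forall>w\<in>v ` A. a w = \<zero>\<^bsub>class_ring\<^esub>" by simp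
  qed (use assms(3) v in auto)
  then have "card (v ` A) \<le> dim" using li_le_dim(2)[OF assms(2)] v by blast
  then show ?thesis using card_image[OF inj] by simp
qed

text \<open>
  All dimensions of the concrete modules come from this criterion, with the coefficients of
  monomials as coordinates \<open>c\<close> and the monomials as dual vectors \<open>u\<close>.
\<close>

lemma dim_eq_card_coordinates:
  fixes V :: "('k::field, 'v, 'm) module_scheme" and c :: "'x \<Rightarrow> 'v \<Rightarrow> 'k"
  assumes "vectorspace class_ring V" and B: "finite B"
    and add: "\<And>x v w. v \<in> carrier V \<Longrightarrow> w \<in> carrier V \<Longrightarrow> c x (v \<oplus>\<^bsub>V\<^esub> w) = c x v + c x w"
    and smult: "\<And>x a v. v \<in> carrier V \<Longrightarrow> c x (a \<odot>\<^bsub>V\<^esub> v) = a * c x v"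
    and faithful: "\<And>v. v \<in> carrier V \<Longrightarrow> (\<And>x. x \<in> B \<Longrightarrow> c x v = 0) \<Longrightarrow> v = \<zero>\<^bsub>V\<^esub>"
    and u: "\<And>x. x \<in> B \<Longrightarrow> u x \<in> carrier V"
    and dual: "\<And>x y. x \<in> B \<Longrightarrow> y \<in> B \<Longrightarrow> c y (u x) = (if y = x then 1 else 0)"
  shows "vectorspace.dim class_ring V = card B" "vectorspace.fin_dim class_ring V"
proof -
  interpret vectorspace class_ring V by fact
  have c0: "c x \<zero>\<^bsub>V\<^esub> = 0" for x
    using smult[of "\<zero>\<^bsub>V\<^esub>" x 0] smult_l_null[of "\<zero>\<^bsub>V\<^esub>"] by simp
  have c_sum: "c x (\<Oplus>\<^bsub>V\<^esub>i\<in>A. f i) = (\<Sum>i\<in>A. c x (f i))"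
    if "finite A" "\<And>i. i \<in> A \<Longrightarrow> f i \<in> carrier V" for x f and A :: "'x set"
    using that
  proof (induction A rule: finite_induct)
    case (insert i A)
    then have "(\<Oplus>\<^bsub>V\<^esub>i\<in>insert i A. f i) = f i \<oplus>\<^bsub>V\<^esub> (\<Oplus>\<^bsub>V\<^esub>i\<in>A. f i)"
      by (intro M.finsum_insert) auto
    then show ?case using insert by (simp add: add M.finsum_closed)
  qed (simp add: c0)
  have coeff: "c y (\<Oplus>\<^bsub>V\<^esub>x\<in>B. a x \<odot>\<^bsub>V\<^esub> u x) = a y" if "y \<in> B" for a y
  proof -
    have "c y (\<Oplus>\<^bsub>V\<^esub>x\<in>B. a x \<odot>\<^bsub>V\<^esub> u x) = (\<Sum>x\<in>B. c y (a x \<odot>\<^bsub>V\<^esub> u x))"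
      by (rule c_sum) (use B u in auto)
    also have "\<dots> = (\<Sum>x\<in>B. if x = y then a y else 0)"
      by (rule sum.cong) (use u dual that in \<open>auto simp: smult\<close>)
    finally show ?thesis using B that by simp
  qed
  have "v \<in> span (u ` B)" if v: "v \<in> carrier V" for v
  proof -
    let ?s = "\<Oplus>\<^bsub>V\<^esub>x\<in>B. c x v \<odot>\<^bsub>V\<^esub> u x"
    have s: "?s \<in> carrier V" by (rule M.finsum_closed) (use u in auto)
    have ms: "(- 1) \<odot>\<^bsub>V\<^esub> ?s \<in> carrier V" using s by simp
    have "v \<oplus>\<^bsub>V\<^esub> (- 1) \<odot>\<^bsub>V\<^esub> ?s = \<zero>\<^bsub>V\<^esub>"
      using v ms s by (intro faithful) (auto simp: add smult coeff)
    moreover have "?s \<oplus>\<^bsub>V\<^esub> (- 1) \<odot>\<^bsub>V\<^esub> ?s = \<zero>\<^bsub>V\<^esub>"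
      using ms s by (intro faithful) (auto simp: add smult)
    ultimately have "v = ?s" using v s ms M.add.right_cancel[of "(- 1) \<odot>\<^bsub>V\<^esub> ?s" v ?s] by simp
    have sub: "submodule class_ring (span (u ` B)) V" using u by (intro span_is_submodule) auto
    have "(\<Oplus>\<^bsub>V\<^esub>x\<in>A. c x v \<odot>\<^bsub>V\<^esub> u x) \<in> span (u ` B)" if "finite A" "A \<subseteq> B" for A
      using that
    proof (induction A rule: finite_induct)
      case empty then show ?case using submodule.zero_closed[OF sub] by simp
    next
      case (insert x A)
      then have "u x \<in> span (u ` B)" using in_own_span[of "u ` B"] u by auto
      moreover have "(\<Oplus>\<^bsub>V\<^esub>x\<in>insert x A. c x v \<odot>\<^bsub>V\<^esub> u x) =
          c x v \<odot>\<^bsub>V\<^esub> u x \<oplus>\<^bsub>V\<^esub> (\<Oplus>\<^bsub>V\<^esub>x\<in>A. c x v \<odot>\<^bsub>V\<^esub> u x)"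
        using insert u by (intro M.finsum_insert) auto
      ultimately show ?case
        using insert submodule.m_closed[OF sub] submodule.smult_closed[OF sub] by auto
    qed
    from this[OF B order_refl] show ?thesis using \<open>v = ?s\<close> by metis
  qed
  then have gen: "gen_set (u ` B)" using span_is_subset2[of "u ` B"] u by auto
  then show fd: "fin_dim" unfolding fin_dim_def using B u by (intro exI[of _ "u ` B"]) auto
  have "dim \<le> card B"
    using gen_ge_dim[OF _ _ gen] B u card_image_le[OF B, of u] by fastforce
  moreover have "card B \<le> dim"
  proof (rule independent_family_card_le_dim[OF assms(1) fd B u])
    fix a i assume "(\<Oplus>\<^bsub>V\<^esub>i\<in>B. a i \<odot>\<^bsub>V\<^esub> u i) = \<zero>\<^bsub>V\<^esub>" "i \<in> B"
    then show "a i = 0" using coeff[of i a] c0[of i] by simp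
  qed
  ultimately show "dim = card B" by simp
qed

lemma hilbert_series_eq_iff_dim:
  fixes N :: "(('n::finite, 'k::field) mpoly, 'b) graded_module"
    and M :: "(('n, 'k) mpoly, 'c) graded_module"
  assumes N: "graded_module N" "finitely_generated N" and M: "graded_module M" "finitely_generated M"
  shows "hilbert_series N = hilbert_series M \<longleftrightarrow>
    (\<forall>d. vectorspace.dim class_ring (component_space N d) = vectorspace.dim class_ring (component_space M d))"
proof -
  have ev: "(\<lambda>d. int (vectorspace.dim class_ring (component_space N d))) \<in>
      {f. \<forall>\<^sub>\<infinity>n::nat. f (- int n) = 0}"
    if N: "graded_module N" "finitely_generated N" for N :: "(('n, 'k) mpoly, 'd) graded_module"
  proof -
    obtain d0 where d0: "\<And>d. d < d0 \<Longrightarrow> component N d = {\<zero>\<^bsub>N\<^esub>}"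
      using graded_module.finite_dimensional_components(2)[OF N] by blast
    have "vectorspace.dim class_ring (component_space N d) = 0" if "d < d0" for d
    proof -
      have "vectorspace.dim class_ring (component_space N d) = card ({} :: nat set)"
      proof (rule dim_eq_card_coordinates(1)[where c = "\<lambda>_ _. 0" and u = "\<lambda>_. undefined"])
        show "vectorspace class_ring (component_space N d)" by (rule component_space_vectorspace[OF N(1)])
        show "v = \<zero>\<^bsub>component_space N d\<^esub>" if "v \<in> carrier (component_space N d)" for v
          using that d0[OF \<open>d < d0\<close>] by (simp add: component_space_def)
      qed simp_all
      then show ?thesis by simp
    qed
    moreover have "- int n < d0" if "n > nat \<bar>d0\<bar>" for n using that by linarith
    ultimately show ?thesis unfolding MOST_nat mem_Collect_eq
      by (intro exI[of _ "nat \<bar>d0\<bar>"]) auto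
  qed
  show ?thesis
    unfolding hilbert_series_def Abs_fls_inject[OF ev[OF N] ev[OF M]] by (auto simp: fun_eq_iff)
qed

section \<open>Regular sequences on modules in positive degrees\<close>

lemma (in abelian_monoid) finsum_Sigma_times:
  assumes "finite I" "finite B" "\<And>i b. i \<in> I \<Longrightarrow> b \<in> B \<Longrightarrow> f (i, b) \<in> carrier G"
  shows "(\<Oplus>p\<in>I \<times> B. f p) = (\<Oplus>i\<in>I. \<Oplus>b\<in>B. f (i, b))"
  using assms(1,3)
proof (induction I rule: finite_induct)
  case (insert i I)
  have split: "insert i I \<times> B = Pair i ` B \<union> I \<times> B" by auto
  have "(\<Oplus>p\<in>insert i I \<times> B. f p) = (\<Oplus>p\<in>Pair i ` B. f p) \<oplus> (\<Oplus>p\<in>I \<times> B. f p)"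
    unfolding split by (rule finsum_Un_disjoint) (use insert assms(2) in auto)
  also have "(\<Oplus>p\<in>Pair i ` B. f p) = (\<Oplus>b\<in>B. f (i, b))"
    by (rule finsum_reindex) (use insert in \<open>auto intro: inj_onI\<close>)
  also have "(\<Oplus>p\<in>I \<times> B. f p) = (\<Oplus>i\<in>I. \<Oplus>b\<in>B. f (i, b))" using insert by blast
  also have "(\<Oplus>b\<in>B. f (i, b)) \<oplus> \<dots> = (\<Oplus>i\<in>insert i I. \<Oplus>b\<in>B. f (i, b))"
    using insert by (intro finsum_insert[symmetric]) (auto intro!: finsum_closed)
  finally show ?case .
qed simp

lemma max_ideal_sum_Var:
  fixes p :: "('n::finite, 'k::field) mpoly" and v :: "nat \<Rightarrow> 'n"
  assumes v: "bij_betw v {..<n} UNIV" and p: "p \<in> max_ideal"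
  shows "\<exists>c. p = (\<Sum>k<n. c k * Var (v k))"
proof -
  have "\<exists>a c. p = Const a + (\<Sum>k<n. c k * Var (v k))" for p :: "('n, 'k) mpoly"
  proof (induction p rule: mpoly_induct)
    case (Const a)
    show ?case by (intro exI[of _ a] exI[of _ "\<lambda>_. 0"]) simp
  next
    case (add p q)
    then obtain a b c d where "p = Const a + (\<Sum>k<n. c k * Var (v k))" "q = Const b + (\<Sum>k<n. d k * Var (v k))"
      by blast
    then show ?case
      by (intro exI[of _ "a + b"] exI[of _ "\<lambda>k. c k + d k"])
        (simp add: Const_add algebra_simps sum.distrib)
  next
    case (Var i p)
    obtain j where j: "j < n" "v j = i" using v by (metis UNIV_I bij_betw_iff_bijections lessThan_iff)
    have "(\<Sum>k<n. (if k = j then p else 0) * Var (v k)) = (\<Sum>k<n. if k = j then p * Var (v k) else 0)"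
      by (rule sum.cong) auto
    then show ?case using j
      by (intro exI[of _ 0] exI[of _ "\<lambda>k. if k = j then p else 0"]) (simp add: Const_def mult.commute)
  qed
  then obtain a c where ac: "p = Const a + (\<Sum>k<n. c k * Var (v k))" by blast
  have "Poly_Mapping.lookup (c k * Var (v k)) 0 = 0" for k
  proof -
    have "(Var (v k) :: ('n, 'k) mpoly) \<in> max_ideal"
      unfolding max_ideal_def using ring.genideal_self[OF class_ring.ring_axioms, of "range Var"] by auto
    then have "c k * Var (v k) \<in> max_ideal"
      using ideal.I_l_closed[OF ring.genideal_ideal[OF class_ring.ring_axioms], of "range Var" "Var (v k)" "c k"]
      by (simp add: max_ideal_def)
    then show ?thesis by (simp add: mem_max_ideal_iff)
  qed
  then have "a = 0" using p ac by (simp add: mem_max_ideal_iff lookup_add lookup_sum Const_def)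
  then show ?thesis using ac by (auto simp: Const_def)
qed

text \<open>
  A finitely generated module is a quotient of a free module, here of the finitely supported
  functions on its own elements. This carries the results on \<open>regular_mod\<close> over to it.
\<close>

definition free_scale :: "('n::finite, 'k::field) mpoly \<Rightarrow> ('b \<Rightarrow>\<^sub>0 ('n, 'k) mpoly) \<Rightarrow> ('b \<Rightarrow>\<^sub>0 ('n, 'k) mpoly)" where
  "free_scale p = Poly_Mapping.map ((*) p)"

lemma lookup_free_scale [simp]: "Poly_Mapping.lookup (free_scale p f) g = p * Poly_Mapping.lookup f g"
  by (simp add: free_scale_def Poly_Mapping.map.rep_eq when_def)

lemma free_expansion:
  assumes "finite X" "Poly_Mapping.keys f \<subseteq> X"
  shows "f = (\<Sum>g\<in>X. free_scale (Poly_Mapping.lookup f g) (Poly_Mapping.single g 1))"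
proof (rule poly_mapping_eqI)
  fix h
  have "Poly_Mapping.lookup (\<Sum>g\<in>X. free_scale (Poly_Mapping.lookup f g) (Poly_Mapping.single g 1)) h =
      (\<Sum>g\<in>X. if g = h then Poly_Mapping.lookup f h else 0)"
    unfolding lookup_sum by (intro sum.cong) (simp_all add: lookup_single when_def)
  also have "\<dots> = Poly_Mapping.lookup f h"
    using assms by (auto simp: in_keys_iff)
  finally show "Poly_Mapping.lookup f h = Poly_Mapping.lookup
      (\<Sum>g\<in>X. free_scale (Poly_Mapping.lookup f g) (Poly_Mapping.single g 1)) h" by simp
qed

lemma ring_module_free_scale: "ring_module free_scale"
  by (intro ring_module.intro Modules.module.intro) (auto intro!: poly_mapping_eqI simp: lookup_add algebra_simps)

context graded_module
begin

lemma scale_commute: "x \<in> carrier N \<Longrightarrow> p \<odot> (q \<odot> x) = q \<odot> (p \<odot> x)"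
  using scale_simps(3)[of x p q] scale_simps(3)[of x q p] by (simp add: mult.commute)

lemma seq_submodule_Nil: "seq_submodule N [] = {\<zero>}"
proof -
  have "submodule class_ring {\<zero>} N"
    by (intro submodule.intro module_axioms) auto
  then have "span {} \<subseteq> {\<zero>}" by (intro span_is_subset) auto
  moreover have "\<zero> \<in> span {}" using submodule.zero_closed[OF span_is_submodule[of "{}"]] by simp
  ultimately show ?thesis by (auto simp: seq_submodule_def)
qed

lemma seq_submodule_submodule: "submodule class_ring (seq_submodule N rs) N"
  unfolding seq_submodule_def by (rule span_is_submodule) auto

lemma seq_submodule_snoc:
  "seq_submodule N (rs @ [r]) = {q \<oplus> r \<odot> x | q x. q \<in> seq_submodule N rs \<and> x \<in> carrier N}" (is "_ = ?S")
proof
  let ?G = "\<lambda>rs. {r \<odot> x | r x. r \<in> set rs \<and> x \<in> carrier N}"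
  note sub = seq_submodule_submodule[of rs] and sub' = seq_submodule_submodule[of "rs @ [r]"]
  have q: "q \<in> seq_submodule N rs \<Longrightarrow> q \<in> carrier N" for q using submodule.subset[OF sub] by blast
  have gen: "?G rs \<subseteq> seq_submodule N rs" "?G (rs @ [r]) \<subseteq> seq_submodule N (rs @ [r])"
    unfolding seq_submodule_def by (rule in_own_span; auto)+
  have "submodule class_ring ?S N"
  proof (intro submodule.intro module_axioms)
    show "?S \<subseteq> carrier N" using q by auto
    show "\<zero> \<in> ?S" using submodule.zero_closed[OF sub] by (intro CollectI exI[of _ \<zero>] exI[of _ \<zero>]) auto
  next
    fix v w assume "v \<in> ?S" "w \<in> ?S"
    then obtain a x b y where "v = a \<oplus> r \<odot> x" "w = b \<oplus> r \<odot> y" "a \<in> seq_submodule N rs" "b \<in> seq_submodule N rs"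
      "x \<in> carrier N" "y \<in> carrier N" by blast
    then show "v \<oplus> w \<in> ?S" using q submodule.m_closed[OF sub]
      by (intro CollectI exI[of _ "a \<oplus> b"] exI[of _ "x \<oplus> y"]) (auto simp: scale_simps M.a_ac)
  next
    fix c v assume "v \<in> ?S"
    then obtain a x where "v = a \<oplus> r \<odot> x" "a \<in> seq_submodule N rs" "x \<in> carrier N" by blast
    then show "c \<odot> v \<in> ?S" using q submodule.smult_closed[OF sub]
      by (intro CollectI exI[of _ "c \<odot> a"] exI[of _ "c \<odot> x"])
        (auto simp: scale_simps(2) scale_commute[of _ c r])
  qed
  moreover have "?G (rs @ [r]) \<subseteq> ?S"
  proof
    fix v assume "v \<in> ?G (rs @ [r])"
    then obtain s x where sx: "v = s \<odot> x" "s \<in> set rs \<or> s = r" "x \<in> carrier N" by auto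
    show "v \<in> ?S"
    proof (cases "s \<in> set rs")
      case True
      then have "v \<in> seq_submodule N rs" using gen(1) sx by blast
      then show ?thesis using q by (intro CollectI exI[of _ v] exI[of _ \<zero>]) auto
    next
      case False
      then show ?thesis using sx submodule.zero_closed[OF sub]
        by (intro CollectI exI[of _ \<zero>] exI[of _ x]) auto
    qed
  qed
  ultimately show "seq_submodule N (rs @ [r]) \<subseteq> ?S"
    unfolding seq_submodule_def[of N "rs @ [r]"] by (intro span_is_subset)
  have "?G rs \<subseteq> ?G (rs @ [r])" by auto
  then have mono: "seq_submodule N rs \<subseteq> seq_submodule N (rs @ [r])"
    unfolding seq_submodule_def by (rule span_is_monotone)
  show "?S \<subseteq> seq_submodule N (rs @ [r])"
  proof
    fix v assume "v \<in> ?S"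
    then obtain a x where v: "v = a \<oplus> r \<odot> x" "a \<in> seq_submodule N rs" "x \<in> carrier N" by blast
    have "r \<odot> x \<in> ?G (rs @ [r])" using v(3) by auto
    then show "v \<in> seq_submodule N (rs @ [r])"
      using v(1,2) mono gen(2) submodule.m_closed[OF sub', of a "r \<odot> x"] by auto
  qed
qed

lemma finsum_component:
  assumes "finite A" "\<And>i. i \<in> A \<Longrightarrow> f i \<in> component N d"
  shows "finsum (component_space N d) f A = finsum N f A" "finsum N f A \<in> component N d"
proof -
  interpret V: vectorspace class_ring "component_space N d"
    by (rule component_space_vectorspace[OF graded_module_axioms])
  have "finsum (component_space N d) f A = finsum N f A \<and> finsum N f A \<in> component N d"
    using assms
  proof (induction A rule: finite_induct)
    case empty
    have "\<zero>\<^bsub>component_space N d\<^esub> = \<zero>" by (simp add: component_space_def)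
    then show ?case using component_closed(1) by simp
  next
    case (insert i A)
    have "finsum (component_space N d) f (insert i A) = f i \<oplus>\<^bsub>component_space N d\<^esub> finsum (component_space N d) f A"
      using insert by (intro V.M.finsum_insert) (auto simp: component_space_def)
    moreover have "finsum N f (insert i A) = f i \<oplus> finsum N f A"
      using insert component_closed(2) by (intro M.finsum_insert) auto
    ultimately show ?case using insert component_closed(3) by (simp add: component_space_def)
  qed
  then show "finsum (component_space N d) f A = finsum N f A" "finsum N f A \<in> component N d" by auto
qed

text \<open>
  Pull back the regular sequence along the presentation \<open>\<phi>\<close> of \<open>N\<close> by a free module \<open>F\<close>, where \<open>P rs\<close> is
  the preimage of \<open>(rs) N\<close>, and replace it by linear forms.
  As \<open>N\<close> lives in positive degrees, the multiples of linear forms have no part of degree at most 1.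
\<close>

lemma linear_regular_relations:
  assumes inf: "infinite (UNIV :: 'k set)" and fg: "finitely_generated N"
    and rs: "set rs \<subseteq> max_ideal" "regular_sequence N rs"
    and vanish: "\<And>d. d \<le> 0 \<Longrightarrow> component N d = {\<zero>}"
  shows "\<exists>L. (\<forall>i. homogeneous 1 (L i)) \<and>
    (\<forall>w. (\<forall>i<length rs. w i \<in> component N 1) \<longrightarrow> (\<Oplus>i\<in>{..<length rs}. L i \<odot> w i) = \<zero> \<longrightarrow>
      (\<forall>i<length rs. w i = \<zero>))"
proof -
  obtain X where X: "finite X" "X \<subseteq> carrier N" "span X = carrier N"
    using fg unfolding finitely_generated_def by blast
  define \<phi> where "\<phi> f = (\<Oplus>g\<in>X. Poly_Mapping.lookup f g \<odot> g)" for f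
  have \<phi>_carrier [simp]: "\<phi> f \<in> carrier N" for f
    unfolding \<phi>_def using X(2) by (intro M.finsum_closed) auto
  have \<phi>_add: "\<phi> (f + h) = \<phi> f \<oplus> \<phi> h" for f h
  proof -
    have "\<phi> (f + h) = (\<Oplus>g\<in>X. Poly_Mapping.lookup f g \<odot> g \<oplus> Poly_Mapping.lookup h g \<odot> g)"
      unfolding \<phi>_def using X(2)
      by (intro M.finsum_cong') (auto simp: lookup_add scale_simps subset_iff)
    then show ?thesis unfolding \<phi>_def using X(2) by (subst M.finsum_addf[symmetric]) auto
  qed
  have \<phi>_scale: "\<phi> (free_scale p f) = p \<odot> \<phi> f" for p f
  proof -
    have "p \<odot> \<phi> f = (\<Oplus>g\<in>X. p \<odot> (Poly_Mapping.lookup f g \<odot> g))"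
      unfolding \<phi>_def using X(2) by (intro finsum_smult) auto
    also have "\<dots> = \<phi> (free_scale p f)"
      unfolding \<phi>_def using X(2) by (intro M.finsum_cong') (auto simp: scale_simps subset_iff)
    finally show ?thesis by simp
  qed
  have \<phi>_0: "\<phi> 0 = \<zero>" using \<phi>_add[of 0 0] by (metis M.add.r_cancel_one' \<phi>_carrier add_0)
  define F where "F = {f :: 'b \<Rightarrow>\<^sub>0 ('n, 'k) mpoly. Poly_Mapping.keys f \<subseteq> X}"
  have surj: "\<exists>f\<in>F. \<phi> f = x" if "x \<in> carrier N" for x
  proof -
    have "x \<in> {lincomb a X | a. a \<in> X \<rightarrow> carrier class_ring}"
      using that X(3) finite_span[OF X(1,2)] by blast
    then obtain a where a: "x = lincomb a X" by blast
    define f where "f = (\<Sum>g\<in>X. Poly_Mapping.single g (a g))"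
    have lf: "Poly_Mapping.lookup f g = (if g \<in> X then a g else 0)" for g
      using X(1) by (simp add: f_def lookup_sum lookup_single when_def)
    have "\<phi> f = lincomb a X"
      unfolding \<phi>_def lincomb_def using X(2) by (intro M.finsum_cong') (auto simp: lf)
    moreover have "f \<in> F" by (auto simp: F_def in_keys_iff lf split: if_splits)
    ultimately show ?thesis using a by blast
  qed
  define n where "n = CARD('n)"
  obtain v :: "nat \<Rightarrow> 'n" where v: "bij_betw v {..<n} UNIV"
    unfolding n_def using ex_bij_betw_nat_finite[of "UNIV :: 'n set"] by (auto simp: atLeast0LessThan)
  interpret free: ring_module "free_scale :: ('n, 'k) mpoly \<Rightarrow> ('b \<Rightarrow>\<^sub>0 ('n, 'k) mpoly) \<Rightarrow> _"
    by (rule ring_module_free_scale)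
  interpret free: pencil_module "free_scale :: ('n, 'k) mpoly \<Rightarrow> ('b \<Rightarrow>\<^sub>0 ('n, 'k) mpoly) \<Rightarrow> _" Const "\<lambda>k. Var (v k)" n
    by unfold_locales (rule Const_add Const_mult Const_1)+
  have submodI: "free.submod U" if U: "free.stable_subgroup (range Const \<union> range Var) U" for U
  proof -
    note u = free.stable_subgroupD[OF U]
    have "free_scale p f \<in> U" if "f \<in> U" for p f
    proof (induction p rule: mpoly_induct)
      case (add p q) then show ?case using u(2) by (simp add: free.scale_left_distrib)
    next
      case (Var i p) then show ?case using u(4)[of "Var i" "free_scale p f"] by simp
    qed (use u(4) that in auto)
    then show ?thesis using u by (auto simp: free.stable_subgroup_def)
  qed
  \<comment> \<open>\<open>F\<close> is Noetherian: start from the span of its basis over the field and adjoin the variables.\<close>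
  obtain M1 where M1: "(\<lambda>g. Poly_Mapping.single g 1) ` X \<subseteq> M1" "free.noetherian_over (range Const) M1"
    using free.noetherian_over_finite_dimensional[of "(\<lambda>g. Poly_Mapping.single g 1) ` X"] X(1) by blast
  obtain M2 where M2: "M1 \<subseteq> M2" "free.noetherian_over (range Const \<union> range Var) M2"
    using free.noetherian_over_extend[OF _ M1(2), of "range Var"] by auto
  have sM2: "free.submod M2" using M2(2) submodI by (auto simp: free.noetherian_over_def)
  have F_iff: "f \<in> F \<longleftrightarrow> (\<forall>g. g \<notin> X \<longrightarrow> Poly_Mapping.lookup f g = 0)" for f
    by (auto simp: F_def in_keys_iff)
  have sF: "free.submod F"
    by (simp add: free.stable_subgroup_def F_iff lookup_add)
  have "F \<subseteq> M2"
  proof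
    fix f assume f: "f \<in> F"
    have "f = (\<Sum>g\<in>X. free_scale (Poly_Mapping.lookup f g) (Poly_Mapping.single g 1))"
      using f free_expansion[OF X(1), of f] unfolding F_def by simp
    also have "\<dots> \<in> M2"
    proof (rule free.submod_sum[OF sM2])
      fix g assume "g \<in> X"
      then have "Poly_Mapping.single g 1 \<in> M2" using M1(1) M2(1) by blast
      then show "free_scale (Poly_Mapping.lookup f g) (Poly_Mapping.single g 1) \<in> M2"
        by (rule free.submodD(4)[OF sM2])
    qed
    finally show "f \<in> M2" .
  qed
  then have F: "free.noetherian_over UNIV F"
    using free.noetherian_over_subset[OF M2(2) _ _ sF] by simp
  define P where "P rs = {f\<in>F. \<phi> f \<in> seq_submodule N rs}" for rs
  note f = free.submodD[OF sF]
  have P_snoc: "P (rs @ [r]) = free.adjoin F (P rs) r" for rs r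
  proof
    show "free.adjoin F (P rs) r \<subseteq> P (rs @ [r])"
    proof
      fix h assume "h \<in> free.adjoin F (P rs) r"
      then obtain p y where h: "h = p + free_scale r y" "p \<in> F" "\<phi> p \<in> seq_submodule N rs" "y \<in> F"
        by (auto simp: free.adjoin_def P_def)
      then have "\<phi> h = \<phi> p \<oplus> r \<odot> \<phi> y" "h \<in> F" using f(2,4) by (auto simp: \<phi>_add \<phi>_scale)
      then show "h \<in> P (rs @ [r])" using h(3) \<phi>_carrier[of y] unfolding P_def seq_submodule_snoc by blast
    qed
    show "P (rs @ [r]) \<subseteq> free.adjoin F (P rs) r"
    proof
      fix h assume h: "h \<in> P (rs @ [r])"
      then obtain q x where qx: "\<phi> h = q \<oplus> r \<odot> x" "q \<in> seq_submodule N rs" "x \<in> carrier N" "h \<in> F"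
        unfolding P_def seq_submodule_snoc by blast
      obtain y where y: "y \<in> F" "\<phi> y = x" using surj[OF qx(3)] by blast
      have qc: "q \<in> carrier N" using qx(2) submodule.subset[OF seq_submodule_submodule] by blast
      have "\<phi> (h - free_scale r y) \<oplus> r \<odot> x = q \<oplus> r \<odot> x"
        using \<phi>_add[of "h - free_scale r y" "free_scale r y"] qx(1) by (simp add: \<phi>_scale y(2))
      then have "\<phi> (h - free_scale r y) = q" using qc qx(3) by simp
      then have "h - free_scale r y \<in> P rs" using qx y f(4,5) by (simp add: P_def)
      then show "h \<in> free.adjoin F (P rs) r" unfolding free.adjoin_def using y(1)
        by (intro CollectI exI[of _ "h - free_scale r y"] exI[of _ y]) simp
    qed
  qed
  have P_foldl: "P rs = foldl (free.adjoin F) (P []) rs" for rs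
    by (induction rs rule: rev_induct) (simp_all add: P_snoc)
  have sP: "free.submod (P [])"
    unfolding free.stable_subgroup_def
  proof (intro conjI ballI)
    have neg: "\<phi> (- h) = \<zero>" if "\<phi> h = \<zero>" for h
      using \<phi>_add[of h "- h"] that by (simp add: \<phi>_0)
    show "- h \<in> P []" if "h \<in> P []" for h using that f(3) neg by (auto simp: P_def seq_submodule_Nil)
  qed (use f in \<open>auto simp: P_def seq_submodule_Nil \<phi>_0 \<phi>_add \<phi>_scale\<close>)
  have PF: "P [] \<subseteq> F" by (auto simp: P_def)
  have "free.regular_mod F (P []) rs"
    unfolding free.regular_mod_iff_nth free.nonzerodivisor_mod_def P_foldl[symmetric]
    using rs(2) unfolding regular_sequence_def by (auto simp: P_def \<phi>_scale)
  moreover have "\<exists>c. r = (\<Sum>k<n. c k * Var (v k))" if "r \<in> set rs" for r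
    using max_ideal_sum_Var[OF v] rs(1) that by blast
  ultimately obtain ts where ts: "length ts = length rs" "free.regular_mod F (P []) (map free.pencil ts)"
    using free.regular_mod_by_pencil[OF inf F sP PF] by blast
  have hom: "homogeneous 1 (free.pencil t)" for t
    unfolding free.pencil_def using homogeneous_mult[OF homogeneous_Const homogeneous_Var]
    by (intro homogeneous_sum) simp
  have shift: "part x d = \<zero>" if "x \<in> carrier N" "d \<le> 0" for x d
    using part(1)[OF that(1), of d] vanish[OF that(2)] by simp
  define G where "G = {f\<in>F. \<forall>d\<le>1. part (\<phi> f) d = \<zero>}"
  have part_0: "part \<zero> d = \<zero>" for d using part_component[OF component_closed(1), of 0] by simp
  have sG: "free.submod G"
  proof (rule submodI, unfold free.stable_subgroup_def, intro conjI ballI)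
    show "0 \<in> G" using f(1) by (simp add: G_def \<phi>_0 part_0)
    show "g + h \<in> G" if "g \<in> G" "h \<in> G" for g h
      using that f(2) by (auto simp: G_def \<phi>_add part_add)
    have C: "free_scale (Const c) h \<in> G" if "h \<in> G" for c h
      using that f(4) by (auto simp: G_def \<phi>_scale part_scale[OF homogeneous_Const])
    have "Const (- 1) = (- 1 :: ('n, 'k) mpoly)" by (simp add: Const_def single_uminus)
    then have neg: "- h = free_scale (Const (- 1)) h" for h :: "'b \<Rightarrow>\<^sub>0 ('n, 'k) mpoly"
      by - (rule poly_mapping_eqI, simp)
    show "- h \<in> G" if "h \<in> G" for h using C[OF that, of "- 1"] unfolding neg[of h] .
    have V: "free_scale (Var i) h \<in> G" if "h \<in> G" for i h
      using that f(4) by (auto simp: G_def \<phi>_scale part_scale[OF homogeneous_Var])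
    show "free_scale r h \<in> G" if "r \<in> range Const \<union> range Var" "h \<in> G" for r h
      using that C V by blast
  qed
  define L where "L i = free.pencil (ts ! i)" for i
  show ?thesis
  proof (intro exI[of _ L] conjI allI impI)
    show "homogeneous 1 (L i)" for i unfolding L_def by (rule hom)
  next
    fix w i assume w': "\<forall>i<length rs. w i \<in> component N 1"
      and rel: "(\<Oplus>i\<in>{..<length rs}. L i \<odot> w i) = \<zero>" and i: "i < length rs"
    have w: "w i \<in> component N 1" if "i < length rs" for i using w' that by blast
    have wc: "w i \<in> carrier N" if "i < length rs" for i using w[OF that] by (rule component_closed(2))
    have "\<forall>i. \<exists>f. i < length rs \<longrightarrow> f \<in> F \<and> \<phi> f = w i"
      using surj wc by blast
    then obtain y where y: "\<And>i. i < length rs \<Longrightarrow> y i \<in> F \<and> \<phi> (y i) = w i" by metis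
    have "y i \<in> P []"
    proof (rule free.regular_mod_relation_trivial[OF ts(2) sP PF sF sG, where Y = "{f\<in>F. \<phi> f \<in> component N 1}"])
      show "P [] \<subseteq> G" by (auto simp: P_def G_def seq_submodule_Nil part_0)
      show "free_scale l h \<in> G" if "l \<in> set (map free.pencil ts)" "h \<in> F" for l h
        using that f(4) shift part_scale[OF hom] by (auto simp: G_def \<phi>_scale)
      show "{f \<in> F. \<phi> f \<in> component N 1} \<inter> G \<subseteq> P []"
        using part_component[of _ 1] by (auto simp: G_def P_def seq_submodule_Nil)
      show "y j \<in> {f \<in> F. \<phi> f \<in> component N 1}" if "j < length (map free.pencil ts)" for j
        using that y w ts(1) by simp
      have "\<phi> (\<Sum>i<m. free_scale (L i) (y i)) = (\<Oplus>i\<in>{..<m}. L i \<odot> w i)"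
        if "m \<le> length rs" for m
        using that
      proof (induction m)
        case (Suc m)
        have "(\<Oplus>i\<in>insert m {..<m}. L i \<odot> w i) = L m \<odot> w m \<oplus> (\<Oplus>i\<in>{..<m}. L i \<odot> w i)"
          using Suc.prems wc by (intro M.finsum_insert) auto
        moreover have "(\<Oplus>i\<in>{..<m}. L i \<odot> w i) \<in> carrier N" "L m \<odot> w m \<in> carrier N"
          using Suc.prems wc by (auto intro!: M.finsum_closed)
        ultimately show ?case using Suc y[of m]
          by (simp add: \<phi>_add \<phi>_scale lessThan_Suc M.a_comm)
      qed (simp add: \<phi>_0)
      then have "\<phi> (\<Sum>i<length rs. free_scale (L i) (y i)) = \<zero>" using rel by simp
      moreover have "(\<Sum>i<length rs. free_scale (L i) (y i)) \<in> F"
        using y f(4) by (intro free.submod_sum[OF sF]) auto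
      ultimately show "(\<Sum>i<length (map free.pencil ts). free_scale (map free.pencil ts ! i) (y i)) \<in> P []"
        by (simp add: P_def seq_submodule_Nil L_def ts(1) cong: sum.cong_simp)
    qed (use i ts(1) in auto)
    then show "w i = \<zero>" using y[OF i] by (simp add: P_def seq_submodule_Nil)
  qed
qed

text \<open>
  The linear forms map the direct sum of \<open>length rs\<close> copies of the component of degree 1 injectively
  into the component of degree 2.
\<close>

lemma regular_sequence_length_bound:
  assumes inf: "infinite (UNIV :: 'k set)" and fg: "finitely_generated N"
    and rs: "set rs \<subseteq> max_ideal" "regular_sequence N rs"
    and vanish: "\<And>d. d \<le> 0 \<Longrightarrow> component N d = {\<zero>}"
  shows "length rs * vectorspace.dim class_ring (component_space N 1) \<le>
    vectorspace.dim class_ring (component_space N 2)"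
proof -
  have "\<exists>L. (\<forall>i. homogeneous 1 (L i)) \<and>
    (\<forall>w. (\<forall>i<length rs. w i \<in> component N 1) \<longrightarrow> (\<Oplus>i\<in>{..<length rs}. L i \<odot> w i) = \<zero> \<longrightarrow>
      (\<forall>i<length rs. w i = \<zero>))"
    using assms by (rule linear_regular_relations)
  then obtain L :: "nat \<Rightarrow> ('n, 'k) mpoly"
    where L: "\<And>i. homogeneous 1 (L i)"
      and indep: "\<And>w. \<forall>i<length rs. w i \<in> component N 1 \<Longrightarrow>
        (\<Oplus>i\<in>{..<length rs}. L i \<odot> w i) = \<zero> \<Longrightarrow> \<forall>i<length rs. w i = \<zero>"
    by blast
  let ?V = "component_space N"
  interpret V1: vectorspace class_ring "?V 1" by (rule component_space_vectorspace[OF graded_module_axioms])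
  obtain B where B: "finite B" "V1.basis B"
    using V1.finite_basis_exists finite_dimensional_components(1)[OF fg] by blast
  have "carrier (?V 1) = component N 1" by (simp add: component_space_def)
  then have B1: "B \<subseteq> component N 1" using B(2) unfolding V1.basis_def by blast
  have dim1: "V1.dim = card B" using V1.dim_basis[OF B] .
  have "card ({..<length rs} \<times> B) \<le> vectorspace.dim class_ring (?V 2)"
  proof (rule independent_family_card_le_dim[where v = "\<lambda>(i, b). L i \<odot> b"])
    show "vectorspace class_ring (?V 2)" by (rule component_space_vectorspace[OF graded_module_axioms])
    show "vectorspace.fin_dim class_ring (?V 2)" by (rule finite_dimensional_components(1)[OF fg])
    show "finite ({..<length rs} \<times> B)" using B(1) by simp
    have Lb: "L i \<odot> x \<in> component N 2" if "x \<in> component N 1" for i x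
      using smult_component[OF L that, of i] by simp
    then show "(case p of (i, b) \<Rightarrow> L i \<odot> b) \<in> carrier (?V 2)" if "p \<in> {..<length rs} \<times> B" for p
      using that B1 by (auto simp: component_space_def)
    fix a p assume eq: "(\<Oplus>\<^bsub>?V 2\<^esub>p\<in>{..<length rs} \<times> B. a p \<odot>\<^bsub>?V 2\<^esub> (case p of (i, b) \<Rightarrow> L i \<odot> b)) = \<zero>\<^bsub>?V 2\<^esub>"
      and p: "p \<in> {..<length rs} \<times> B"
    have smult: "a \<odot>\<^bsub>?V d\<^esub> x = Const a \<odot> x" for a d x by (simp add: component_space_def)
    have zero: "\<zero>\<^bsub>?V d\<^esub> = \<zero>" for d by (simp add: component_space_def)
    define w where "w i = (\<Oplus>b\<in>B. Const (a (i, b)) \<odot> b)" for i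
    have w: "w i \<in> component N 1" for i
      unfolding w_def by (rule finsum_component(2)[OF B(1)]) (use B1 component_closed(4) in auto)
    have "(\<Oplus>p\<in>{..<length rs} \<times> B. Const (a p) \<odot> (case p of (i, b) \<Rightarrow> L i \<odot> b)) = \<zero>"
      using eq unfolding smult zero
      by (subst (asm) finsum_component(1)) (use B(1) B1 Lb component_closed(4) in auto)
    also have "(\<Oplus>p\<in>{..<length rs} \<times> B. Const (a p) \<odot> (case p of (i, b) \<Rightarrow> L i \<odot> b)) =
        (\<Oplus>i\<in>{..<length rs}. \<Oplus>b\<in>B. Const (a (i, b)) \<odot> (L i \<odot> b))"
      using B(1) B1 component_closed(2) by (subst M.finsum_Sigma_times) auto
    also have "\<dots> = (\<Oplus>i\<in>{..<length rs}. L i \<odot> w i)"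
    proof (rule M.finsum_cong')
      show "(\<Oplus>b\<in>B. Const (a (i, b)) \<odot> (L i \<odot> b)) = L i \<odot> w i" for i
      proof -
        have "L i \<odot> w i = (\<Oplus>b\<in>B. L i \<odot> (Const (a (i, b)) \<odot> b))"
          unfolding w_def using B1 component_closed(2) by (intro finsum_smult) auto
        also have "\<dots> = (\<Oplus>b\<in>B. Const (a (i, b)) \<odot> (L i \<odot> b))"
          using B1 component_closed(2)
          by (intro M.finsum_cong') (auto simp: scale_commute[of _ "L i"] subset_iff)
        finally show ?thesis by simp
      qed
      show "(\<lambda>i. L i \<odot> w i) \<in> {..<length rs} \<rightarrow> carrier N"
        using component_closed(2)[OF w] by simp
    qed simp
    finally have "w i = \<zero>" if "i < length rs" for i using indep[of w] w that by blast
    then have w0: "w (fst p) = \<zero>" using p by auto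
    have "V1.lincomb (\<lambda>b. a (fst p, b)) B = \<zero>\<^bsub>?V 1\<^esub>"
      unfolding V1.lincomb_def smult zero w0[symmetric] w_def
      by (rule finsum_component(1)[OF B(1)]) (use B1 component_closed(4) in auto)
    moreover have "V1.lin_indpt B" using B(2) by (simp add: V1.basis_def)
    ultimately have "a (fst p, b) = 0" if "b \<in> B" for b
      using V1.lin_dep_crit[of B B "\<lambda>b. a (fst p, b)" b] B(1) that by auto
    then show "a p = 0" using p by auto
  qed
  then show ?thesis by (simp add: dim1 card_cartesian_product)
qed

end

section \<open>Counting monomials\<close>

definition monomials :: "'n::finite set \<Rightarrow> nat \<Rightarrow> ('n \<Rightarrow>\<^sub>0 nat) set" where
  "monomials V k = {e. Poly_Mapping.keys e \<subseteq> V \<and> total_degree e = k}"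

lemma finite_monomials: "finite (monomials V k)"
  unfolding monomials_def by (rule finite_subset[OF _ finite_total_degree[of k]]) auto

lemma total_degree_eq_0_iff: "total_degree e = 0 \<longleftrightarrow> e = 0"
  by (auto simp: total_degree_def intro: poly_mapping_eqI)

lemma monomials_0: "monomials V 0 = {0}"
  by (auto simp: monomials_def total_degree_eq_0_iff)

lemma monomials_empty: "monomials {} k = (if k = 0 then {0} else {})"
  by (auto simp: monomials_def)

lemma keys_add_nat: "Poly_Mapping.keys (e + f :: 'n \<Rightarrow>\<^sub>0 nat) = Poly_Mapping.keys e \<union> Poly_Mapping.keys f"
  by (auto simp: in_keys_iff lookup_add)

text \<open>
  A monomial either contains the variable \<open>v\<close>, and can be divided by it, or does not contain it.
\<close>

lemma card_monomials_insert:
  assumes "v \<notin> V"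
  shows "card (monomials (insert v V) (Suc k)) = card (monomials (insert v V) k) + card (monomials V (Suc k))"
proof -
  let ?s = "\<lambda>e. Poly_Mapping.single v 1 + e"
  have "monomials (insert v V) (Suc k) = ?s ` monomials (insert v V) k \<union> monomials V (Suc k)"
  proof (intro equalityI subsetI)
    fix e assume e: "e \<in> monomials (insert v V) (Suc k)"
    show "e \<in> ?s ` monomials (insert v V) k \<union> monomials V (Suc k)"
    proof (cases "v \<in> Poly_Mapping.keys e")
      case True
      define f where "f = e - Poly_Mapping.single v 1"
      have ef: "e = ?s f" unfolding f_def
        by (rule poly_mapping_eqI) (use True in \<open>auto simp: lookup_add lookup_minus lookup_single when_def in_keys_iff\<close>)
      then have "f \<in> monomials (insert v V) k"
        using e by (auto simp: monomials_def total_degree_add total_degree_single keys_add_nat)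
      then show ?thesis using ef by blast
    next
      case False
      then show ?thesis using e by (auto simp: monomials_def)
    qed
  qed (auto simp: monomials_def total_degree_add total_degree_single keys_add_nat)
  moreover have "?s ` monomials (insert v V) k \<inter> monomials V (Suc k) = {}"
    using assms by (auto simp: monomials_def keys_add_nat)
  moreover have "card (?s ` monomials (insert v V) k) = card (monomials (insert v V) k)"
    by (rule card_image) (auto intro: inj_onI)
  ultimately show ?thesis
    using card_Un_disjoint[of "?s ` monomials (insert v V) k" "monomials V (Suc k)"]
      finite_monomials[of "insert v V" k] finite_monomials[of V "Suc k"] by simp
qed

lemma card_monomials:
  assumes "V \<noteq> {}"
  shows "card (monomials (V :: 'n::finite set) k) = (card V + k - 1) choose k"
  using finite[of V] assms
proof (induction V arbitrary: k rule: finite_ne_induct)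
  case (singleton v)
  show ?case
  proof (induction k)
    case (Suc k)
    then show ?case using card_monomials_insert[of v "{}" k] by (simp add: monomials_empty)
  qed (simp add: monomials_0)
next
  case (insert v V)
  show ?case
  proof (induction k)
    case (Suc k)
    have "card V > 0" using insert by (simp add: card_gt_0_iff)
    then obtain m where "card V = Suc m" by (cases "card V") auto
    then show ?case using card_monomials_insert[OF insert(3), of k] Suc insert.IH[of "Suc k"] insert.hyps by simp
  qed (simp add: monomials_0)
qed

lemma alternating_nth: "fps_nth ((1 - fps_X :: int fps) ^ d) i = (- 1) ^ i * int (d choose i)"
proof (induction d arbitrary: i)
  case (Suc d)
  have "fps_nth ((1 - fps_X :: int fps) ^ Suc d) i =
      fps_nth ((1 - fps_X) ^ d) i - fps_nth (fps_X * (1 - fps_X :: int fps) ^ d) i"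
    by (simp add: algebra_simps)
  then show ?case using Suc by (cases i) (simp_all add: algebra_simps)
qed (simp add: binomial_eq_0)

lemma monomials_fps: "(1 - fps_X) ^ card V * Abs_fps (\<lambda>k. int (card (monomials (V :: 'n::finite set) k))) = 1"
  using finite[of V]
proof (induction V rule: finite_induct)
  case empty
  show ?case by (rule fps_ext) (simp add: monomials_empty)
next
  case (insert v V)
  let ?F = "\<lambda>V. Abs_fps (\<lambda>k. int (card (monomials V k)))"
  have "(1 - fps_X) * ?F (insert v V) = ?F V"
  proof (rule fps_ext)
    fix k
    show "fps_nth ((1 - fps_X) * ?F (insert v V)) k = fps_nth (?F V) k"
      using card_monomials_insert[OF insert(2)] by (cases k) (simp_all add: left_diff_distrib monomials_0)
  qed
  then have "(1 - fps_X) ^ card (insert v V) * ?F (insert v V) = (1 - fps_X) ^ card V * ?F V"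
    using insert by (simp add: mult.assoc mult.left_commute[of "1 - fps_X"])
  then show ?case using insert by simp
qed

text \<open>
  The coefficients of \<open>(1 - t)\<^sup>d\<close> times the Hilbert series \<open>1 / (1 - t)\<^sup>d\<close> of the polynomial ring in \<open>d\<close>
  variables.
\<close>

lemma alternating_monomials_sum:
  fixes Z :: "'n::finite set"
  shows "(\<Sum>i\<le>j. (- 1) ^ i * int (card Z choose i) * int (card (monomials Z (j - i)))) = (if j = 0 then 1 else 0)"
proof -
  have "fps_nth ((1 - fps_X) ^ card Z * Abs_fps (\<lambda>k. int (card (monomials Z k)))) j = fps_nth 1 j"
    unfolding monomials_fps ..
  then show ?thesis by (simp add: fps_mult_nth alternating_nth atLeast0AtMost)
qed

definition partial_degree :: "'n::finite set \<Rightarrow> ('n \<Rightarrow>\<^sub>0 nat) \<Rightarrow> nat" where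
  "partial_degree Y e = (\<Sum>i\<in>Y. Poly_Mapping.lookup e i)"

definition restrict_keys :: "'n set \<Rightarrow> ('n \<Rightarrow>\<^sub>0 'k::zero) \<Rightarrow> ('n \<Rightarrow>\<^sub>0 'k)" where
  "restrict_keys Y e = Poly_Mapping.mapp (\<lambda>i c. if i \<in> Y then c else 0) e"

lemma lookup_restrict_keys: "Poly_Mapping.lookup (restrict_keys Y e) i = (if i \<in> Y then Poly_Mapping.lookup e i else 0)"
  by (simp add: restrict_keys_def lookup_mapp when_def in_keys_iff)

lemma total_degree_split: "total_degree e = partial_degree Y e + partial_degree (- Y) e"
proof -
  have "sum (Poly_Mapping.lookup e) (Y \<union> - Y) = partial_degree Y e + partial_degree (- Y) e"
    unfolding partial_degree_def by (rule sum.union_disjoint) auto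
  then show ?thesis by (simp add: total_degree_def)
qed

text \<open>
  A monomial is the product of its part in the variables \<open>Y\<close> and its part in the others.
\<close>

lemma card_partial_degree:
  "card {e :: 'n::finite \<Rightarrow>\<^sub>0 nat. total_degree e = i + k \<and> partial_degree Y e = i} =
     card (monomials Y i) * card (monomials (- Y) k)"
proof -
  have td: "total_degree e = partial_degree V e" if "Poly_Mapping.keys e \<subseteq> V" for e :: "'n \<Rightarrow>\<^sub>0 nat" and V
  proof -
    have "partial_degree (- V) e = 0" unfolding partial_degree_def
      by (rule sum.neutral) (use that in \<open>auto simp: in_keys_iff\<close>)
    then show ?thesis using total_degree_split[of e V] by simp
  qed
  have "bij_betw (\<lambda>(a, b). a + b) (monomials Y i \<times> monomials (- Y) k)
      {e. total_degree e = i + k \<and> partial_degree Y e = i}"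
  proof (rule bij_betw_byWitness[where f' = "\<lambda>e. (restrict_keys Y e, restrict_keys (- Y) e)"])
    show "\<forall>p\<in>monomials Y i \<times> monomials (- Y) k.
        (\<lambda>e. (restrict_keys Y e, restrict_keys (- Y) e)) (case p of (a, b) \<Rightarrow> a + b) = p"
      by (auto simp: monomials_def lookup_restrict_keys lookup_add in_keys_iff subset_iff intro!: poly_mapping_eqI)
    show "\<forall>e\<in>{e. total_degree e = i + k \<and> partial_degree Y e = i}.
        (case (restrict_keys Y e, restrict_keys (- Y) e) of (a, b) \<Rightarrow> a + b) = e"
      by (auto simp: lookup_restrict_keys lookup_add intro!: poly_mapping_eqI)
    show "(\<lambda>(a, b). a + b) ` (monomials Y i \<times> monomials (- Y) k) \<subseteq>
        {e. total_degree e = i + k \<and> partial_degree Y e = i}"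
    proof (rule image_subsetI)
      fix p :: "('n \<Rightarrow>\<^sub>0 nat) \<times> ('n \<Rightarrow>\<^sub>0 nat)" assume "p \<in> monomials Y i \<times> monomials (- Y) k"
      then obtain a b where ab: "p = (a, b)" "a \<in> monomials Y i" "b \<in> monomials (- Y) k" by blast
      then have "partial_degree Y (a + b) = partial_degree Y a"
        unfolding partial_degree_def
        by (intro sum.cong) (auto simp: monomials_def lookup_add in_keys_iff subset_iff)
      then show "(case p of (a, b) \<Rightarrow> a + b) \<in> {e. total_degree e = i + k \<and> partial_degree Y e = i}"
        using ab td[of a Y] by (auto simp: monomials_def total_degree_add)
    qed
    show "(\<lambda>e. (restrict_keys Y e, restrict_keys (- Y) e)) ` {e. total_degree e = i + k \<and> partial_degree Y e = i} \<subseteq>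
        monomials Y i \<times> monomials (- Y) k"
    proof (rule image_subsetI)
      fix e :: "'n \<Rightarrow>\<^sub>0 nat" assume e: "e \<in> {e. total_degree e = i + k \<and> partial_degree Y e = i}"
      have keys: "Poly_Mapping.keys (restrict_keys V e) \<subseteq> V" for V
        by (auto simp: in_keys_iff lookup_restrict_keys split: if_splits)
      have "partial_degree V (restrict_keys V e) = partial_degree V e" for V
        unfolding partial_degree_def by (rule sum.cong) (auto simp: lookup_restrict_keys)
      then have "total_degree (restrict_keys V e) = partial_degree V e" for V
        using td[OF keys[of V]] by simp
      then show "(restrict_keys Y e, restrict_keys (- Y) e) \<in> monomials Y i \<times> monomials (- Y) k"
        using e total_degree_split[of e Y] keys by (auto simp: monomials_def)
    qed
  qed
  then have "card (monomials Y i \<times> monomials (- Y) k) = card {e. total_degree e = i + k \<and> partial_degree Y e = i}"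
    by (rule bij_betw_same_card)
  then show ?thesis by (simp add: card_cartesian_product)
qed

lemma card_high_partial_degree:
  "int (card {e :: 'n::finite \<Rightarrow>\<^sub>0 nat. total_degree e = j \<and> J \<le> partial_degree Y e}) =
     int (card (monomials (UNIV :: 'n set) j)) -
     (\<Sum>i | i < J \<and> i \<le> j. int (card (monomials Y i)) * int (card (monomials (- Y) (j - i))))"
proof -
  let ?A = "{e :: 'n \<Rightarrow>\<^sub>0 nat. total_degree e = j \<and> J \<le> partial_degree Y e}"
  let ?C = "\<lambda>i. {e :: 'n \<Rightarrow>\<^sub>0 nat. total_degree e = j \<and> partial_degree Y e = i}"
  have le: "partial_degree Y e \<le> total_degree e" for e :: "'n \<Rightarrow>\<^sub>0 nat"
    using total_degree_split[of e Y] by simp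
  have fin: "finite {e :: 'n \<Rightarrow>\<^sub>0 nat. total_degree e = j \<and> P e}" for P
    by (rule finite_subset[OF _ finite_total_degree[of j]]) auto
  have "monomials UNIV j = ?A \<union> (\<Union>i\<in>{i. i < J \<and> i \<le> j}. ?C i)"
    using le by (auto simp: monomials_def not_le)
  then have "card (monomials (UNIV :: 'n set) j) = card ?A + card (\<Union>i\<in>{i. i < J \<and> i \<le> j}. ?C i)"
    by (simp only:) (rule card_Un_disjoint, use fin in auto)
  also have "card (\<Union>i\<in>{i. i < J \<and> i \<le> j}. ?C i) = (\<Sum>i | i < J \<and> i \<le> j. card (?C i))"
    by (rule card_UN_disjoint) (use fin in auto)
  also have "\<dots> = (\<Sum>i | i < J \<and> i \<le> j. card (monomials Y i) * card (monomials (- Y) (j - i)))"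
  proof (rule sum.cong)
    fix i assume "i \<in> {i. i < J \<and> i \<le> j}"
    then show "card (?C i) = card (monomials Y i) * card (monomials (- Y) (j - i))"
      using card_partial_degree[of i "j - i" Y] by simp
  qed simp
  finally show ?thesis by simp
qed

section \<open>Modules with a basis of monomials\<close>

lemma restrict_keys_add: "restrict_keys A (p + q) = restrict_keys A p + restrict_keys A (q :: 'a \<Rightarrow>\<^sub>0 'b::comm_monoid_add)"
  by (rule poly_mapping_eqI) (simp add: lookup_restrict_keys lookup_add)

lemma keys_restrict_keys: "Poly_Mapping.keys (restrict_keys A p) = Poly_Mapping.keys p \<inter> A"
  by (auto simp: in_keys_iff lookup_restrict_keys split: if_splits)

lemma restrict_keys_id: "Poly_Mapping.keys p \<subseteq> A \<Longrightarrow> restrict_keys A p = p"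
  by (rule poly_mapping_eqI) (auto simp: lookup_restrict_keys in_keys_iff)

lemma poly_mapping_sum_singles: "(\<Sum>e\<in>Poly_Mapping.keys p. Poly_Mapping.single e (Poly_Mapping.lookup p e)) = p"
  by (rule poly_mapping_eqI) (auto simp: lookup_sum lookup_single when_def in_keys_iff)

lemma lookup_single_mult:
  fixes p :: "('n \<Rightarrow>\<^sub>0 nat) \<Rightarrow>\<^sub>0 'k::comm_ring_1"
  shows "Poly_Mapping.lookup (Poly_Mapping.single u c * p) (u + e) = c * Poly_Mapping.lookup p e"
proof -
  have "Poly_Mapping.single u c * p = (\<Sum>k\<in>Poly_Mapping.keys p. Poly_Mapping.single (u + k) (c * Poly_Mapping.lookup p k))"
    by (subst poly_mapping_sum_singles[of p, symmetric]) (simp add: sum_distrib_left mult_single)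
  then have "Poly_Mapping.lookup (Poly_Mapping.single u c * p) (u + e) =
      (\<Sum>k\<in>Poly_Mapping.keys p. if k = e then c * Poly_Mapping.lookup p e else 0)"
    by (simp add: lookup_sum lookup_single when_def)
  then show ?thesis by (simp add: in_keys_iff)
qed

lemma lookup_Const_mult: "Poly_Mapping.lookup (Const c * p) e = c * Poly_Mapping.lookup p e"
  using lookup_single_mult[of 0 c p e] by (simp add: Const_def)

lemma keys_Var_mult:
  fixes p :: "('n \<Rightarrow>\<^sub>0 nat) \<Rightarrow>\<^sub>0 'k::comm_ring_1"
  shows "Poly_Mapping.keys (Var z * p) = (+) (Poly_Mapping.single z 1) ` Poly_Mapping.keys p"
proof
  show "Poly_Mapping.keys (Var z * p) \<subseteq> (+) (Poly_Mapping.single z 1) ` Poly_Mapping.keys p"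
    using keys_mult[of "Var z" p] by (auto simp: Var_def split: if_splits)
  show "(+) (Poly_Mapping.single z 1) ` Poly_Mapping.keys p \<subseteq> Poly_Mapping.keys (Var z * p)"
    using lookup_single_mult[of "Poly_Mapping.single z 1" 1 p] by (auto simp: Var_def in_keys_iff)
qed

text \<open>
  A direct sum, indexed by \<open>'i\<close>, of modules with a basis of monomials: summand \<open>b\<close> has the basis
  \<open>B b\<close>, its degrees are shifted by \<open>a b\<close>, and a product of basis elements counts as 0 when it leaves
  \<open>B b\<close>. By convexity a product that has left \<open>B b\<close> cannot return to it, so the multiplication is
  associative. The phantom argument \<open>ground\<close> fixes the field of coefficients.
\<close>

locale monomial_module =
  fixes B :: "'i \<Rightarrow> ('n::finite \<Rightarrow>\<^sub>0 nat) set" and a :: "'i \<Rightarrow> nat" and ground :: "'k::field itself"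
  assumes convex: "e \<in> B b \<Longrightarrow> e + u + v \<in> B b \<Longrightarrow> e + u \<in> B b"
    and finite_support: "finite {b. B b \<noteq> {}}"
begin

definition M :: "(('n, 'k) mpoly, 'i \<Rightarrow> ('n, 'k) mpoly) graded_module" where
  "M = \<lparr>carrier = {f. \<forall>b. Poly_Mapping.keys (f b) \<subseteq> B b}, mult = (\<lambda>f g. f), one = (\<lambda>_. 0),
     zero = (\<lambda>_. 0), add = (\<lambda>f g b. f b + g b), smult = (\<lambda>p f b. restrict_keys (B b) (p * f b)),
     component = (\<lambda>d. {f. \<forall>b. Poly_Mapping.keys (f b) \<subseteq> B b \<and> homogeneous (d - int (a b)) (f b)})\<rparr>"

lemma M_simps [simp]:
  "f \<in> carrier M \<longleftrightarrow> (\<forall>b. Poly_Mapping.keys (f b) \<subseteq> B b)"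
  "\<zero>\<^bsub>M\<^esub> = (\<lambda>_. 0)" "f \<oplus>\<^bsub>M\<^esub> g = (\<lambda>b. f b + g b)" "p \<odot>\<^bsub>M\<^esub> f = (\<lambda>b. restrict_keys (B b) (p * f b))"
  "f \<in> component M d \<longleftrightarrow> (\<forall>b. Poly_Mapping.keys (f b) \<subseteq> B b \<and> homogeneous (d - int (a b)) (f b))"
  by (auto simp: M_def)

lemma restrict_mult_restrict:
  assumes "Poly_Mapping.keys f \<subseteq> B b"
  shows "restrict_keys (B b) (p * restrict_keys (B b) (q * f)) = restrict_keys (B b) (p * q * (f :: ('n, 'k) mpoly))"
proof -
  let ?r = "restrict_keys (- B b) (q * f)"
  have split: "q * f = restrict_keys (B b) (q * f) + ?r"
    by (rule poly_mapping_eqI) (simp add: lookup_restrict_keys lookup_add)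
  have "restrict_keys (B b) (p * ?r) = 0"
  proof (rule poly_mapping_eqI)
    fix x
    have "x \<notin> B b" if x: "x \<in> Poly_Mapping.keys (p * ?r)"
    proof -
      obtain v e' where ve: "x = v + e'" "e' \<in> Poly_Mapping.keys ?r" using x keys_mult by blast
      then have "e' \<in> Poly_Mapping.keys (q * f)" "e' \<notin> B b" by (auto simp: keys_restrict_keys)
      moreover from this obtain u e where ue: "e' = u + e" "e \<in> Poly_Mapping.keys f" using keys_mult by blast
      ultimately show ?thesis using convex[of e b u v] assms ve by (auto simp: algebra_simps)
    qed
    then show "Poly_Mapping.lookup (restrict_keys (B b) (p * ?r)) x = Poly_Mapping.lookup 0 x"
      by (auto simp: lookup_restrict_keys in_keys_iff)
  qed
  moreover have "p * q * f = p * restrict_keys (B b) (q * f) + p * ?r"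
    by (subst (1) mult.assoc, subst (1) split) (simp add: algebra_simps)
  ultimately show ?thesis by (simp add: restrict_keys_add)
qed

lemma module_M: "Module.module class_ring M"
proof (rule moduleI)
  show "cring (class_ring :: ('n,'k) mpoly ring)" by (rule class_cring.cring_axioms)
  show "abelian_group M"
  proof (rule abelian_groupI)
    fix f assume "f \<in> carrier M"
    then show "\<exists>g\<in>carrier M. g \<oplus>\<^bsub>M\<^esub> f = \<zero>\<^bsub>M\<^esub>"
      by (intro bexI[of _ "\<lambda>b. - f b"]) auto
  next
    fix f g assume "f \<in> carrier M" "g \<in> carrier M"
    then show "f \<oplus>\<^bsub>M\<^esub> g \<in> carrier M" using Poly_Mapping.keys_add by fastforce
  qed (auto simp: add_ac)
qed (auto simp: keys_restrict_keys restrict_keys_add restrict_keys_id restrict_mult_restrict distrib_right distrib_left)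

lemma finsum_M:
  assumes "finite A" "\<And>d. d \<in> A \<Longrightarrow> F d \<in> carrier M"
  shows "finsum M F A = (\<lambda>b. \<Sum>d\<in>A. F d b)"
proof -
  interpret M: Module.module class_ring M by (rule module_M)
  show ?thesis using assms
  proof (induction A rule: finite_induct)
    case (insert d A)
    then have "finsum M F (insert d A) = F d \<oplus>\<^bsub>M\<^esub> finsum M F A"
      by (intro M.finsum_insert) (auto simp del: M_simps)
    then show ?case using insert by (simp add: fun_eq_iff)
  qed (simp add: M.finsum_empty)
qed

abbreviation hpart :: "int \<Rightarrow> ('n, 'k) mpoly \<Rightarrow> ('n, 'k) mpoly" where
  "hpart k \<equiv> restrict_keys {e. int (total_degree e) = k}"

lemma graded_module_M: "graded_module M"
proof (intro graded_module.intro module_M graded_module_axioms.intro)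
  interpret M: Module.module class_ring M by (rule module_M)
  fix d
  show "subgroup (component M d) (add_monoid M)"
  proof (rule group.subgroupI)
    show "group (add_monoid M)" by (rule M.a_group)
    show "component M d \<subseteq> carrier (add_monoid M)" by auto
    have "(\<lambda>_. 0) \<in> component M d" by (simp add: homogeneous_def)
    then show "component M d \<noteq> {}" by blast
    fix f g assume f: "f \<in> component M d"
    have "inv\<^bsub>add_monoid M\<^esub> f = (\<lambda>b. - f b)"
      using M.minus_equality[of "\<lambda>b. - f b" f] f by (simp add: a_inv_def)
    then show "inv\<^bsub>add_monoid M\<^esub> f \<in> component M d" using f by (simp add: homogeneous_def)
    assume g: "g \<in> component M d"
    have "Poly_Mapping.keys (f b + g b) \<subseteq> Poly_Mapping.keys (f b) \<union> Poly_Mapping.keys (g b)" for b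
      by (rule Poly_Mapping.keys_add)
    then show "f \<otimes>\<^bsub>add_monoid M\<^esub> g \<in> component M d"
      using f g by (fastforce simp: homogeneous_def)
  qed
next
  fix i d and p :: "('n, 'k) mpoly" and f
  assume p: "homogeneous i p" and f: "f \<in> component M d"
  have "homogeneous (i + d - int (a b)) (p * f b)" for b
    using homogeneous_mult[OF p, of "d - int (a b)" "f b"] f by (simp add: algebra_simps)
  then show "p \<odot>\<^bsub>M\<^esub> f \<in> component M (i + d)"
    by (simp add: homogeneous_def keys_restrict_keys)
next
  fix f assume f: "f \<in> carrier M"
  define F where "F d = (\<lambda>b. hpart (d - int (a b)) (f b))" for d
  have F_comp: "F d \<in> component M d" for d
    using f by (auto simp: F_def keys_restrict_keys homogeneous_def)
  have fin: "finite {d. F d \<noteq> (\<lambda>_. 0)}"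
  proof (rule finite_subset)
    show "finite (\<Union>b\<in>{b. B b \<noteq> {}}. (\<lambda>e. int (total_degree e) + int (a b)) ` Poly_Mapping.keys (f b))"
      using finite_support by simp
    show "{d. F d \<noteq> (\<lambda>_. 0)} \<subseteq> (\<Union>b\<in>{b. B b \<noteq> {}}. (\<lambda>e. int (total_degree e) + int (a b)) ` Poly_Mapping.keys (f b))"
    proof
      fix d assume "d \<in> {d. F d \<noteq> (\<lambda>_. 0)}"
      then obtain b where "F d b \<noteq> 0" by auto
      then obtain e where "e \<in> Poly_Mapping.keys (F d b)" by (metis keys_eq_empty ex_in_conv)
      then have "e \<in> Poly_Mapping.keys (f b)" "d = int (total_degree e) + int (a b)"
        by (auto simp: F_def keys_restrict_keys)
      then show "d \<in> (\<Union>b\<in>{b. B b \<noteq> {}}. (\<lambda>e. int (total_degree e) + int (a b)) ` Poly_Mapping.keys (f b))"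
        using f by fastforce
    qed
  qed
  have sum: "(\<Sum>d\<in>{d. G d \<noteq> (\<lambda>_. 0)}. Poly_Mapping.lookup (G d b) e) =
      Poly_Mapping.lookup (G (int (total_degree e) + int (a b)) b) e"
    if G: "\<And>d. G d \<in> component M d" "finite {d. G d \<noteq> (\<lambda>_. 0)}" for G b e
  proof -
    let ?d = "int (total_degree e) + int (a b)"
    have "Poly_Mapping.lookup (G d b) e = 0" if "d \<noteq> ?d" for d
    proof -
      have "e \<notin> Poly_Mapping.keys (G d b)" using G(1)[of d] that by (auto simp: homogeneous_def)
      then show ?thesis by (simp add: in_keys_iff)
    qed
    then have "(\<Sum>d\<in>{d. G d \<noteq> (\<lambda>_. 0)}. Poly_Mapping.lookup (G d b) e) =
        (\<Sum>d\<in>{d. G d \<noteq> (\<lambda>_. 0)}. if d = ?d then Poly_Mapping.lookup (G ?d b) e else 0)"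
      by (intro sum.cong) auto
    also have "\<dots> = Poly_Mapping.lookup (G ?d b) e" using G(2) by simp
    finally show ?thesis .
  qed
  have comp_carrier: "G d \<in> carrier M" if "\<And>d. G d \<in> component M d" for G d
    using that[of d] by simp
  have lookup_F: "Poly_Mapping.lookup (F d b) e =
      (if int (total_degree e) + int (a b) = d then Poly_Mapping.lookup (f b) e else 0)" for d b e
    by (auto simp: F_def lookup_restrict_keys)
  show "\<exists>!F. (\<forall>d. F d \<in> component M d) \<and> finite {d. F d \<noteq> \<zero>\<^bsub>M\<^esub>} \<and>
      f = (\<Oplus>\<^bsub>M\<^esub>d\<in>{d. F d \<noteq> \<zero>\<^bsub>M\<^esub>}. F d)"
  proof (rule ex1I[of _ F])
    have "f = (\<Oplus>\<^bsub>M\<^esub>d\<in>{d. F d \<noteq> (\<lambda>_. 0)}. F d)"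
      unfolding finsum_M[OF fin comp_carrier[OF F_comp]]
      by (intro ext poly_mapping_eqI, simp only: lookup_sum sum[OF F_comp fin], simp only: lookup_F refl if_True)
    then show "(\<forall>d. F d \<in> component M d) \<and> finite {d. F d \<noteq> \<zero>\<^bsub>M\<^esub>} \<and>
        f = (\<Oplus>\<^bsub>M\<^esub>d\<in>{d. F d \<noteq> \<zero>\<^bsub>M\<^esub>}. F d)"
      using F_comp fin unfolding M_simps(2) by blast
  next
    fix G assume "(\<forall>d. G d \<in> component M d) \<and> finite {d. G d \<noteq> \<zero>\<^bsub>M\<^esub>} \<and>
        f = (\<Oplus>\<^bsub>M\<^esub>d\<in>{d. G d \<noteq> \<zero>\<^bsub>M\<^esub>}. G d)"
    then have G: "\<And>d. G d \<in> component M d" "finite {d. G d \<noteq> (\<lambda>_. 0)}"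
      and fG: "f = (\<Oplus>\<^bsub>M\<^esub>d\<in>{d. G d \<noteq> (\<lambda>_. 0)}. G d)" unfolding M_simps(2) by blast+
    have fb: "f b = (\<Sum>d\<in>{d. G d \<noteq> (\<lambda>_. 0)}. G d b)" for b
      using fG unfolding finsum_M[OF G(2) comp_carrier[OF G(1)]] by (rule fun_cong)
    have "Poly_Mapping.lookup (G d b) e = Poly_Mapping.lookup (F d b) e" for d b e
    proof (cases "int (total_degree e) + int (a b) = d")
      case True
      then show ?thesis unfolding lookup_F fb[of b] lookup_sum sum[OF G] by simp
    next
      case False
      then have "e \<notin> Poly_Mapping.keys (G d b)" using G(1)[of d] by (auto simp: homogeneous_def)
      then show ?thesis using False by (simp add: lookup_F in_keys_iff)
    qed
    then show "G = F" by (intro ext poly_mapping_eqI)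
  qed
qed

text \<open>
  The monomials of \<open>G\<close>, one copy in each summand that contains them, generate the module.
\<close>

lemma finitely_generated_M:
  assumes "finite G" and G: "\<And>b e. e \<in> B b \<Longrightarrow> \<exists>g\<in>G. g \<in> B b \<and> (\<exists>u. e = u + g)"
  shows "finitely_generated M"
proof -
  interpret graded_module M by (rule graded_module_M)
  let ?\<delta> = "\<lambda>b p b'. if b' = b then p else (0 :: ('n, 'k) mpoly)"
  define X where "X = (\<lambda>(b, g). ?\<delta> b (Poly_Mapping.single g 1)) ` {(b, g). g \<in> G \<and> g \<in> B b}"
  have "finite {(b, g). g \<in> G \<and> g \<in> B b}"
    by (rule finite_subset[of _ "{b. B b \<noteq> {}} \<times> G"]) (use finite_support assms(1) in auto)
  then have finX: "finite X" unfolding X_def by simp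
  have XM: "X \<subseteq> carrier M" by (auto simp: X_def)
  have sub: "submodule class_ring (span X) M" by (rule span_is_submodule[OF XM])
  have add: "(\<lambda>b. f b + g b) \<in> span X" if "f \<in> span X" "g \<in> span X" for f g
    using submodule.m_closed[OF sub that] by simp
  have zero: "(\<lambda>_. 0) \<in> span X" using submodule.zero_closed[OF sub] by simp
  have single: "?\<delta> b (Poly_Mapping.single e c) \<in> span X" if e: "e \<in> B b" for b e c
  proof -
    obtain g u where g: "g \<in> G" "g \<in> B b" "e = u + g" using G[OF e] by blast
    then have "?\<delta> b (Poly_Mapping.single g 1) \<in> X"
      unfolding X_def by (intro image_eqI[of _ _ "(b, g)"]) auto
    then have "?\<delta> b (Poly_Mapping.single g 1) \<in> span X" using in_own_span[OF XM] by blast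
    then have "Poly_Mapping.single u c \<odot>\<^bsub>M\<^esub> ?\<delta> b (Poly_Mapping.single g 1) \<in> span X"
      using submodule.smult_closed[OF sub] by simp
    moreover have "Poly_Mapping.single u c \<odot>\<^bsub>M\<^esub> ?\<delta> b (Poly_Mapping.single g 1) = ?\<delta> b (Poly_Mapping.single e c)"
      using e g(3) by (auto simp: fun_eq_iff mult_single restrict_keys_id)
    ultimately show ?thesis by metis
  qed
  have \<delta>: "?\<delta> b p \<in> span X" if "Poly_Mapping.keys p \<subseteq> B b" for b p
  proof -
    have "?\<delta> b (\<Sum>e\<in>A. Poly_Mapping.single e (Poly_Mapping.lookup p e)) \<in> span X"
      if "finite A" "A \<subseteq> B b" for A
      using that
    proof (induction A rule: finite_induct)
      case empty
      then show ?case using zero by (simp add: if_distrib cong: if_cong)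
    next
      case (insert e A)
      let ?s = "\<lambda>A. \<Sum>e\<in>A. Poly_Mapping.single e (Poly_Mapping.lookup p e)"
      have "?\<delta> b (?s (insert e A)) = (\<lambda>b'. ?\<delta> b (Poly_Mapping.single e (Poly_Mapping.lookup p e)) b' + ?\<delta> b (?s A) b')"
        using insert by (auto simp: fun_eq_iff)
      then show ?case using add[OF single[of e b "Poly_Mapping.lookup p e"]] insert by simp
    qed
    from this[OF finite_keys that] show ?thesis unfolding poly_mapping_sum_singles .
  qed
  have "carrier M \<subseteq> span X"
  proof
    fix f assume f: "f \<in> carrier M"
    have "(\<lambda>b. if b \<in> A then f b else 0) \<in> span X" if "finite A" for A
      using that
    proof (induction A rule: finite_induct)
      case (insert b A)
      have "(\<lambda>b'. if b' \<in> insert b A then f b' else 0) =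
          (\<lambda>b'. ?\<delta> b (f b) b' + (if b' \<in> A then f b' else 0))"
        using insert by (auto simp: fun_eq_iff)
      moreover have "?\<delta> b (f b) \<in> span X" using f by (intro \<delta>) auto
      ultimately show ?case using add[OF _ insert.IH] by simp
    qed (use zero in simp)
    from this[OF finite_support] have "(\<lambda>b. if B b \<noteq> {} then f b else 0) \<in> span X" by simp
    moreover have "(\<lambda>b. if B b \<noteq> {} then f b else 0) = f"
    proof
      fix b
      have "Poly_Mapping.keys (f b) \<subseteq> B b" using f by simp
      then show "(if B b \<noteq> {} then f b else 0) = f b" by (cases "B b = {}") auto
    qed
    ultimately show "f \<in> span X" by simp
  qed
  then have "span X = carrier M" using span_is_subset2[OF XM] by blast
  then show ?thesis unfolding finitely_generated_def using finX XM by blast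
qed

lemma dim_component_M:
  "vectorspace.dim class_ring (component_space M d) =
     card (SIGMA b : {b. B b \<noteq> {}}. {e \<in> B b. int (total_degree e) + int (a b) = d})"
proof (rule dim_eq_card_coordinates(1)[where c = "\<lambda>(b, e) f. Poly_Mapping.lookup (f b) e"
      and u = "\<lambda>(b, e) b'. if b' = b then Poly_Mapping.single e 1 else 0"])
  show "vectorspace class_ring (component_space M d)"
    by (rule component_space_vectorspace[OF graded_module_M])
  have "finite {e \<in> B b. int (total_degree e) + int (a b) = d}" for b
    by (rule finite_subset[OF _ finite_total_degree[of "nat (d - int (a b))"]]) auto
  then show "finite (SIGMA b : {b. B b \<noteq> {}}. {e \<in> B b. int (total_degree e) + int (a b) = d})"
    using finite_support by blast
  fix f assume f: "f \<in> carrier (component_space M d)"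
  then have f': "\<And>b. Poly_Mapping.keys (f b) \<subseteq> B b" "\<And>b. homogeneous (d - int (a b)) (f b)"
    by (auto simp: component_space_def)
  show "f = \<zero>\<^bsub>component_space M d\<^esub>"
    if z: "\<And>x. x \<in> (SIGMA b : {b. B b \<noteq> {}}. {e \<in> B b. int (total_degree e) + int (a b) = d}) \<Longrightarrow>
      (case x of (b, e) \<Rightarrow> \<lambda>f. Poly_Mapping.lookup (f b) e) f = 0"
  proof -
    have "Poly_Mapping.lookup (f b) e = 0" for b e
    proof (rule ccontr)
      assume "Poly_Mapping.lookup (f b) e \<noteq> 0"
      then have "e \<in> Poly_Mapping.keys (f b)" by (simp add: in_keys_iff)
      then have "(b, e) \<in> (SIGMA b : {b. B b \<noteq> {}}. {e \<in> B b. int (total_degree e) + int (a b) = d})"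
        using f'(1)[of b] f'(2)[of b] by (auto simp: homogeneous_def)
      from z[OF this] \<open>Poly_Mapping.lookup (f b) e \<noteq> 0\<close> show False by simp
    qed
    then show ?thesis by (auto simp: component_space_def fun_eq_iff intro: poly_mapping_eqI)
  qed
  have "Poly_Mapping.lookup (restrict_keys (B b) (Const c * f b)) e = c * Poly_Mapping.lookup (f b) e" for c b e
    using f'(1)[of b] by (auto simp: lookup_restrict_keys lookup_Const_mult in_keys_iff)
  then show "(case x of (b, e) \<Rightarrow> \<lambda>f. Poly_Mapping.lookup (f b) e) (c \<odot>\<^bsub>component_space M d\<^esub> f) =
      c * (case x of (b, e) \<Rightarrow> \<lambda>f. Poly_Mapping.lookup (f b) e) f" for c x
    by (auto simp: component_space_def split: prod.split)
qed (auto simp: component_space_def lookup_add homogeneous_def lookup_single when_def split: prod.splits)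

text \<open>
  Since each \<open>B b\<close> is closed under multiplication and division by the variables \<open>zs\<close>, the multiples of
  these variables are spanned by the basis elements that contain one of them.
\<close>

lemma seq_submodule_Vars:
  assumes Z: "\<And>z b e. z \<in> set zs \<Longrightarrow> Poly_Mapping.single z 1 + e \<in> B b \<longleftrightarrow> e \<in> B b"
  shows "seq_submodule M (map Var zs) =
    {f \<in> carrier M. \<forall>b. \<forall>e\<in>Poly_Mapping.keys (f b). \<exists>z\<in>set zs. Poly_Mapping.lookup e z \<noteq> 0}"
  using assms
proof (induction zs rule: rev_induct)
  case Nil
  interpret graded_module M by (rule graded_module_M)
  show ?case using seq_submodule_Nil by (auto simp: fun_eq_iff)
next
  case (snoc z zs)
  interpret graded_module M by (rule graded_module_M)
  let ?S = "\<lambda>zs. {f \<in> carrier M. \<forall>b. \<forall>e\<in>Poly_Mapping.keys (f b). \<exists>z\<in>set zs. Poly_Mapping.lookup e z \<noteq> 0}"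
  have IH: "seq_submodule M (map Var zs) = ?S zs" using snoc by auto
  have z: "Poly_Mapping.single z 1 + e \<in> B b \<longleftrightarrow> e \<in> B b" for b e using snoc.prems by simp
  have Var_mult: "restrict_keys (B b) (Var z * p) = Var z * p" if "Poly_Mapping.keys p \<subseteq> B b" for b p
    using that z by (intro restrict_keys_id) (auto simp: keys_Var_mult)
  show ?case
  proof
    show "seq_submodule M (map Var (zs @ [z])) \<subseteq> ?S (zs @ [z])"
    proof
      fix f assume "f \<in> seq_submodule M (map Var (zs @ [z]))"
      then obtain q x where f: "f = q \<oplus>\<^bsub>M\<^esub> Var z \<odot>\<^bsub>M\<^esub> x" "q \<in> ?S zs" "x \<in> carrier M"
        unfolding map_append list.map seq_submodule_snoc IH by blast
      have x: "Poly_Mapping.keys (x b) \<subseteq> B b" for b using f(3) by simp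
      have fb: "f b = q b + Var z * x b" for b using f(1) Var_mult[OF x[of b]] by simp
      have "\<exists>z\<in>set (zs @ [z]). Poly_Mapping.lookup e z \<noteq> 0" if "e \<in> Poly_Mapping.keys (f b)" for b e
      proof -
        have "e \<in> Poly_Mapping.keys (q b) \<or> e \<in> Poly_Mapping.keys (Var z * x b)"
          using that Poly_Mapping.keys_add[of "q b" "Var z * x b"] unfolding fb by blast
        then show ?thesis using f(2) by (auto simp: keys_Var_mult lookup_add)
      qed
      moreover have "f \<in> carrier M"
        unfolding f(1) using f(2,3) by (intro M.a_closed smult_closed) auto
      ultimately show "f \<in> ?S (zs @ [z])" by blast
    qed
    show "?S (zs @ [z]) \<subseteq> seq_submodule M (map Var (zs @ [z]))"
    proof
      fix f assume f: "f \<in> ?S (zs @ [z])"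
      define E where "E = {e :: 'n \<Rightarrow>\<^sub>0 nat. \<exists>z\<in>set zs. Poly_Mapping.lookup e z \<noteq> 0}"
      define q where "q = (\<lambda>b. restrict_keys E (f b))"
      define r where "r = (\<lambda>b. restrict_keys (- E) (f b))"
      \<comment> \<open>The quotient of \<open>r\<close> by the variable \<open>z\<close>.\<close>
      define x where "x = (\<lambda>b. Poly_Mapping.map_key (\<lambda>e. Poly_Mapping.single z 1 + e) (r b))"
      have lx: "Poly_Mapping.lookup (x b) e = Poly_Mapping.lookup (r b) (Poly_Mapping.single z 1 + e)" for b e
        unfolding x_def by (subst map_key.rep_eq) (auto intro: injI)
      have "Var z * x b = r b" for b
      proof (rule poly_mapping_eqI)
        fix e
        show "Poly_Mapping.lookup (Var z * x b) e = Poly_Mapping.lookup (r b) e"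
        proof (cases "Poly_Mapping.lookup e z = 0")
          case True
          then have "e \<notin> Poly_Mapping.keys (Var z * x b)"
            by (auto simp: keys_Var_mult lookup_add)
          moreover have "e \<notin> Poly_Mapping.keys (r b)"
          proof
            assume "e \<in> Poly_Mapping.keys (r b)"
            then have "e \<in> Poly_Mapping.keys (f b)" "e \<notin> E" by (auto simp: r_def keys_restrict_keys)
            moreover from this(1) obtain z' where "z' \<in> set (zs @ [z])" "Poly_Mapping.lookup e z' \<noteq> 0"
              using f by blast
            ultimately show False using True by (auto simp: E_def)
          qed
          ultimately show ?thesis by (simp add: in_keys_iff)
        next
          case False
          have "e = Poly_Mapping.single z 1 + (e - Poly_Mapping.single z 1)"
            by (rule poly_mapping_eqI) (use False in \<open>auto simp: lookup_add lookup_minus lookup_single when_def\<close>)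
          then obtain e' where e': "e = Poly_Mapping.single z 1 + e'" by blast
          show ?thesis
            unfolding e' Var_def lookup_single_mult by (simp add: lx)
        qed
      qed
      note Var_x = this
      have xM: "x \<in> carrier M"
      proof -
        have "e \<in> B b" if "e \<in> Poly_Mapping.keys (x b)" for b e
        proof -
          have "Poly_Mapping.single z 1 + e \<in> Poly_Mapping.keys (r b)" using that by (simp add: in_keys_iff lx)
          then have "Poly_Mapping.single z 1 + e \<in> B b" using f by (auto simp: r_def keys_restrict_keys)
          then show ?thesis using z by simp
        qed
        then show ?thesis by auto
      qed
      have "q \<in> ?S zs" using f by (auto simp: q_def keys_restrict_keys E_def)
      moreover have "f = q \<oplus>\<^bsub>M\<^esub> Var z \<odot>\<^bsub>M\<^esub> x"
      proof -
        have "f b = q b + r b" for b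
          by (rule poly_mapping_eqI) (simp add: q_def r_def lookup_restrict_keys lookup_add)
        moreover have "restrict_keys (B b) (Var z * x b) = r b" for b
          using Var_mult[of "x b" b] xM Var_x[of b] by simp
        ultimately show ?thesis by (simp add: fun_eq_iff)
      qed
      ultimately show "f \<in> seq_submodule M (map Var (zs @ [z]))"
        unfolding map_append list.map seq_submodule_snoc IH using xM by blast
    qed
  qed
qed

lemma regular_sequence_Vars:
  assumes Z: "\<And>z b e. z \<in> set zs \<Longrightarrow> Poly_Mapping.single z 1 + e \<in> B b \<longleftrightarrow> e \<in> B b"
    and "distinct zs" and e: "e \<in> B b" "\<And>z. z \<in> set zs \<Longrightarrow> Poly_Mapping.lookup e z = 0"
  shows "regular_sequence M (map Var zs)"
  unfolding regular_sequence_def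
proof (intro conjI allI impI ballI)
  fix i f assume i: "i < length (map Var zs :: ('n, 'k) mpoly list)" and f: "f \<in> carrier M"
    and mem: "map Var zs ! i \<odot>\<^bsub>M\<^esub> f \<in> seq_submodule M (take i (map Var zs))"
  have i': "i < length zs" using i by simp
  have take_sub: "set (take i zs) \<subseteq> set zs" by (rule set_take_subset)
  have seq: "seq_submodule M (take i (map Var zs)) =
      {f \<in> carrier M. \<forall>b. \<forall>e\<in>Poly_Mapping.keys (f b). \<exists>z\<in>set (take i zs). Poly_Mapping.lookup e z \<noteq> 0}"
    unfolding take_map using Z take_sub by (intro seq_submodule_Vars) blast
  have "\<exists>z\<in>set (take i zs). Poly_Mapping.lookup e z \<noteq> 0" if e: "e \<in> Poly_Mapping.keys (f b)" for b e
  proof -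
    let ?z = "zs ! i"
    have eB: "Poly_Mapping.single ?z 1 + e \<in> B b" using e f Z[of ?z e b] i' by auto
    have "Poly_Mapping.single ?z 1 + e \<in> Poly_Mapping.keys (Var ?z * f b)"
      using e by (simp add: keys_Var_mult)
    then have "Poly_Mapping.single ?z 1 + e \<in> Poly_Mapping.keys ((Var ?z \<odot>\<^bsub>M\<^esub> f) b)"
      using eB by (simp add: keys_restrict_keys)
    moreover have "Var ?z \<odot>\<^bsub>M\<^esub> f \<in> seq_submodule M (take i (map Var zs))" using mem i' by simp
    ultimately obtain z where z: "z \<in> set (take i zs)" "Poly_Mapping.lookup (Poly_Mapping.single ?z 1 + e) z \<noteq> 0"
      unfolding seq by blast
    have "z \<noteq> ?z" using z(1) assms(2) i' by (auto simp: in_set_conv_nth nth_eq_iff_index_eq)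
    then have "Poly_Mapping.lookup e z \<noteq> 0" using z(2) by (simp add: lookup_add lookup_single when_def)
    then show ?thesis using z(1) by blast
  qed
  then show "f \<in> seq_submodule M (take i (map Var zs))" unfolding seq using f by blast
next
  let ?f = "\<lambda>b'. if b' = b then Poly_Mapping.single e 1 else (0 :: ('n, 'k) mpoly)"
  have "?f \<in> carrier M" using e(1) by simp
  moreover have "?f \<notin> seq_submodule M (map Var zs)"
  proof
    have "\<exists>z\<in>set zs. Poly_Mapping.lookup e z \<noteq> 0"
      if "f \<in> seq_submodule M (map Var zs)" "e \<in> Poly_Mapping.keys (f b)"
      for f :: "'i \<Rightarrow> ('n, 'k) mpoly" and e b
    proof -
      have "seq_submodule M (map Var zs) = {f \<in> carrier M :: ('i \<Rightarrow> ('n, 'k) mpoly) set.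
          \<forall>b. \<forall>e\<in>Poly_Mapping.keys (f b). \<exists>z\<in>set zs. Poly_Mapping.lookup e z \<noteq> 0}"
        using Z by (intro seq_submodule_Vars) blast
      then show ?thesis using that by blast
    qed
    moreover assume "?f \<in> seq_submodule M (map Var zs)"
    moreover have "e \<in> Poly_Mapping.keys (?f b)" by simp
    ultimately have "\<exists>z\<in>set zs. Poly_Mapping.lookup e z \<noteq> 0" .
    then show False using e(2) by simp
  qed
  ultimately show "seq_submodule M (map Var zs) \<noteq> carrier M" by blast
qed

end

section \<open>The Hilbert depth of the maximal ideal\<close>

lemma max_ideal_component_dim:
  "vectorspace.dim class_ring (component_space (max_ideal_module :: (('n::finite, 'k::field) mpoly, ('n, 'k) mpoly) graded_module) d) =
     card {e :: 'n \<Rightarrow>\<^sub>0 nat. e \<noteq> 0 \<and> int (total_degree e) = d}"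
proof (rule dim_eq_card_coordinates(1)[where c = "\<lambda>e p. Poly_Mapping.lookup p e" and u = "\<lambda>e. Poly_Mapping.single e 1"])
  let ?V = "component_space (max_ideal_module :: (('n, 'k) mpoly, ('n, 'k) mpoly) graded_module) d"
  show "vectorspace class_ring ?V" by (rule component_space_vectorspace[OF graded_module_max_ideal])
  show "finite {e :: 'n \<Rightarrow>\<^sub>0 nat. e \<noteq> 0 \<and> int (total_degree e) = d}"
    by (rule finite_subset[OF _ finite_total_degree[of "nat d"]]) auto
  show "p = \<zero>\<^bsub>?V\<^esub>" if p: "p \<in> carrier ?V"
    and z: "\<And>e. e \<in> {e. e \<noteq> 0 \<and> int (total_degree e) = d} \<Longrightarrow> Poly_Mapping.lookup p e = 0" for p
  proof -
    have "Poly_Mapping.lookup p e = 0" for e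
    proof (rule ccontr)
      assume "Poly_Mapping.lookup p e \<noteq> 0"
      then show False
        using p z[of e] by (auto simp: component_space_def max_ideal_module_def mem_max_ideal_iff homogeneous_def in_keys_iff)
    qed
    then show ?thesis by (auto simp: component_space_def max_ideal_module_def intro: poly_mapping_eqI)
  qed
qed (auto simp: component_space_def max_ideal_module_def mem_max_ideal_iff homogeneous_def lookup_add
    lookup_Const_mult lookup_single when_def)

lemma max_ideal_component_dim_nat:
  "vectorspace.dim class_ring (component_space (max_ideal_module :: (('n::finite, 'k::field) mpoly, ('n, 'k) mpoly) graded_module) (int j)) =
     (if j = 0 then 0 else card (monomials (UNIV :: 'n set) j))"
proof -
  have "{e :: 'n \<Rightarrow>\<^sub>0 nat. e \<noteq> 0 \<and> int (total_degree e) = int j} = (if j = 0 then {} else monomials UNIV j)"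
    by (auto simp: monomials_def total_degree_eq_0_iff)
  then show ?thesis by (simp add: max_ideal_component_dim)
qed

text \<open>
  The Hilbert series prescribes dimension \<open>n\<close> in degree 1 and \<open>n (n + 1) / 2\<close> in degree 2, so
  \<open>length rs * n \<le> n (n + 1) / 2\<close>.
\<close>

theorem depth_le_half_of_hilbert_series:
  fixes N :: "(('n::finite, 'k::field) mpoly, 'b) graded_module"
  assumes inf: "infinite (UNIV :: 'k set)"
    and N: "graded_module N" "finitely_generated N"
    and H: "hilbert_series N = hilbert_series (max_ideal_module :: (('n, 'k) mpoly, ('n, 'k) mpoly) graded_module)"
  shows "depth N \<le> enat ((CARD('n) + 1) div 2)"
proof -
  interpret graded_module N by (rule N(1))
  let ?M = "max_ideal_module :: (('n, 'k) mpoly, ('n, 'k) mpoly) graded_module"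
  let ?n = "CARD('n)"
  have dim: "vectorspace.dim class_ring (component_space N d) = vectorspace.dim class_ring (component_space ?M d)" for d
    using H hilbert_series_eq_iff_dim[OF N graded_module_max_ideal finitely_generated_max_ideal] by blast
  have n: "?n > 0" by (simp add: card_gt_0_iff)
  have dim1: "vectorspace.dim class_ring (component_space N 1) = ?n"
    using dim[of "int 1"] n by (simp add: max_ideal_component_dim_nat[of 1, simplified] card_monomials)
  have dim2: "vectorspace.dim class_ring (component_space N 2) = (?n + 1) choose 2"
    using dim[of "int 2"] max_ideal_component_dim_nat[where 'n = 'n and 'k = 'k, of 2] n by (simp add: card_monomials)
  have vanish: "component N d = {\<zero>\<^bsub>N\<^esub>}" if "d \<le> 0" for d
  proof -
    interpret V: vectorspace class_ring "component_space N d"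
      by (rule component_space_vectorspace[OF N(1)])
    have "{e :: 'n \<Rightarrow>\<^sub>0 nat. e \<noteq> 0 \<and> int (total_degree e) = d} = {}"
      using that by (auto simp flip: total_degree_eq_0_iff)
    then have "V.dim = 0" unfolding dim max_ideal_component_dim by (simp only: card.empty)
    moreover obtain A where "finite A" "V.basis A"
      using V.finite_basis_exists finite_dimensional_components(1)[OF N(2)] by blast
    ultimately have "V.basis {}" using V.dim_basis by fastforce
    then have "carrier (component_space N d) = {\<zero>\<^bsub>component_space N d\<^esub>}"
      unfolding V.basis_def V.span_empty by simp
    then show ?thesis by (simp add: component_space_def)
  qed
  have bound: "length rs \<le> (?n + 1) div 2"
    if rs: "set rs \<subseteq> max_ideal" "regular_sequence N rs" for rs :: "('n, 'k) mpoly list"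
  proof -
    have "length rs * ?n \<le> (?n + 1) choose 2"
      using regular_sequence_length_bound[OF inf N(2) rs vanish] unfolding dim1 dim2 by blast
    then have "length rs * ?n * 2 \<le> (?n + 1) * ?n" by (simp add: choose_two)
    then have "length rs * 2 * ?n \<le> (?n + 1) * ?n" by (simp add: algebra_simps)
    then have "length rs * 2 \<le> ?n + 1" using n by (metis mult_le_cancel2)
    then show ?thesis by simp
  qed
  have N_nonzero: "carrier N \<noteq> {\<zero>\<^bsub>N\<^esub>}"
  proof
    assume "carrier N = {\<zero>\<^bsub>N\<^esub>}"
    then have "component N 1 = {\<zero>\<^bsub>N\<^esub>}" using component_subset[of 1] component_closed(1)[of 1] by blast
    interpret V: vectorspace class_ring "component_space N 1"
      by (rule component_space_vectorspace[OF N(1)])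
    have "V.gen_set {}" using \<open>component N 1 = {\<zero>\<^bsub>N\<^esub>}\<close> unfolding V.span_empty by (simp add: component_space_def)
    then have "V.dim \<le> card ({} :: 'b set)" by (intro V.gen_ge_dim) auto
    then show False using dim1 n by simp
  qed
  have "Sup {enat (length rs) | rs. set rs \<subseteq> max_ideal \<and> regular_sequence N rs} \<le> enat ((?n + 1) div 2)"
    by (rule Sup_least) (use bound in auto)
  then show ?thesis unfolding depth_def using N_nonzero by simp
qed

text \<open>
  Split the variables into a set \<open>Y\<close> of \<open>r = n div 2\<close> and the remaining \<open>d = (n + 1) div 2\<close>, and let
  \<open>y\<^sub>i\<close> be the number of monomials of degree \<open>i\<close> in \<open>Y\<close>. From the Hilbert series \<open>1 / (1 - t)\<^sup>n - 1\<close> of the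
  maximal ideal, multiplication by \<open>(1 - t)\<^sup>d\<close> leaves \<open>1 / (1 - t)\<^sup>r - (1 - t)\<^sup>d\<close>, with the
  coefficients \<open>c\<^sub>i = y\<^sub>i - (- 1)\<^sup>i (d choose i)\<close>. They are nonnegative because \<open>d \<le> r + 1\<close>, and equal to
  \<open>y\<^sub>i\<close> for \<open>i > d\<close>. The module is therefore the direct sum of the power \<open>(Y)\<^sup>d\<^sup>+\<^sup>1\<close> of an ideal and of
  \<open>c\<^sub>i\<close> copies, for \<open>1 \<le> i \<le> d\<close>, of the polynomial ring in the variables outside \<open>Y\<close>, shifted to start in
  degree \<open>i\<close>. The \<open>d\<close> variables outside \<open>Y\<close> are a regular sequence on each summand.
\<close>

theorem exists_module_of_depth_ge_half:
  assumes "CARD('n::finite) \<ge> 2"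
  shows "\<exists>N :: (('n, 'k::field) mpoly, nat \<times> nat \<Rightarrow> ('n, 'k) mpoly) graded_module.
    graded_module N \<and> finitely_generated N \<and>
    hilbert_series N = hilbert_series (max_ideal_module :: (('n, 'k) mpoly, ('n, 'k) mpoly) graded_module) \<and>
    enat ((CARD('n) + 1) div 2) \<le> depth N"
proof -
  define n where "n = CARD('n)"
  define d where "d = (n + 1) div 2"
  define r where "r = n div 2"
  have nd: "r \<ge> 1" "d \<ge> 1" "d \<le> r + 1" "r + d = n" using assms by (auto simp: n_def d_def r_def)
  obtain Y :: "'n set" where Y: "card Y = r"
    using obtain_subset_with_card_n[of r "UNIV :: 'n set"] by (auto simp: n_def r_def)
  have Z: "card (- Y) = d" using nd(4) Y by (simp add: Compl_eq_Diff_UNIV card_Diff_subset n_def)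
  have Yne: "Y \<noteq> {}" using Y nd(1) by auto
  define c where "c i = nat (int (card (monomials Y i)) - (- 1) ^ i * int (d choose i))" for i
  have c: "int (c i) = int (card (monomials Y i)) - (- 1) ^ i * int (d choose i)" for i
  proof -
    \<comment> \<open>Only even \<open>i\<close> matter. For \<open>i \<ge> 2\<close> there are \<open>r + i - 1 choose i\<close> monomials, and \<open>r + i - 1 \<ge> d\<close>.\<close>
    have "(d choose i) \<le> card (monomials Y i)" if "even i"
    proof (cases "i = 0")
      case True then show ?thesis by (simp add: monomials_0)
    next
      case False
      then have "i \<ge> 2" using that by presburger
      then have "d \<le> r + i - 1" using nd(3) by simp
      then show ?thesis unfolding card_monomials[OF Yne] Y by (rule binomial_right_mono)
    qed
    then show ?thesis unfolding c_def by (cases "even i") auto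
  qed
  have c0: "c 0 = 0" using c[of 0] by (simp add: monomials_0)
  have c1: "c 1 \<ge> 1" using c[of 1] nd by (simp add: card_monomials[OF Yne] Y)
  \<comment> \<open>Summand \<open>(0, 0)\<close> is the power of the ideal, and summand \<open>(i, t)\<close> is copy number \<open>t\<close> of the polynomial
  ring that starts in degree \<open>i\<close>; the first index is thus also the shift.\<close>
  define B :: "nat \<times> nat \<Rightarrow> ('n \<Rightarrow>\<^sub>0 nat) set" where
    "B = (\<lambda>(i, t). if i = 0 then if t = 0 then {e. d + 1 \<le> partial_degree Y e} else {}
       else if i \<le> d \<and> t < c i then {e. partial_degree Y e = 0} else {})"
  have pd_add: "partial_degree Y (e + f) = partial_degree Y e + partial_degree Y f" for e f
    by (simp add: partial_degree_def lookup_add sum.distrib)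
  define I where "I = (SIGMA i : {1..d}. {..<c i})"
  have supp: "{b. B b \<noteq> {}} \<subseteq> insert (0, 0) I"
    by (auto simp: B_def I_def split: if_splits)
  interpret N: monomial_module B fst "TYPE('k)"
  proof
    show "e + u \<in> B b" if "e \<in> B b" "e + u + v \<in> B b" for e b u v
      using that by (auto simp: B_def pd_add split: if_splits prod.splits)
    show "finite {b. B b \<noteq> {}}" by (rule finite_subset[OF supp]) (simp add: I_def)
  qed
  have pd_mono: "partial_degree Y e = total_degree e" if "e \<in> monomials Y k" for e k
  proof -
    have "partial_degree (- Y) e = 0" unfolding partial_degree_def
      using that by (intro sum.neutral) (auto simp: monomials_def in_keys_iff)
    then show ?thesis using total_degree_split[of e Y] by simp
  qed
  have fg: "finitely_generated N.M"
  proof (rule N.finitely_generated_M)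
    show "finite (insert 0 (monomials Y (d + 1)))" using finite_monomials by simp
    have sub: "\<exists>g\<in>monomials Y k. \<exists>u. e = u + g" if "k \<le> partial_degree Y e" for e :: "'n \<Rightarrow>\<^sub>0 nat" and k
      using that
    proof (induction k)
      case 0 show ?case by (auto simp: monomials_0)
    next
      case (Suc k)
      then obtain g u where g: "g \<in> monomials Y k" "e = u + g" by force
      then have "partial_degree Y u > 0" using Suc.prems pd_mono[OF g(1)] by (simp add: pd_add monomials_def)
      then obtain y where y: "y \<in> Y" "Poly_Mapping.lookup u y \<noteq> 0"
        unfolding partial_degree_def by (metis less_numeral_extra(3) sum.neutral)
      have "u = (u - Poly_Mapping.single y 1) + Poly_Mapping.single y 1"
        by (rule poly_mapping_eqI) (use y in \<open>auto simp: lookup_add lookup_minus lookup_single when_def\<close>)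
      then have "e = (u - Poly_Mapping.single y 1) + (Poly_Mapping.single y 1 + g)"
        using g(2) by (metis add.assoc)
      moreover have "Poly_Mapping.single y 1 + g \<in> monomials Y (Suc k)"
        using g(1) y(1) by (auto simp: monomials_def total_degree_add total_degree_single keys_add_nat)
      ultimately show ?case by blast
    qed
    fix b e assume e: "e \<in> B b"
    show "\<exists>g\<in>insert 0 (monomials Y (d + 1)). g \<in> B b \<and> (\<exists>u. e = u + g)"
    proof (cases "fst b = 0")
      case True
      then have b: "B b = {e. d + 1 \<le> partial_degree Y e}" using e by (cases b) (auto simp: B_def split: if_splits)
      then obtain g u where g: "g \<in> monomials Y (d + 1)" "e = u + g" using e sub[of "d + 1" e] by blast
      then have "g \<in> B b" using pd_mono[OF g(1)] b by (simp add: monomials_def)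
      then show ?thesis using g by blast
    next
      case False
      then have b: "B b = {e. partial_degree Y e = 0}" using e by (cases b) (auto simp: B_def split: if_splits)
      then have "0 \<in> B b" by (simp add: partial_degree_def)
      then show ?thesis by (intro bexI[of _ 0] conjI exI[of _ e]) auto
    qed
  qed
  let ?M = "max_ideal_module :: (('n, 'k) mpoly, ('n, 'k) mpoly) graded_module"
  have dims: "vectorspace.dim class_ring (component_space N.M k) = vectorspace.dim class_ring (component_space ?M k)" for k
  proof (cases "k < 0")
    case True
    then have "(SIGMA b : {b. B b \<noteq> {}}. {e \<in> B b. int (total_degree e) + int (fst b) = k}) = {}"
      "{e :: 'n \<Rightarrow>\<^sub>0 nat. e \<noteq> 0 \<and> int (total_degree e) = k} = {}" by auto
    then show ?thesis unfolding N.dim_component_M max_ideal_component_dim by (simp only: card.empty)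
  next
    case False
    then obtain j where k: "k = int j" by (metis nonneg_int_cases not_less)
    let ?z = "\<lambda>i. int (card (monomials (- Y) i))" and ?y = "\<lambda>i. int (card (monomials Y i))"
    have fin: "finite {e. e \<in> B b \<and> int (total_degree e) + int (fst b) = k}" for b
      by (rule finite_subset[OF _ finite_total_degree[of "nat (k - int (fst b))"]]) auto
    have "(SIGMA b : {b. B b \<noteq> {}}. {e \<in> B b. int (total_degree e) + int (fst b) = k}) =
        (SIGMA b : insert (0, 0) I. {e \<in> B b. int (total_degree e) + int (fst b) = k})"
      using supp by auto
    then have "card (SIGMA b : {b. B b \<noteq> {}}. {e \<in> B b. int (total_degree e) + int (fst b) = k}) =
        (\<Sum>b\<in>insert (0, 0) I. card {e \<in> B b. int (total_degree e) + int (fst b) = k})"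
      using fin by (simp add: card_SigmaI I_def)
    also have "\<dots> = card {e \<in> B (0, 0). int (total_degree e) = k} +
        (\<Sum>b\<in>I. card {e \<in> B b. int (total_degree e) + int (fst b) = k})"
      by (subst sum.insert) (auto simp: I_def)
    also have "{e \<in> B (0, 0). int (total_degree e) = k} = {e. total_degree e = j \<and> d + 1 \<le> partial_degree Y e}"
      by (auto simp: B_def k)
    also have "(\<Sum>b\<in>I. card {e \<in> B b. int (total_degree e) + int (fst b) = k}) =
        (\<Sum>i=1..d. \<Sum>t<c i. card {e \<in> B (i, t). int (total_degree e) + int i = k})"
      unfolding I_def by (subst sum.Sigma) (auto intro: sum.cong)
    also have "\<dots> = (\<Sum>i=1..d. c i * (if i \<le> j then card (monomials (- Y) (j - i)) else 0))"
    proof (rule sum.cong)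
      fix i assume i: "i \<in> {1..d}"
      have "{e \<in> B (i, t). int (total_degree e) + int i = k} = (if i \<le> j then monomials (- Y) (j - i) else {})"
        if "t < c i" for t
        using i that by (auto simp: B_def k monomials_def partial_degree_def in_keys_iff)
      then show "(\<Sum>t<c i. card {e \<in> B (i, t). int (total_degree e) + int i = k}) =
          c i * (if i \<le> j then card (monomials (- Y) (j - i)) else 0)" by simp
    qed simp
    finally have "int (vectorspace.dim class_ring (component_space N.M k)) =
        int (card {e :: 'n \<Rightarrow>\<^sub>0 nat. total_degree e = j \<and> d + 1 \<le> partial_degree Y e}) +
        (\<Sum>i=1..d. int (c i) * (if i \<le> j then ?z (j - i) else 0))"
      unfolding N.dim_component_M by (simp add: if_distrib cong: if_cong)
    also have "(\<Sum>i=1..d. int (c i) * (if i \<le> j then ?z (j - i) else 0)) =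
        (\<Sum>i | i < d + 1 \<and> i \<le> j. int (c i) * ?z (j - i))"
    proof -
      have "(\<Sum>i=1..d. int (c i) * (if i \<le> j then ?z (j - i) else 0)) =
          (\<Sum>i\<in>{i. i < d + 1}. int (c i) * (if i \<le> j then ?z (j - i) else 0))"
        by (rule sum.mono_neutral_left) (auto simp: c0 not_le)
      also have "\<dots> = (\<Sum>i | i < d + 1 \<and> i \<le> j. int (c i) * ?z (j - i))"
        by (rule sum.mono_neutral_cong_right) auto
      finally show ?thesis .
    qed
    also have "(\<Sum>i | i < d + 1 \<and> i \<le> j. int (c i) * ?z (j - i)) =
        (\<Sum>i | i < d + 1 \<and> i \<le> j. ?y i * ?z (j - i)) -
        (\<Sum>i | i < d + 1 \<and> i \<le> j. (- 1) ^ i * int (d choose i) * ?z (j - i))"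
      by (simp add: c left_diff_distrib sum_subtractf)
    also have "(\<Sum>i | i < d + 1 \<and> i \<le> j. (- 1) ^ i * int (d choose i) * ?z (j - i)) =
        (\<Sum>i\<le>j. (- 1) ^ i * int (d choose i) * ?z (j - i))"
      by (rule sum.mono_neutral_left) (auto simp: binomial_eq_0)
    also have "\<dots> = (if j = 0 then 1 else 0)" using alternating_monomials_sum[of "- Y" j] unfolding Z .
    finally have "int (vectorspace.dim class_ring (component_space N.M k)) =
        int (card (monomials (UNIV :: 'n set) j)) - (if j = 0 then 1 else 0)"
      unfolding card_high_partial_degree by simp
    then show ?thesis unfolding k max_ideal_component_dim_nat by (simp add: monomials_0 split: if_splits)
  qed
  obtain zs where zs: "set zs = - Y" "distinct zs" using finite_distinct_list[of "- Y"] by auto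
  then have len: "length zs = d" using Z distinct_card by metis
  have "regular_sequence N.M (map Var zs)"
  proof (rule N.regular_sequence_Vars[OF _ zs(2)])
    show "Poly_Mapping.single z 1 + e \<in> B b \<longleftrightarrow> e \<in> B b" if "z \<in> set zs" for z b e
    proof -
      have "partial_degree Y (Poly_Mapping.single z 1) = 0"
        unfolding partial_degree_def using that zs(1) by (intro sum.neutral) (auto simp: lookup_single when_def)
      then show ?thesis by (cases b) (simp add: B_def pd_add)
    qed
    \<comment> \<open>The generator 1 of a summand that starts in degree 1 is no multiple of a variable; \<open>c 1 = n\<close> is positive.\<close>
    show "0 \<in> B (1, 0)" using c1 nd(2) by (auto simp: B_def partial_degree_def)
  qed simp
  moreover have "set (map Var zs :: ('n, 'k) mpoly list) \<subseteq> max_ideal"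
    unfolding max_ideal_def using ring.genideal_self[OF class_ring.ring_axioms, of "range Var"] by auto
  ultimately have "enat d \<in> {enat (length rs) | rs. set rs \<subseteq> max_ideal \<and> regular_sequence N.M rs}"
    using len by (intro CollectI exI[of _ "map Var zs"]) simp
  then have "enat d \<le> depth N.M" unfolding depth_def by (auto intro: Sup_upper)
  moreover have "hilbert_series N.M = hilbert_series ?M"
    using dims hilbert_series_eq_iff_dim[OF N.graded_module_M fg graded_module_max_ideal finitely_generated_max_ideal] by blast
  ultimately show ?thesis using N.graded_module_M fg unfolding d_def n_def by blast
qed

theorem corollary3p8:
  assumes "infinite (UNIV :: 'k::field set)"
    and "card (UNIV :: 'n::finite set) \<ge> 2"
  shows "hdepth (max_ideal_module :: (('n, 'k) mpoly, ('n, 'k) mpoly) graded_module) =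
    enat (nat \<lceil>real CARD('n) / 2\<rceil>)"
proof -
  let ?M = "max_ideal_module :: (('n, 'k) mpoly, ('n, 'k) mpoly) graded_module"
  have ceil: "nat \<lceil>real CARD('n) / 2\<rceil> = (CARD('n) + 1) div 2"
    by linarith
  obtain N :: "(('n, 'k) mpoly, nat \<times> nat \<Rightarrow> ('n, 'k) mpoly) graded_module"
    where N: "graded_module N" "finitely_generated N" "hilbert_series N = hilbert_series ?M"
      "enat ((CARD('n) + 1) div 2) \<le> depth N"
    using exists_module_of_depth_ge_half[where 'n = 'n and 'k = 'k, OF assms(2)] by blast
  obtain N' :: "(('n, 'k) mpoly, nat \<Rightarrow>\<^sub>0 ('n, 'k) mpoly) graded_module"
    where N': "graded_module N'" "finitely_generated N'" "hilbert_series N' = hilbert_series ?M" "depth N' = depth N"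
    using exists_copy[OF N(1,2)] N(3) by metis
  show ?thesis
    unfolding hdepth_def ceil
  proof (rule antisym)
    show "Sup {depth N | N :: (('n, 'k) mpoly, nat \<Rightarrow>\<^sub>0 ('n, 'k) mpoly) graded_module.
        graded_module N \<and> finitely_generated N \<and> hilbert_series N = hilbert_series ?M}
      \<le> enat ((CARD('n) + 1) div 2)"
      by (rule Sup_least) (use depth_le_half_of_hilbert_series[OF assms(1)] in blast)
    have "depth N' \<le> Sup {depth N | N :: (('n, 'k) mpoly, nat \<Rightarrow>\<^sub>0 ('n, 'k) mpoly) graded_module.
        graded_module N \<and> finitely_generated N \<and> hilbert_series N = hilbert_series ?M}"
      using N' by (intro Sup_upper) blast
    then show "enat ((CARD('n) + 1) div 2) \<le> Sup {depth N | N :: (('n, 'k) mpoly, nat \<Rightarrow>\<^sub>0 ('n, 'k) mpoly) graded_module.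
        graded_module N \<and> finitely_generated N \<and> hilbert_series N = hilbert_series ?M}"
      using N(4) N'(4) by simp
  qed
qed

end
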